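(* The short exact sequence of $\mathcal{O}_K$-modules $$0 \rightarrow \text{End}(F) \rightarrow \mathscr{A} \rightarrow \mathscr{C}' \rightarrow 0,$$ where $\text{End}(F)\rightarrow\mathscr{A}$ is the inclusion and $\mathscr{A}\rightarrow\mathscr{C}'$ is $f\mapsto \log_F(\phi(f))$, is exact and splits.
   Context: $K$ is a finite extension of $\mathbb{Q}_p$ with ring of integers $\mathcal{O}_K$, uniformizer $\pi$, and residue field of size $q$; assume $q>2$. $F$ is a Lubin-Tate formal group law over $\mathcal{O}_K$ attached to $\pi$, with endomorphisms $[a](x)$ for $a\in\mathcal{O}_K$, $x\oplus y=F(x,y)$, $\ominus$ the corresponding subtraction, and $\log_F,\exp_F$ its logarithm and exponential. $\mathfrak{F}_0$ denotes the kernel of $[\pi](x)$ (the $0$-th level torsion points). $\sum^{\text{LT}}$ denotes summation using $\oplus$. $\mathscr{A}$ is the set of $f\in\mathcal{O}_K[[x]]$ with $|f(0)|<1$ satisfying $\sum^{\text{LT}}_{z\in\mathfrak{F}_0} f(x\oplus z) = [q/\pi](f([\pi](x)))$; it is an $\mathcal{O}_K$-module with addition $f_1\oplus f_2=F(f_1(x),f_2(x))$ and $a\cdot f=[a](f(x))$, and $\text{End}(F)=\{[a](x)\}$ is a submodule. $\phi(f)=[\pi](f(x))\ominus f([\pi](x))$. Coleman's trace operator $\mathscr{L}$ is the unique operator on power series with $\mathscr{L}(f)([\pi](x))=\sum_{z\in\mathfrak{F}_0} f(x\oplus z)$. $\mathscr{C}$ is the set of $g\in\pi\mathcal{O}_K[[x]]$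 with $\mathscr{L}(g)=0$ (an $\mathcal{O}_K$-module under ordinary addition and scalar multiplication), and $\mathscr{C}'=\{g\in\mathscr{C}: g'(0)=0\}$. *)

theory Defs
  imports
    "HOL-Analysis.Analysis"
    "HOL-Computational_Algebra.Computational_Algebra"
    "HOL-Algebra.Algebra"
    "HOL-Algebra.Algebraic_Closure_Type"
begin

text \<open>
  Fields with a nonarchimedean absolute value, given as the distance to 0. (The library restricts
  \<open>norm\<close> to real vector spaces.)
\<close>

class nonarch_field = field_char_0 + metric_space +
  assumes dist_diff_zero: "dist x y = dist (x - y) 0"
    and dist_mult_zero: "dist (x * y) 0 = dist x 0 * dist y 0"
    and dist_add_zero_le: "dist (x + y) 0 \<le> max (dist x 0) (dist y 0)"

definition absval :: "'c::nonarch_field \<Rightarrow> real" where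
  "absval x = dist x 0"

text \<open>
  All fields are subfields of an ambient complete, algebraically closed field of sort
  \<open>{nonarch_field, alg_closed_field, complete_space}\<close> in which \<open>p\<close> has absolute value
  \<open>1/p\<close> (for instance the completion of an algebraic closure of the p-adic numbers). The absolute value
  then restricts to the p-adic absolute value on the rationals, and since the ambient field is complete,
  the closure of the rationals in it is their completion.
\<close>

definition padic_numbers :: "'c::nonarch_field set" where
  "padic_numbers = closure \<rat>"

definition finite_padic_extension :: "nat \<Rightarrow> 'c::nonarch_field set \<Rightarrow> bool" where
  "finite_padic_extension p K \<longleftrightarrow>
     Factorial_Ring.prime p \<and> absval (of_nat p :: 'c) = 1 / real p \<and>
     subfield K ring_of_type_algebra \<and> padic_numbers \<subseteq> K \<and>
     (\<exists>B. finite B \<and> B \<subseteq> K \<and>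
        (\<forall>x\<in>K. \<exists>c. (\<forall>b\<in>B. c b \<in> padic_numbers) \<and> x = (\<Sum>b\<in>B. c b * b)))"

definition ring_of_integers :: "'c::nonarch_field set \<Rightarrow> 'c ring" where
  "ring_of_integers K = ring_of_type_algebra\<lparr>carrier := {x \<in> K. absval x \<le> 1}\<rparr>"

definition max_ideal :: "'c::nonarch_field set \<Rightarrow> 'c set" where
  "max_ideal K = {x \<in> K. absval x < 1}"

definition uniformizer :: "'c::nonarch_field set \<Rightarrow> 'c \<Rightarrow> bool" where
  "uniformizer K \<pi> \<longleftrightarrow> \<pi> \<in> carrier (ring_of_integers K) \<and> PIdl\<^bsub>ring_of_integers K\<^esub> \<pi> = max_ideal K"

definition residue_card :: "'c::nonarch_field set \<Rightarrow> nat" where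
  "residue_card K = card (carrier (ring_of_integers K Quot max_ideal K))"

definition int_fps :: "'c::nonarch_field set \<Rightarrow> 'c fps set" where
  "int_fps K = {f. \<forall>n. fps_nth f n \<in> carrier (ring_of_integers K)}"

definition scaled_int_fps :: "'c::nonarch_field set \<Rightarrow> 'c \<Rightarrow> 'c fps set" where
  "scaled_int_fps K \<pi> = {fps_const \<pi> * h | h. h \<in> int_fps K}"

text \<open>
  Substitution into power series. Unlike for \<^const>\<open>fps_compose\<close>, the constant terms of the series
  \<open>u\<close> and \<open>v\<close> that are substituted may be nonzero (of absolute value less than 1); each coefficient of the
  result is an infinite sum in the ambient field.
  A series in two variables \<open>x\<close>, \<open>y\<close> is an element \<open>F\<close> of type \<open>'c fps fps\<close> where \<open>F $ i $ j\<close> is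
  the coefficient of \<open>x^i y^j\<close>.
\<close>

definition fps_subst :: "'c::nonarch_field fps \<Rightarrow> 'c fps \<Rightarrow> 'c fps" where
  "fps_subst f u = Abs_fps (\<lambda>n. infsum (\<lambda>k. fps_nth f k * fps_nth (u ^ k) n) UNIV)"

definition fps_subst2 :: "'c::nonarch_field fps fps \<Rightarrow> 'c fps \<Rightarrow> 'c fps \<Rightarrow> 'c fps" where
  "fps_subst2 F u v = Abs_fps (\<lambda>n.
     infsum (\<lambda>(i, j). fps_nth (fps_nth F i) j * fps_nth (u ^ i * v ^ j) n) UNIV)"

text \<open>
  The formal composites \<open>g(F(x,y))\<close> and \<open>F(g(x),h(y))\<close>, where \<open>F\<close>, \<open>g\<close>, \<open>h\<close> have zero constant
  term: the omitted summands vanish, because \<open>F^k\<close> has no terms of total degree below \<open>k\<close>.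
\<close>

definition comp_outer :: "'c::comm_ring_1 fps \<Rightarrow> 'c fps fps \<Rightarrow> 'c fps fps" where
  "comp_outer g F = Abs_fps (\<lambda>i. Abs_fps (\<lambda>j.
     \<Sum>k\<le>i + j. fps_nth g k * fps_nth (fps_nth (F ^ k) i) j))"

definition comp_inner :: "'c::comm_ring_1 fps fps \<Rightarrow> 'c fps \<Rightarrow> 'c fps \<Rightarrow> 'c fps fps" where
  "comp_inner F g h = Abs_fps (\<lambda>i. Abs_fps (\<lambda>j.
     \<Sum>k\<le>i. \<Sum>l\<le>j. fps_nth (fps_nth F k) l * fps_nth (g ^ k) i * fps_nth (h ^ l) j))"

text \<open>
  In the associativity law, the two sides are the coefficients of \<open>x^i y^j z^k\<close> in
  \<open>F(F(x,y),z)\<close> and \<open>F(x,F(y,z))\<close>.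
\<close>

definition formal_group_law :: "'c::nonarch_field set \<Rightarrow> 'c fps fps \<Rightarrow> bool" where
  "formal_group_law K F \<longleftrightarrow>
     (\<forall>i j. fps_nth (fps_nth F i) j \<in> carrier (ring_of_integers K)) \<and>
     (\<forall>i. fps_nth (fps_nth F i) 0 = (if i = 1 then 1 else 0)) \<and>
     (\<forall>j. fps_nth (fps_nth F 0) j = (if j = 1 then 1 else 0)) \<and>
     (\<forall>i j. fps_nth (fps_nth F i) j = fps_nth (fps_nth F j) i) \<and>
     (\<forall>i j k. (\<Sum>m\<le>i + j. fps_nth (fps_nth F m) k * fps_nth (fps_nth (F ^ m) i) j) =
              (\<Sum>m\<le>j + k. fps_nth (fps_nth F i) m * fps_nth (fps_nth (F ^ m) j) k))"

definition formal_endomorphism :: "'c::nonarch_field set \<Rightarrow> 'c fps fps \<Rightarrow> 'c fps \<Rightarrow> bool" where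
  "formal_endomorphism K F g \<longleftrightarrow>
     g \<in> int_fps K \<and> fps_nth g 0 = 0 \<and> comp_outer g F = comp_inner F g g"

text \<open>
  A Lubin-Tate formal group law attached to \<open>\<pi>\<close> is a formal module \<open>(F, br)\<close> over the ring of
  integers, where \<open>br a\<close> is the endomorphism \<open>[a](x) = a x + ...\<close>, such that \<open>[\<pi>](x)\<close> is congruent
  to \<open>x^q\<close> modulo \<open>\<pi>\<close>.
\<close>

definition lubin_tate ::
    "'c::nonarch_field set \<Rightarrow> 'c \<Rightarrow> 'c fps fps \<Rightarrow> ('c \<Rightarrow> 'c fps) \<Rightarrow> bool" where
  "lubin_tate K \<pi> F br \<longleftrightarrow>
     formal_group_law K F \<and>
     (\<forall>a\<in>carrier (ring_of_integers K). formal_endomorphism K F (br a) \<and> fps_nth (br a) 1 = a) \<and>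
     br 1 = fps_X \<and>
     (\<forall>a\<in>carrier (ring_of_integers K). \<forall>b\<in>carrier (ring_of_integers K).
        br (a + b) = fps_subst2 F (br a) (br b) \<and> br (a * b) = fps_compose (br a) (br b)) \<and>
     br \<pi> - fps_X ^ residue_card K \<in> scaled_int_fps K \<pi>"

definition formal_log :: "'c::nonarch_field fps fps \<Rightarrow> 'c fps" where
  "formal_log F = (THE l. fps_nth l 0 = 0 \<and> fps_nth l 1 = 1 \<and>
     (\<forall>i j. fps_nth (fps_nth (comp_outer l F) i) j =
        (if j = 0 then fps_nth l i else 0) + (if i = 0 then fps_nth l j else 0)))"

text \<open>
  The points of \<open>F\<close> in the power series with integral coefficients in the ambient field and constant
  term of absolute value less than 1. The fields \<open>mult\<close> and \<open>one\<close> of a module record have no meaning.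
\<close>

definition lt_points ::
    "'c::nonarch_field fps fps \<Rightarrow> ('c \<Rightarrow> 'c fps) \<Rightarrow> ('c, 'c fps) module" where
  "lt_points F br =
     \<lparr>carrier = {u. (\<forall>n. absval (fps_nth u n) \<le> 1) \<and> absval (fps_nth u 0) < 1},
      mult = undefined, one = undefined, ring.zero = 0, ring.add = fps_subst2 F,
      smult = (\<lambda>a u. fps_subst (br a) u)\<rparr>"

definition lt_minus ::
    "'c::nonarch_field fps fps \<Rightarrow> ('c \<Rightarrow> 'c fps) \<Rightarrow> 'c fps \<Rightarrow> 'c fps \<Rightarrow> 'c fps" where
  "lt_minus F br u v = fps_subst2 F u (fps_subst (br (-1)) v)"

definition torsion0 :: "'c::nonarch_field \<Rightarrow> ('c \<Rightarrow> 'c fps) \<Rightarrow> 'c set" where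
  "torsion0 \<pi> br = {z. absval z < 1 \<and> ((\<lambda>n. fps_nth (br \<pi>) n * z ^ n) has_sum 0) UNIV}"

text \<open>\<open>f(x \<oplus> z)\<close>\<close>

definition lt_translate ::
    "'c::nonarch_field fps fps \<Rightarrow> 'c fps \<Rightarrow> 'c \<Rightarrow> 'c fps" where
  "lt_translate F f z = fps_subst f (fps_subst2 F fps_X (fps_const z))"

definition End_set :: "'c::nonarch_field set \<Rightarrow> ('c \<Rightarrow> 'c fps) \<Rightarrow> 'c fps set" where
  "End_set K br = br ` carrier (ring_of_integers K)"

definition A_set ::
    "'c::nonarch_field set \<Rightarrow> 'c \<Rightarrow> 'c fps fps \<Rightarrow> ('c \<Rightarrow> 'c fps) \<Rightarrow> 'c fps set" where
  "A_set K \<pi> F br = {f \<in> int_fps K. absval (fps_nth f 0) < 1 \<and>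
     finsum (lt_points F br) (lt_translate F f) (torsion0 \<pi> br) =
       fps_subst (br (of_nat (residue_card K) / \<pi>)) (fps_compose f (br \<pi>))}"

definition coleman_trace ::
    "'c::nonarch_field \<Rightarrow> 'c fps fps \<Rightarrow> ('c \<Rightarrow> 'c fps) \<Rightarrow> 'c fps \<Rightarrow> 'c fps" where
  "coleman_trace \<pi> F br f =
     (THE h. fps_compose h (br \<pi>) = (\<Sum>z\<in>torsion0 \<pi> br. lt_translate F f z))"

definition C_set ::
    "'c::nonarch_field set \<Rightarrow> 'c \<Rightarrow> 'c fps fps \<Rightarrow> ('c \<Rightarrow> 'c fps) \<Rightarrow> 'c fps set" where
  "C_set K \<pi> F br = {g \<in> scaled_int_fps K \<pi>. coleman_trace \<pi> F br g = 0}"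

definition C'_set ::
    "'c::nonarch_field set \<Rightarrow> 'c \<Rightarrow> 'c fps fps \<Rightarrow> ('c \<Rightarrow> 'c fps) \<Rightarrow> 'c fps set" where
  "C'_set K \<pi> F br = {g \<in> C_set K \<pi> F br. fps_nth (fps_deriv g) 0 = 0}"

definition End_module ::
    "'c::nonarch_field set \<Rightarrow> 'c fps fps \<Rightarrow> ('c \<Rightarrow> 'c fps) \<Rightarrow> ('c, 'c fps) module" where
  "End_module K F br = lt_points F br\<lparr>carrier := End_set K br\<rparr>"

definition A_module ::
    "'c::nonarch_field set \<Rightarrow> 'c \<Rightarrow> 'c fps fps \<Rightarrow> ('c \<Rightarrow> 'c fps) \<Rightarrow> ('c, 'c fps) module" where
  "A_module K \<pi> F br = lt_points F br\<lparr>carrier := A_set K \<pi> F br\<rparr>"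

definition C'_module ::
    "'c::nonarch_field set \<Rightarrow> 'c \<Rightarrow> 'c fps fps \<Rightarrow> ('c \<Rightarrow> 'c fps) \<Rightarrow> ('c, 'c fps) module" where
  "C'_module K \<pi> F br =
     \<lparr>carrier = C'_set K \<pi> F br, mult = undefined, one = undefined, ring.zero = 0, ring.add = (+),
      smult = (\<lambda>a g. fps_const a * g)\<rparr>"

definition lt_phi ::
    "'c::nonarch_field \<Rightarrow> 'c fps fps \<Rightarrow> ('c \<Rightarrow> 'c fps) \<Rightarrow> 'c fps \<Rightarrow> 'c fps" where
  "lt_phi \<pi> F br f = lt_minus F br (fps_subst (br \<pi>) f) (fps_compose f (br \<pi>))"

definition linear_map ::
    "('a, 'r) ring_scheme \<Rightarrow> ('a, 'm, 's) module_scheme \<Rightarrow> ('a, 'n, 't) module_scheme \<Rightarrow>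
     ('m \<Rightarrow> 'n) \<Rightarrow> bool" where
  "linear_map R M N f \<longleftrightarrow>
     f \<in> carrier M \<rightarrow> carrier N \<and>
     (\<forall>x\<in>carrier M. \<forall>y\<in>carrier M. f (x \<oplus>\<^bsub>M\<^esub> y) = f x \<oplus>\<^bsub>N\<^esub> f y) \<and>
     (\<forall>a\<in>carrier R. \<forall>x\<in>carrier M. f (a \<odot>\<^bsub>M\<^esub> x) = a \<odot>\<^bsub>N\<^esub> f x)"

text \<open>The locale \<open>Module.module\<close> of HOL-Algebra is meant, not \<open>Modules.module\<close> of HOL.\<close>

definition module_short_exact ::
    "('a, 'r) ring_scheme \<Rightarrow> ('a, 'l, 's) module_scheme \<Rightarrow> ('a, 'm, 't) module_scheme \<Rightarrow>
     ('a, 'n, 'u) module_scheme \<Rightarrow> ('l \<Rightarrow> 'm) \<Rightarrow> ('m \<Rightarrow> 'n) \<Rightarrow> bool" where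
  "module_short_exact R L M N i h \<longleftrightarrow>
     Module.module R L \<and> Module.module R M \<and> Module.module R N \<and>
     linear_map R L M i \<and> linear_map R M N h \<and>
     inj_on i (carrier L) \<and>
     i ` carrier L = {x \<in> carrier M. h x = \<zero>\<^bsub>N\<^esub>} \<and>
     h ` carrier M = carrier N"

definition split_by_section ::
    "('a, 'r) ring_scheme \<Rightarrow> ('a, 'm, 't) module_scheme \<Rightarrow> ('a, 'n, 'u) module_scheme \<Rightarrow>
     ('m \<Rightarrow> 'n) \<Rightarrow> bool" where
  "split_by_section R M N h \<longleftrightarrow> (\<exists>s. linear_map R N M s \<and> (\<forall>y\<in>carrier N. h (s y) = y))"

end

theory Submission
  imports Defs
begin

unbundle no vec_syntax
unbundle fps_syntax

text \<open>
  Write \<open>\<Lambda> f\<close> for \<open>log\<^sub>F \<circ> f\<close> and \<open>H = [\<pi>]\<close>. On points \<open>\<Lambda>\<close> is additive, so the map of the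
  sequence is \<open>f \<mapsto> \<pi> \<Lambda> f - \<Lambda> f \<circ> H\<close>. Its values are divisible by \<open>\<pi>\<close> because
  \<open>[\<pi>](f(x)) \<equiv> f([\<pi>](x))\<close> modulo \<open>\<pi>\<close>; and since translation by a torsion point does not change \<open>H\<close> and
  there are \<open>q\<close> torsion points, the trace of the image of \<open>f\<close> is \<open>\<pi>\<close> times \<open>\<Lambda>\<close> of the difference of the
  two sides of the equation that defines \<open>\<A>\<close>.

  The equation \<open>\<pi> l - l \<circ> H = g\<close> determines every coefficient of \<open>l\<close> except the linear one, on
  which it says that \<open>g\<close> has none. For \<open>g = 0\<close> this gives \<open>\<Lambda> f = a log\<^sub>F\<close>, hence \<open>f = [a]\<close>. For \<open>g\<close> in
  \<open>\<C>'\<close>, take the solution \<open>l\<close> without linear term. Honda's argument shows that \<open>l = \<Lambda> f\<close> for an integral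
  \<open>f\<close> without linear term. The two sides of the trace equation for \<open>f\<close> then have the same logarithm,
  and the constant term of their difference lies in the open disc below the radius of the torsion points,
  where the logarithm is injective; so \<open>f\<close> lies in \<open>\<A>\<close>. The section sends \<open>g\<close> to the unique preimage
  \<open>f\<close> for which \<open>\<Lambda> f\<close> has no linear term.
\<close>

subsection \<open>Nonarchimedean absolute values\<close>

text \<open>Points may have a nonzero constant term, so each substitution is a convergent series in
  the ambient field and formal identities do not transfer by themselves. Both sides of a
  substitution law are written as iterated sums of one family of series, and the order of summation
  is interchanged; in a complete nonarchimedean field this only requires the terms to tend to 0.
  Coefficients stay in \<open>K\<close> because \<open>K\<close> is closed.

  The linear coefficient is exceptional because \<open>\<pi> - \<pi>^n\<close> vanishes only for
  \<open>n = 1\<close>; for \<open>n \<ge> 2\<close> it is \<open>\<pi>\<close> times a unit, which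
  integrality requires. Omitting the linear term also settles the trace equation. That equation is
  first known only after applying the logarithm, which kills torsion; but a series without constant
  and linear term has size at most \<open>|z|^2\<close> at a torsion point \<open>z\<close>, and
  \<open>|z|^(q - 1) \<le> |\<pi>|\<close> then puts the value strictly inside the torsion radius.

  The assumption \<open>q > 2\<close> provides a unit \<open>a\<close> for which
  \<open>a - 1\<close> is a unit, so that the torsion points sum to 0 and \<open>End(F)\<close> lies
  in the middle module; it also makes the logarithm close to the identity on the disc of radius
  \<open>|\<pi>|\<close>.\<close>

lemma dist_eq_absval: "dist x y = absval (x - y)"
  unfolding absval_def by (rule dist_diff_zero)

lemma absval_zero [simp]: "absval 0 = 0"
  by (simp add: absval_def)

lemma absval_nonneg [simp]: "absval x \<ge> 0"
  by (simp add: absval_def)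

lemma absval_eq_0_iff [simp]: "absval x = 0 \<longleftrightarrow> x = 0"
  by (simp add: absval_def)

lemma absval_pos_iff [simp]: "absval x > 0 \<longleftrightarrow> x \<noteq> 0"
  by (simp add: absval_def)

lemma absval_mult: "absval (x * y) = absval x * absval y"
  unfolding absval_def by (rule dist_mult_zero)

lemma absval_add_le: "absval (x + y) \<le> max (absval x) (absval y)"
  unfolding absval_def by (rule dist_add_zero_le)

lemma absval_one [simp]: "absval 1 = 1"
  using absval_mult[of 1 1] by simp

text \<open>This is the symmetry of \<open>dist\<close>, read off from
  \<open>dist 0 x = dist x 0\<close>.\<close>

lemma absval_minus [simp]: "absval (- x) = absval x"
  using dist_eq_absval[of 0 x] dist_eq_absval[of x 0] by (simp add: dist_commute)

lemma absval_minus_commute: "absval (x - y) = absval (y - x)"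
  by (metis absval_minus minus_diff_eq)

lemma absval_diff_le: "absval (x - y) \<le> max (absval x) (absval y)"
  using absval_add_le[of x "- y"] by simp

lemma absval_power: "absval (x ^ n) = absval x ^ n"
  by (induction n) (auto simp: absval_mult)

lemma absval_inverse: "absval (inverse x) = inverse (absval x)"
proof (cases "x = 0")
  case False
  then have "absval x * absval (inverse x) = 1"
    by (simp flip: absval_mult)
  then show ?thesis
    by (metis inverse_unique)
qed auto

lemma absval_divide: "absval (x / y) = absval x / absval y"
  by (simp add: divide_inverse absval_mult absval_inverse)

lemma absval_add_bound: "absval x \<le> B \<Longrightarrow> absval y \<le> B \<Longrightarrow> absval (x + y) \<le> B"
  using absval_add_le[of x y] by linarith

lemma absval_diff_bound: "absval x \<le> B \<Longrightarrow> absval y \<le> B \<Longrightarrow> absval (x - y) \<le> B"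
  using absval_diff_le[of x y] by linarith

lemma absval_sum_le:
  assumes "\<And>i. i \<in> A \<Longrightarrow> absval (f i) \<le> B" "B \<ge> 0"
  shows "absval (sum f A) \<le> B"
  using assms by (induction A rule: infinite_finite_induct) (auto intro!: absval_add_bound)

lemma absval_of_nat_le [simp]: "absval (of_nat n) \<le> 1"
  by (induction n) (auto intro!: absval_add_bound)

text \<open>Since \<open>y\<close> is the difference of \<open>x + y\<close> and \<open>x\<close>, a
  value of the sum below \<open>absval y\<close> would contradict the ultrametric
  inequality.\<close>

lemma absval_add_eq: "absval x < absval y \<Longrightarrow> absval (x + y) = absval y"
  using absval_add_le[of x y] absval_diff_le[of "x + y" x] by simp

lemma absval_mult_le_one: "absval x \<le> 1 \<Longrightarrow> absval y \<le> 1 \<Longrightarrow> absval (x * y) \<le> 1"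
  by (simp add: absval_mult mult_le_one)

text \<open>This instance and the next one make the general laws of \<open>has_sum\<close> for
  addition and for multiplication by constants applicable.\<close>

instance nonarch_field \<subseteq> topological_ab_group_add
proof
  show "LIM x (nhds a \<times>\<^sub>F nhds b). fst x + snd x :> nhds (a + b)" for a b :: 'a
    unfolding tendsto_iff
  proof (intro allI impI)
    fix e :: real assume e: "e > 0"
    have "\<forall>\<^sub>F x in nhds a \<times>\<^sub>F nhds b. dist (fst x) a < e \<and> dist (snd x) b < e"
      unfolding eventually_prod_filter using e
      by (intro exI[of _ "\<lambda>x. dist x a < e"] exI[of _ "\<lambda>x. dist x b < e"]) (auto simp: eventually_nhds_metric)
    then show "\<forall>\<^sub>F x in nhds a \<times>\<^sub>F nhds b. dist (fst x + snd x) (a + b) < e"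
    proof eventually_elim
      case (elim x)
      have "absval ((fst x - a) + (snd x - b)) \<le> max (absval (fst x - a)) (absval (snd x - b))"
        by (rule absval_add_le)
      moreover have "fst x + snd x - (a + b) = (fst x - a) + (snd x - b)" by simp
      ultimately show ?case
        using elim unfolding dist_eq_absval by (metis le_less_trans max_less_iff_conj)
    qed
  qed
  show "(uminus \<longlongrightarrow> - a) (nhds a)" for a :: 'a
    unfolding tendsto_iff
  proof (intro allI impI)
    fix e :: real assume e: "e > 0"
    then have "\<forall>\<^sub>F x in nhds a. dist x a < e"
      by (auto simp: eventually_nhds_metric)
    then show "\<forall>\<^sub>F x in nhds a. dist (- x) (- a) < e"
      by eventually_elim (simp add: dist_eq_absval absval_minus_commute)
  qed
qed

instance nonarch_field \<subseteq> topological_monoid_mult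
proof
  show "LIM x (nhds a \<times>\<^sub>F nhds b). fst x * snd x :> nhds (a * b)" for a b :: 'a
    unfolding tendsto_iff
  proof (intro allI impI)
    fix e :: real assume e: "e > 0"
    \<comment> \<open>With both errors below \<open>d \<le> 1\<close>, each of the three terms
      \<open>s * t\<close>, \<open>s * b\<close>, \<open>a * t\<close> is below
      \<open>d * (1 + max (absval a) (absval b))\<close>.\<close>
    define d where "d = min 1 (e / (1 + max (absval a) (absval b)))"
    have M: "1 + max (absval a) (absval b) > 0"
      by (smt (verit) absval_nonneg)
    with e have d: "d > 0" "d \<le> 1" by (auto simp: d_def)
    have de: "d * (1 + max (absval a) (absval b)) \<le> e"
    proof -
      have "d \<le> e / (1 + max (absval a) (absval b))" by (auto simp: d_def)
      then show ?thesis using M by (simp add: pos_le_divide_eq)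
    qed
    have "\<forall>\<^sub>F x in nhds a \<times>\<^sub>F nhds b. dist (fst x) a < d \<and> dist (snd x) b < d"
      unfolding eventually_prod_filter using d
      by (intro exI[of _ "\<lambda>x. dist x a < d"] exI[of _ "\<lambda>x. dist x b < d"]) (auto simp: eventually_nhds_metric)
    then show "\<forall>\<^sub>F x in nhds a \<times>\<^sub>F nhds b. dist (fst x * snd x) (a * b) < e"
    proof eventually_elim
      case (elim x)
      define s t where "s = fst x - a" "t = snd x - b"
      have st: "absval s < d" "absval t < d"
        using elim by (auto simp: s_t_def dist_eq_absval)
      have eq: "fst x * snd x - a * b = s * t + (s * b + a * t)"
        by (simp add: s_t_def algebra_simps)
      have 1: "absval (s * t) < e"
      proof -
        have "absval s * absval t \<le> absval s * 1" using st d by (intro mult_left_mono) auto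
        also have "\<dots> < d * 1" using st by simp
        also have "\<dots> \<le> d * (1 + max (absval a) (absval b))"
          using d by (intro mult_left_mono) (auto simp: le_max_iff_disj)
        finally show ?thesis using de by (simp add: absval_mult)
      qed
      have 2: "absval (s * b) < e"
      proof -
        have "absval s * absval b \<le> d * max (absval a) (absval b)"
          using st d by (intro mult_mono) auto
        also have "\<dots> < d * (1 + max (absval a) (absval b))" using d by simp
        finally show ?thesis using de by (simp add: absval_mult)
      qed
      have 3: "absval (a * t) < e"
      proof -
        have "absval a * absval t \<le> max (absval a) (absval b) * d"
          using st d by (intro mult_mono) (auto simp: le_max_iff_disj)
        also have "\<dots> < d * (1 + max (absval a) (absval b))" using d by simp
        finally show ?thesis using de by (simp add: absval_mult)
      qed
      show ?case
        unfolding dist_eq_absval eq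
        using absval_add_le[of "s * t" "s * b + a * t"] absval_add_le[of "s * b" "a * t"] 1 2 3
        by linarith
    qed
  qed
qed

subsection \<open>Unconditional summation\<close>

text \<open>The terms tend to 0 along the cofinite filter of \<open>A\<close>. In a complete
  nonarchimedean field this is equivalent to unconditional summability, and it can be checked
  directly on a product of index sets.\<close>

definition vanishing :: "('i \<Rightarrow> 'c::nonarch_field) \<Rightarrow> 'i set \<Rightarrow> bool" where
  "vanishing f A \<longleftrightarrow> (\<forall>e>0. finite {i \<in> A. absval (f i) \<ge> e})"

text \<open>Two late partial sums that differ by the single term \<open>f i\<close> are both close
  to the limit.\<close>

lemma summable_imp_vanishing:
  fixes f :: "'i \<Rightarrow> 'c::nonarch_field"
  assumes "f summable_on A"
  shows "vanishing f A"
  unfolding vanishing_def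
proof (intro allI impI)
  fix e :: real assume e: "e > 0"
  obtain s where "(f has_sum s) A" using assms by (auto simp: summable_on_def)
  then have "\<forall>\<^sub>F T in finite_subsets_at_top A. dist (sum f T) s < e"
    using e unfolding has_sum_def tendsto_iff by blast
  then have "\<exists>Y. finite Y \<and> Y \<subseteq> A \<and>
      (\<forall>T. finite T \<and> Y \<subseteq> T \<and> T \<subseteq> A \<longrightarrow> dist (sum f T) s < e)"
    unfolding eventually_finite_subsets_at_top by simp
  then obtain Y where Y: "finite Y" "Y \<subseteq> A"
    "\<And>T. finite T \<Longrightarrow> Y \<subseteq> T \<Longrightarrow> T \<subseteq> A \<Longrightarrow> dist (sum f T) s < e"
    by (elim exE conjE) (rule that, auto)
  have "absval (f i) < e" if "i \<in> A" "i \<notin> Y" for i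
  proof -
    have "dist (sum f (insert i Y)) s < e"
      by (rule Y(3)) (use Y that in auto)
    moreover have "dist (sum f Y) s < e"
      by (rule Y(3)) (use Y in auto)
    ultimately have "absval (sum f (insert i Y) - s) < e" "absval (sum f Y - s) < e"
      by (simp_all only: dist_eq_absval)
    moreover have "f i = (sum f (insert i Y) - s) - (sum f Y - s)"
      using that Y by simp
    ultimately show ?thesis
      using absval_diff_le[of "sum f (insert i Y) - s" "sum f Y - s"] by simp
  qed
  then have "{i \<in> A. absval (f i) \<ge> e} \<subseteq> Y"
    by (auto simp flip: not_less)
  then show "finite {i \<in> A. absval (f i) \<ge> e}"
    using Y(1) finite_subset by blast
qed

text \<open>By the ultrametric inequality a finite sum of terms below \<open>e\<close> is below
  \<open>e\<close>. Hence the sums over the finite sets \<open>S n\<close> of terms of size at least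
  \<open>1 / Suc n\<close> form a Cauchy sequence, and its limit is the sum over all of
  \<open>A\<close>.\<close>

lemma vanishing_imp_summable:
  fixes f :: "'i \<Rightarrow> 'c::{nonarch_field, complete_space}"
  assumes "vanishing f A"
  shows "f summable_on A"
proof -
  define S where "S n = {i \<in> A. absval (f i) \<ge> 1 / real (Suc n)}" for n
  have fin: "finite (S n)" for n
    using assms unfolding vanishing_def S_def by auto
  have close: "absval (sum f T - sum f (S n)) < 1 / real (Suc n)"
    if "finite T" "S n \<subseteq> T" "T \<subseteq> A" for T n
  proof -
    have "sum f T - sum f (S n) = sum f (T - S n)"
      using that by (simp add: sum_diff)
    moreover have "absval (sum f (T - S n)) < 1 / real (Suc n)"
    proof (cases "T - S n = {}")
      case True
      then show ?thesis by (simp only: True sum.empty absval_zero) simp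
    next
      case False
      \<comment> \<open>The maximum of finitely many terms is still strictly below the bound, so the
        nonstrict \<open>absval_sum_le\<close> yields a strict inequality.\<close>
      define B where "B = Max ((absval \<circ> f) ` (T - S n))"
      have fi: "finite ((absval \<circ> f) ` (T - S n))" using that by auto
      have "B \<in> (absval \<circ> f) ` (T - S n)"
        unfolding B_def using False that by (intro Max_in) auto
      then have "B < 1 / real (Suc n)" "B \<ge> 0"
        using that by (auto simp: S_def)
      moreover have "absval (sum f (T - S n)) \<le> B"
        using fi \<open>B \<ge> 0\<close> by (intro absval_sum_le) (auto simp: B_def)
      ultimately show ?thesis by simp
    qed
    ultimately show ?thesis by simp
  qed
  have mono: "S m \<subseteq> S n" if "m \<le> n" for m n
  proof -
    have "1 / real (Suc n) \<le> 1 / real (Suc m)"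
      using that by (intro divide_left_mono) auto
    then show ?thesis by (auto simp: S_def)
  qed
  have "Cauchy (\<lambda>n. sum f (S n))"
    unfolding Cauchy_altdef2
  proof (intro allI impI)
    fix e :: real assume "e > 0"
    then obtain N where N: "1 / real (Suc N) < e"
      using nat_approx_posE by metis
    show "\<exists>N. \<forall>n\<ge>N. dist (sum f (S n)) (sum f (S N)) < e"
    proof (intro exI[of _ N] allI impI)
      fix n assume "n \<ge> N"
      then have "absval (sum f (S n) - sum f (S N)) < 1 / real (Suc N)"
        using fin mono by (intro close) (auto simp: S_def)
      then show "dist (sum f (S n)) (sum f (S N)) < e"
        using N by (simp add: dist_eq_absval)
    qed
  qed
  then obtain s where s: "(\<lambda>n. sum f (S n)) \<longlonglongrightarrow> s"
    using Cauchy_convergent convergent_def by blast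
  have "(f has_sum s) A"
    unfolding has_sum_def tendsto_iff
  proof (intro allI impI)
    fix e :: real assume e: "e > 0"
    obtain N where N: "1 / real (Suc N) < e"
      using nat_approx_posE e by metis
    obtain M where M: "\<And>n. n \<ge> M \<Longrightarrow> absval (sum f (S n) - s) < e"
      using s e unfolding tendsto_iff eventually_sequentially dist_eq_absval by metis
    define k where "k = max M N"
    show "\<forall>\<^sub>F T in finite_subsets_at_top A. dist (sum f T) s < e"
      unfolding eventually_finite_subsets_at_top
    proof (intro exI[of _ "S k"] conjI allI impI)
      show "finite (S k)" "S k \<subseteq> A" using fin by (auto simp: S_def)
      fix T assume T: "finite T \<and> S k \<subseteq> T \<and> T \<subseteq> A"
      have "absval (sum f T - sum f (S k)) < 1 / real (Suc k)"
        using close T by blast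
      also have "\<dots> \<le> 1 / real (Suc N)"
        by (intro divide_left_mono) (auto simp: k_def)
      finally have "absval (sum f T - sum f (S k)) < e" using N by simp
      moreover have "absval (sum f (S k) - s) < e" using M by (simp add: k_def)
      moreover have "sum f T - s = (sum f T - sum f (S k)) + (sum f (S k) - s)" by simp
      ultimately show "dist (sum f T) s < e"
        unfolding dist_eq_absval
        using absval_add_le[of "sum f T - sum f (S k)" "sum f (S k) - s"] by simp
    qed
  qed
  then show ?thesis by (auto simp: summable_on_def)
qed

lemma absval_has_sum_le:
  fixes f :: "'i \<Rightarrow> 'c::nonarch_field"
  assumes "(f has_sum s) A" "\<And>i. i \<in> A \<Longrightarrow> absval (f i) \<le> B" "B \<ge> 0"
  shows "absval s \<le> B"
proof (rule ccontr)
  assume neg: "\<not> absval s \<le> B"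
  then have pos: "absval s > 0" using assms(3) by linarith
  then have "\<forall>\<^sub>F T in finite_subsets_at_top A. dist (sum f T) s < absval s"
    using assms(1) unfolding has_sum_def tendsto_iff by blast
  then obtain T where T: "finite T" "T \<subseteq> A" "dist (sum f T) s < absval s"
    unfolding eventually_finite_subsets_at_top by blast
  have "absval (sum f T) \<le> B"
    using T assms by (intro absval_sum_le) auto
  moreover have "absval s \<le> max (absval (sum f T)) (absval (sum f T - s))"
    using absval_diff_le[of "sum f T" "sum f T - s"] by simp
  ultimately show False
    using neg T(3) unfolding dist_eq_absval by linarith
qed

text \<open>Applied to the closed field \<open>K\<close>, and to the closed ring in which a
  contraction is iterated.\<close>

lemma has_sum_in_closed:
  fixes f :: "'i \<Rightarrow> 'c::{nonarch_field, complete_space}"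
  assumes "(f has_sum s) A" "\<And>i. i \<in> A \<Longrightarrow> f i \<in> K" "closed K"
    "0 \<in> K" "\<And>x y. x \<in> K \<Longrightarrow> y \<in> K \<Longrightarrow> x + y \<in> K"
  shows "s \<in> K"
proof -
  have "sum f T \<in> K" if "T \<subseteq> A" for T
    using that assms(2,4,5) by (induction T rule: infinite_finite_induct) auto
  then have "\<forall>\<^sub>F T in finite_subsets_at_top A. sum f T \<in> K"
    by (auto intro: eventually_finite_subsets_at_top_weakI)
  then show ?thesis
    using assms(1,3) unfolding has_sum_def
    by (intro Lim_in_closed_set[of K "sum f"]) auto
qed

text \<open>The weight \<open>w\<close> plays the role of a total degree: only finitely many indices
  have bounded weight, and the terms decay geometrically in it. The multiple series behind the
  substitution laws are all handled with such a weight.\<close>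

lemma vanishing_geometric:
  assumes "\<And>N. finite {i \<in> A. w i \<le> N}" "0 \<le> t" "t < 1"
    "\<And>i. i \<in> A \<Longrightarrow> absval (f i) \<le> B * t ^ w i"
  shows "vanishing f A"
  unfolding vanishing_def
proof (intro allI impI)
  fix e :: real assume e: "e > 0"
  have "(\<lambda>n. B * t ^ n) \<longlonglongrightarrow> B * 0"
    using assms by (intro tendsto_intros LIMSEQ_realpow_zero) auto
  then obtain N where N: "\<And>n. n \<ge> N \<Longrightarrow> B * t ^ n < e"
    using order_tendstoD(2)[of _ "B * 0" sequentially e] e unfolding eventually_sequentially by auto
  have "{i \<in> A. absval (f i) \<ge> e} \<subseteq> {i \<in> A. w i \<le> N}"
    proof safe
    fix i assume i: "i \<in> A" "e \<le> absval (f i)"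
    then have "\<not> B * t ^ w i < e" using assms(4)[of i] by linarith
    then show "w i \<le> N" using N[of "w i"] by linarith
  qed
  then show "finite {i \<in> A. absval (f i) \<ge> e}"
    using assms(1) finite_subset by blast
qed

lemma has_sum_mult:
  fixes f :: "'i \<Rightarrow> 'c::{nonarch_field, complete_space}" and g :: "'j \<Rightarrow> 'c"
  assumes f: "(f has_sum s) A" and g: "(g has_sum t) B"
  shows "((\<lambda>(i, j). f i * g j) has_sum (s * t)) (A \<times> B)"
proof -
  have bound: "\<exists>M>0. \<forall>i\<in>I. absval (h i) \<le> M" if "vanishing h I"
    for h :: "'k \<Rightarrow> 'c" and I
  proof -
    have fin: "finite {i \<in> I. absval (h i) \<ge> 1}"
      using that unfolding vanishing_def by (meson zero_less_one)
    define M where "M = Max (insert 1 ((absval \<circ> h) ` {i \<in> I. absval (h i) \<ge> 1}))"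
    have "M \<ge> 1" unfolding M_def using fin by (intro Max_ge) auto
    moreover have "absval (h i) \<le> M" if "i \<in> I" for i
    proof (cases "absval (h i) \<ge> 1")
      case True
      then show ?thesis unfolding M_def using fin that by (intro Max_ge) auto
    qed (use \<open>M \<ge> 1\<close> in auto)
    ultimately show ?thesis by (intro exI[of _ M]) auto
  qed
  have vf: "vanishing f A" and vg: "vanishing g B"
    using f g by (auto intro!: summable_imp_vanishing simp: summable_on_def)
  obtain M where M: "M > 0" "\<And>i. i \<in> A \<Longrightarrow> absval (f i) \<le> M" using bound[OF vf] by auto
  obtain N where N: "N > 0" "\<And>i. i \<in> B \<Longrightarrow> absval (g i) \<le> N" using bound[OF vg] by auto
  have van: "vanishing (\<lambda>(i, j). f i * g j) (A \<times> B)"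
    unfolding vanishing_def
  proof (intro allI impI)
    fix e :: real assume e: "e > 0"
    \<comment> \<open>Both families are bounded, by \<open>M\<close> and \<open>N\<close>, so a
      product of size at least \<open>e\<close> needs both factors to be large; this leaves finitely
      many pairs.\<close>
    have "{x \<in> A \<times> B. e \<le> absval (case x of (i, j) \<Rightarrow> f i * g j)} \<subseteq>
      {i \<in> A. absval (f i) \<ge> e / N} \<times> {j \<in> B. absval (g j) \<ge> e / M}"
    proof safe
      fix i j assume ij: "i \<in> A" "j \<in> B" "e \<le> absval (f i * g j)"
      have "e \<le> absval (f i) * absval (g j)" using ij by (simp add: absval_mult)
      also have "\<dots> \<le> absval (f i) * N" using N ij by (intro mult_left_mono) auto
      finally show "e / N \<le> absval (f i)" using N by (simp add: divide_le_eq)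
      have "e \<le> absval (f i) * absval (g j)" using ij by (simp add: absval_mult)
      also have "\<dots> \<le> M * absval (g j)" using M ij by (intro mult_right_mono) auto
      finally show "e / M \<le> absval (g j)" using M by (simp add: divide_le_eq mult.commute)
    qed
    moreover have "finite ({i \<in> A. absval (f i) \<ge> e / N} \<times> {j \<in> B. absval (g j) \<ge> e / M})"
      using vf vg e M N unfolding vanishing_def by (intro finite_cartesian_product) auto
    ultimately show "finite {x \<in> A \<times> B. e \<le> absval (case x of (i, j) \<Rightarrow> f i * g j)}"
      using finite_subset by blast
  qed
  then have "(\<lambda>(i, j). f i * g j) summable_on A \<times> B"
    by (rule vanishing_imp_summable)
  moreover have "((\<lambda>j. f i * g j) has_sum f i * t) B" for i
    using g by (rule has_sum_cmult_right)
  moreover have "((\<lambda>i. f i * t) has_sum s * t) A"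
    using f by (rule has_sum_cmult_left)
  ultimately show ?thesis
    by (intro has_sum_SigmaI) auto
qed

text \<open>Smallness of the terms on the whole product replaces the absolute convergence of the
  classical Fubini argument.\<close>

lemma has_sum_swap:
  fixes a :: "'i \<Rightarrow> 'j \<Rightarrow> 'c::{nonarch_field, complete_space}"
  assumes van: "vanishing (\<lambda>(i, j). a i j) (I \<times> J)"
    and row: "\<And>i. i \<in> I \<Longrightarrow> (a i has_sum R i) J"
    and col: "\<And>j. j \<in> J \<Longrightarrow> ((\<lambda>i. a i j) has_sum C j) I"
    and tot: "(R has_sum S) I"
  shows "(C has_sum S) J"
proof -
  have "((\<lambda>(i, j). a i j) has_sum S) (I \<times> J)"
    using row tot van by (intro has_sum_SigmaI vanishing_imp_summable) auto
  then have "((\<lambda>(j, i). a i j) has_sum S) (J \<times> I)"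
    by (rule has_sum_reindex_bij_witness[of _ prod.swap prod.swap, THEN iffD1, rotated -1]) auto
  then show ?thesis
    by (rule has_sum_SigmaD) (use col in auto)
qed

subsection \<open>Sums of families of power series\<close>

definition fps_has_sum :: "('i \<Rightarrow> 'c::nonarch_field fps) \<Rightarrow> 'i set \<Rightarrow> 'c fps \<Rightarrow> bool" where
  "fps_has_sum a I S \<longleftrightarrow> (\<forall>n. ((\<lambda>i. a i $ n) has_sum S $ n) I)"

lemma fps_has_sumD: "fps_has_sum a I S \<Longrightarrow> ((\<lambda>i. a i $ n) has_sum S $ n) I"
  by (simp add: fps_has_sum_def)

lemma fps_has_sum_unique: "fps_has_sum a I S \<Longrightarrow> fps_has_sum a I T \<Longrightarrow> S = T"
  unfolding fps_has_sum_def fps_eq_iff using has_sum_unique by blast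

lemma has_sum_finite_sum:
  fixes a :: "'k \<Rightarrow> 'i \<Rightarrow> 'c::topological_comm_monoid_add"
  assumes "\<And>k. k \<in> M \<Longrightarrow> (a k has_sum s k) I"
  shows "((\<lambda>i. \<Sum>k\<in>M. a k i) has_sum (\<Sum>k\<in>M. s k)) I"
  using assms by (induction M rule: infinite_finite_induct) (auto intro!: has_sum_add)

lemma fps_has_sum_add:
  "fps_has_sum a I S \<Longrightarrow> fps_has_sum b I T \<Longrightarrow> fps_has_sum (\<lambda>i. a i + b i) I (S + T)"
  unfolding fps_has_sum_def by (auto intro: has_sum_add)

lemma fps_has_sum_mult:
  fixes a :: "'i \<Rightarrow> 'c::{nonarch_field, complete_space} fps" and b :: "'j \<Rightarrow> 'c fps"
  assumes "fps_has_sum a I S" "fps_has_sum b J T"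
  shows "fps_has_sum (\<lambda>(i, j). a i * b j) (I \<times> J) (S * T)"
  unfolding fps_has_sum_def
proof
  fix n
  have "((\<lambda>x. \<Sum>m=0..n. (\<lambda>(i, j). a i $ m * b j $ (n - m)) x) has_sum
      (\<Sum>m=0..n. S $ m * T $ (n - m))) (I \<times> J)"
    using assms by (intro has_sum_finite_sum has_sum_mult) (auto simp: fps_has_sum_def)
  then show "((\<lambda>x. (case x of (i, j) \<Rightarrow> a i * b j) $ n) has_sum (S * T) $ n) (I \<times> J)"
    by (simp add: fps_mult_nth case_prod_unfold)
qed

lemma fps_has_sum_cmult:
  assumes "fps_has_sum a I S"
  shows "fps_has_sum (\<lambda>i. c * a i) I (c * S)"
  unfolding fps_has_sum_def fps_mult_nth
  using assms by (intro allI has_sum_finite_sum has_sum_cmult_right) (auto simp: fps_has_sum_def)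

text \<open>The template for the substitution laws: \<open>a\<close> is the fully expanded family,
  \<open>R\<close> gives the summands of one side and \<open>C\<close> those of the other.\<close>

lemma fps_has_sum_swap:
  fixes a :: "'i \<Rightarrow> 'j \<Rightarrow> 'c::{nonarch_field, complete_space} fps"
  assumes "\<And>n. vanishing (\<lambda>(i, j). a i j $ n) (I \<times> J)"
    and "\<And>i. i \<in> I \<Longrightarrow> fps_has_sum (a i) J (R i)"
    and "\<And>j. j \<in> J \<Longrightarrow> fps_has_sum (\<lambda>i. a i j) I (C j)"
    and "fps_has_sum R I S"
  shows "fps_has_sum C J S"
  unfolding fps_has_sum_def
proof
  fix n
  show "((\<lambda>j. C j $ n) has_sum S $ n) J"
    by (rule has_sum_swap[where a = "\<lambda>i j. a i j $ n" and I = I and R = "\<lambda>i. R i $ n"])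
      (use assms in \<open>auto simp: fps_has_sum_def\<close>)
qed

lemma fps_has_sum_cauchy_product:
  fixes a b :: "nat \<Rightarrow> 'c::{nonarch_field, complete_space} fps"
  assumes "fps_has_sum a UNIV S" "fps_has_sum b UNIV T"
  shows "fps_has_sum (\<lambda>n. \<Sum>i\<le>n. a i * b (n - i)) UNIV (S * T)"
  unfolding fps_has_sum_def
proof
  fix m
  have "((\<lambda>(i, j). (a i * b j) $ m) has_sum (S * T) $ m) (UNIV \<times> UNIV)"
    using fps_has_sumD[OF fps_has_sum_mult[OF assms], of m] by (simp add: case_prod_unfold)
  then have "((\<lambda>(n, i). (a i * b (n - i)) $ m) has_sum (S * T) $ m) (SIGMA n:UNIV. {..n})"
    by (rule has_sum_reindex_bij_witness[of _ "\<lambda>(n, i). (i, n - i)" "\<lambda>(i, j). (i + j, i)",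
        THEN iffD1, rotated -1]) auto
  then show "((\<lambda>n. (\<Sum>i\<le>n. a i * b (n - i)) $ m) has_sum (S * T) $ m) UNIV"
    by (rule has_sum_SigmaD) (auto simp: fps_sum_nth intro!: has_sum_finiteI)
qed

subsection \<open>Bounds on the coefficients\<close>

text \<open>A bound for the Gauss norm of \<open>u\<close> at radius \<open>r\<close>. For
  \<open>r = 1\<close> it bounds all coefficients at once and so expresses divisibility by a
  constant.\<close>

definition gauss_le :: "real \<Rightarrow> real \<Rightarrow> 'c::nonarch_field fps \<Rightarrow> bool" where
  "gauss_le r B u \<longleftrightarrow> (\<forall>n. absval (u $ n) * r ^ n \<le> B)"

lemma gauss_le_mono: "gauss_le r B u \<Longrightarrow> B \<le> C \<Longrightarrow> gauss_le r C u"
  unfolding gauss_le_def by (meson order_trans)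

lemma gauss_le_const:
  assumes "absval c \<le> B"
  shows "gauss_le r B (fps_const c)"
proof -
  have "B \<ge> 0" using assms absval_nonneg[of c] by linarith
  then show ?thesis using assms by (auto simp: gauss_le_def)
qed

lemma gauss_le_mult:
  assumes "r > 0" "A \<ge> 0" "gauss_le r A u" "gauss_le r B v"
  shows "gauss_le r (A * B) (u * v)"
  unfolding gauss_le_def
proof
  fix n
  have B: "B \<ge> 0"
    using assms(4) unfolding gauss_le_def by (metis absval_nonneg mult.right_neutral order_trans power_0)
  have "absval (u $ i * v $ (n - i)) \<le> A * B / r ^ n" if "i \<in> {0..n}" for i
  proof -
    have "(absval (u $ i) * r ^ i) * (absval (v $ (n - i)) * r ^ (n - i)) \<le> A * B"
      using assms by (intro mult_mono) (auto simp: gauss_le_def)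
    moreover have "r ^ i * r ^ (n - i) = r ^ n"
      using that by (simp flip: power_add)
    ultimately have "absval (u $ i * v $ (n - i)) * r ^ n \<le> A * B"
      by (metis (no_types, lifting) absval_mult mult.assoc mult.left_commute)
    then show ?thesis using assms(1) by (simp add: pos_le_divide_eq)
  qed
  then have "absval ((u * v) $ n) \<le> A * B / r ^ n"
    unfolding fps_mult_nth using assms B by (intro absval_sum_le) auto
  then show "absval ((u * v) $ n) * r ^ n \<le> A * B"
    using assms(1) by (simp add: pos_le_divide_eq)
qed

lemma gauss_le_power:
  assumes "r > 0" "s \<ge> 0" "gauss_le r s u"
  shows "gauss_le r (s ^ k) (u ^ k)"
proof (induction k)
  case 0
  then show ?case by (simp add: gauss_le_def)
next
  case (Suc k)
  then show ?case using assms by (simp add: gauss_le_mult)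
qed

lemma gauss_le_vanishing:
  assumes "r > 0" "0 \<le> t" "t < 1" "\<And>N. finite {i \<in> A. w i \<le> N}"
    "\<And>i. i \<in> A \<Longrightarrow> gauss_le r (B * t ^ w i) (a i)"
  shows "vanishing (\<lambda>i. a i $ n) A"
proof (rule vanishing_geometric[where w = w and t = t and B = "B / r ^ n"])
  fix i assume "i \<in> A"
  then have "absval (a i $ n) * r ^ n \<le> B * t ^ w i"
    using assms(5) by (auto simp: gauss_le_def)
  then show "absval (a i $ n) \<le> B / r ^ n * t ^ w i"
    using assms(1) by (simp add: field_simps)
qed (use assms in auto)

lemma fps_has_sum_gauss_le:
  assumes "fps_has_sum a I S" "r > 0" "B \<ge> 0" "\<And>i. i \<in> I \<Longrightarrow> gauss_le r B (a i)"
  shows "gauss_le r B S"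
  unfolding gauss_le_def
proof
  fix n
  have "absval (S $ n) \<le> B / r ^ n"
    using assms
    by (intro absval_has_sum_le[OF fps_has_sumD[OF assms(1)]]) (auto simp: gauss_le_def pos_le_divide_eq)
  then show "absval (S $ n) * r ^ n \<le> B"
    using assms(2) by (simp add: pos_le_divide_eq)
qed

section \<open>Integral series, points, and series that converge on the open unit disc\<close>

definition integral_fps :: "'c::nonarch_field fps set" where
  "integral_fps = {u. \<forall>n. absval (u $ n) \<le> 1}"

definition points :: "'c::nonarch_field fps set" where
  "points = {u. (\<forall>n. absval (u $ n) \<le> 1) \<and> absval (u $ 0) < 1}"

text \<open>This class contains both the integral series and the logarithm, whose coefficients need
  not be integral.\<close>

definition convergent_on_disc :: "'c::nonarch_field fps \<Rightarrow> bool" where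
  "convergent_on_disc f \<longleftrightarrow> (\<forall>r. 0 < r \<and> r < 1 \<longrightarrow> (\<exists>B. gauss_le r B f))"

lemma points_integral: "u \<in> points \<Longrightarrow> u \<in> integral_fps"
  by (simp add: points_def integral_fps_def)

lemma integral_gauss_le: "u \<in> integral_fps \<longleftrightarrow> gauss_le 1 1 u"
  by (simp add: integral_fps_def gauss_le_def)

lemma integral_mult: "u \<in> integral_fps \<Longrightarrow> v \<in> integral_fps \<Longrightarrow> u * v \<in> integral_fps"
  using gauss_le_mult[of 1 1 u 1 v] by (simp add: integral_gauss_le)

lemma integral_power: "u \<in> integral_fps \<Longrightarrow> u ^ k \<in> integral_fps"
  using gauss_le_power[of 1 1 u k] by (simp add: integral_gauss_le)

lemma integral_convergent: "f \<in> integral_fps \<Longrightarrow> convergent_on_disc f"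
  unfolding convergent_on_disc_def gauss_le_def integral_fps_def
  by (auto intro!: exI[of _ 1] mult_le_one power_le_one)

text \<open>At a radius below 1 the constant term is small by assumption and the other terms gain a
  factor \<open>r\<close>, so the powers of a point decay. At radius 1 the norm may be 1, which is
  why convergence is studied at an auxiliary radius such as \<open>1 / 2\<close>.\<close>

lemma points_gauss_le:
  assumes "u \<in> points" "0 < r" "r < 1"
  shows "\<exists>s. r \<le> s \<and> s < 1 \<and> gauss_le r s u"
proof (intro exI conjI)
  show "gauss_le r (max r (absval (u $ 0))) u"
    unfolding gauss_le_def
  proof
    fix n
    show "absval (u $ n) * r ^ n \<le> max r (absval (u $ 0))"
    proof (cases n)
      case (Suc m)
      have "absval (u $ n) * r ^ n \<le> 1 * r ^ n"
        using assms by (intro mult_right_mono) (auto simp: points_def)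
      also have "\<dots> \<le> r"
        using assms power_decreasing[of 1 n r] Suc by simp
      finally show ?thesis by simp
    qed auto
  qed
qed (use assms in \<open>auto simp: points_def\<close>)

text \<open>Boundedness at the larger radius \<open>(1 + s) / 2\<close> turns into geometric decay
  at \<open>s\<close>.\<close>

lemma convergent_geometric:
  assumes "convergent_on_disc f" "0 < s" "s < 1"
  obtains B t where "B \<ge> 0" "0 < t" "t < 1" "\<And>k. absval (f $ k) * s ^ k \<le> B * t ^ k"
proof -
  define s' where "s' = (1 + s) / 2"
  have s': "0 < s'" "s' < 1" "s < s'" using assms by (auto simp: s'_def)
  then obtain B where B: "\<And>k. absval (f $ k) * s' ^ k \<le> B"
    using assms(1) unfolding convergent_on_disc_def gauss_le_def by blast
  have "absval (f $ k) * s ^ k \<le> B * (s / s') ^ k" for k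
  proof -
    have "absval (f $ k) * s ^ k = (absval (f $ k) * s' ^ k) * (s / s') ^ k"
      using s' by (simp add: power_divide)
    also have "\<dots> \<le> B * (s / s') ^ k"
      using s' assms by (intro mult_right_mono B) auto
    finally show ?thesis .
  qed
  moreover have "B \<ge> 0" using order_trans[OF absval_nonneg B[of 0, simplified]] .
  ultimately show ?thesis using s' assms by (intro that[of B "s / s'"]) auto
qed

subsection \<open>Substitution\<close>

lemma subst_term_gauss_le:
  assumes "u \<in> points" "0 < r" "r < 1"
  obtains s where "r \<le> s" "s < 1" "\<And>k. gauss_le r (s ^ k) (u ^ k)"
proof -
  obtain s where "r \<le> s" "s < 1" "gauss_le r s u" using points_gauss_le[OF assms] by blast
  with assms show ?thesis by (intro that[of s] gauss_le_power) auto
qed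

lemma fps_subst_has_sum:
  fixes f :: "'c::{nonarch_field, complete_space} fps"
  assumes "convergent_on_disc f" "u \<in> points"
  shows "fps_has_sum (\<lambda>k. fps_const (f $ k) * u ^ k) UNIV (fps_subst f u)"
proof -
  obtain s :: real where s: "1 / 2 \<le> s" "s < 1" "\<And>k. gauss_le (1 / 2) (s ^ k) (u ^ k)"
    by (rule subst_term_gauss_le[OF assms(2), of "1 / 2"]) auto
  obtain B t where Bt: "B \<ge> 0" "0 < t" "t < 1" "\<And>k. absval (f $ k) * s ^ k \<le> B * t ^ k"
    using convergent_geometric[OF assms(1), of s] s by auto
  have "vanishing (\<lambda>k. (fps_const (f $ k) * u ^ k) $ n) UNIV" for n
  proof (rule gauss_le_vanishing[where r = "1 / 2" and t = t and w = id and B = B])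
    fix k
    have "gauss_le (1 / 2) (absval (f $ k) * s ^ k) (fps_const (f $ k) * u ^ k)"
      by (intro gauss_le_mult gauss_le_const s) auto
    then show "gauss_le (1 / 2) (B * t ^ id k) (fps_const (f $ k) * u ^ k)"
      using Bt(4)[of k] by (auto intro: gauss_le_mono)
  qed (use Bt in auto)
  then show ?thesis
    unfolding fps_has_sum_def fps_subst_def
    by (auto intro!: has_sum_infsum vanishing_imp_summable)
qed

lemma fps_subst_unique:
  assumes "fps_has_sum (\<lambda>k. fps_const (f $ k) * u ^ k) UNIV S"
  shows "fps_subst f u = S"
  unfolding fps_eq_iff fps_subst_def using fps_has_sumD[OF assms] by (auto intro: infsumI)

lemma fps_subst_convergent:
  fixes f :: "'c::{nonarch_field, complete_space} fps"
  assumes "convergent_on_disc f" "u \<in> points"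
  shows "convergent_on_disc (fps_subst f u)"
  unfolding convergent_on_disc_def
proof (intro allI impI)
  fix r :: real assume r: "0 < r \<and> r < 1"
  obtain s :: real where s: "r \<le> s" "s < 1" "\<And>k. gauss_le r (s ^ k) (u ^ k)"
    using subst_term_gauss_le[OF assms(2)] r by metis
  obtain B where B: "gauss_le s B f"
    using assms(1) s r unfolding convergent_on_disc_def by (meson less_le_trans)
  then have B0: "B \<ge> 0"
    unfolding gauss_le_def by (metis absval_nonneg mult.right_neutral order_trans power_0)
  have "gauss_le r B (fps_const (f $ k) * u ^ k)" for k
  proof (rule gauss_le_mono)
    show "gauss_le r (absval (f $ k) * s ^ k) (fps_const (f $ k) * u ^ k)"
      using r by (intro gauss_le_mult gauss_le_const s) auto
    show "absval (f $ k) * s ^ k \<le> B" using B by (auto simp: gauss_le_def)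
  qed
  then show "\<exists>B. gauss_le r B (fps_subst f u)"
    using fps_has_sum_gauss_le[OF fps_subst_has_sum[OF assms]] r B0 by blast
qed

lemma fps_subst_add:
  fixes f :: "'c::{nonarch_field, complete_space} fps"
  assumes "convergent_on_disc f" "convergent_on_disc g" "u \<in> points"
  shows "fps_subst (f + g) u = fps_subst f u + fps_subst g u"
proof (rule fps_subst_unique)
  show "fps_has_sum (\<lambda>k. fps_const ((f + g) $ k) * u ^ k) UNIV (fps_subst f u + fps_subst g u)"
    using fps_has_sum_add[OF fps_subst_has_sum[OF assms(1,3)] fps_subst_has_sum[OF assms(2,3)]]
    by (simp add: distrib_right flip: fps_const_add)
qed

lemma fps_subst_cmult:
  fixes f :: "'c::{nonarch_field, complete_space} fps"
  assumes "convergent_on_disc f" "u \<in> points"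
  shows "fps_subst (fps_const c * f) u = fps_const c * fps_subst f u"
proof (rule fps_subst_unique)
  show "fps_has_sum (\<lambda>k. fps_const ((fps_const c * f) $ k) * u ^ k) UNIV (fps_const c * fps_subst f u)"
    using fps_has_sum_cmult[OF fps_subst_has_sum[OF assms], of "fps_const c"]
    by (simp add: mult.assoc flip: fps_const_mult)
qed

lemma fps_const_sum: "fps_const (sum f A) = (\<Sum>i\<in>A. fps_const (f i))"
  by (induction A rule: infinite_finite_induct) (auto simp flip: fps_const_add)

lemma fps_subst_mult:
  fixes f :: "'c::{nonarch_field, complete_space} fps"
  assumes "convergent_on_disc f" "convergent_on_disc g" "u \<in> points"
  shows "fps_subst (f * g) u = fps_subst f u * fps_subst g u"
proof (rule fps_subst_unique)
  have "fps_const ((f * g) $ n) * u ^ n =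
      (\<Sum>i\<le>n. (fps_const (f $ i) * u ^ i) * (fps_const (g $ (n - i)) * u ^ (n - i)))" for n
  proof -
    have "(fps_const (f $ i) * u ^ i) * (fps_const (g $ (n - i)) * u ^ (n - i)) =
        fps_const (f $ i * g $ (n - i)) * u ^ n" if "i \<le> n" for i
    proof -
      have "u ^ n = u ^ i * u ^ (n - i)" using that by (simp flip: power_add)
      then show ?thesis by (simp add: algebra_simps flip: fps_const_mult)
    qed
    then show ?thesis
      by (simp add: fps_mult_nth atLeast0AtMost sum_distrib_right fps_const_sum)
  qed
  then show "fps_has_sum (\<lambda>n. fps_const ((f * g) $ n) * u ^ n) UNIV (fps_subst f u * fps_subst g u)"
    using fps_has_sum_cauchy_product[OF fps_subst_has_sum[OF assms(1,3)] fps_subst_has_sum[OF assms(2,3)]]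
    by presburger
qed

lemma integral_one [simp]: "1 \<in> integral_fps"
  by (auto simp: integral_fps_def)

lemma fps_subst_one [simp]:
  "fps_subst 1 u = 1"
proof (rule fps_subst_unique)
  have "((\<lambda>k. (fps_const (1 $ k) * u ^ k) $ n) has_sum 1 $ n) UNIV" for n
    by (rule has_sum_finite_neutralI[where B = "{0}"]) auto
  then show "fps_has_sum (\<lambda>k. fps_const (1 $ k) * u ^ k) UNIV 1"
    by (simp add: fps_has_sum_def)
qed

lemma fps_subst_zero [simp]: "fps_subst 0 u = 0"
  by (rule fps_subst_unique) (simp add: fps_has_sum_def)

lemma fps_subst_power:
  fixes f :: "'c::{nonarch_field, complete_space} fps"
  assumes "f \<in> integral_fps" "u \<in> points"
  shows "fps_subst (f ^ k) u = fps_subst f u ^ k"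
  using assms by (induction k) (auto simp: fps_subst_mult integral_convergent integral_power)

lemma convergent_add:
  "convergent_on_disc f \<Longrightarrow> convergent_on_disc g \<Longrightarrow> convergent_on_disc (f + g)"
  unfolding convergent_on_disc_def
proof (intro allI impI)
  fix r :: real
  assume r: "0 < r \<and> r < 1" and *: "\<forall>r. 0 < r \<and> r < 1 \<longrightarrow> (\<exists>B. gauss_le r B f)"
    "\<forall>r. 0 < r \<and> r < 1 \<longrightarrow> (\<exists>B. gauss_le r B g)"
  obtain B C where BC: "gauss_le r B f" "gauss_le r C g" using r * by blast
  have "absval ((f + g) $ n) * r ^ n \<le> max B C" for n
  proof -
    have "absval ((f + g) $ n) * r ^ n \<le> max (absval (f $ n)) (absval (g $ n)) * r ^ n"
      using r by (intro mult_right_mono) (auto simp: absval_add_le)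
    also have "\<dots> = max (absval (f $ n) * r ^ n) (absval (g $ n) * r ^ n)"
      using r by (simp add: max_mult_distrib_right)
    also have "\<dots> \<le> max B C"
      using BC unfolding gauss_le_def by (intro max.mono) auto
    finally show ?thesis .
  qed
  then show "\<exists>B. gauss_le r B (f + g)" unfolding gauss_le_def by blast
qed

lemma convergent_cmult:
  assumes "convergent_on_disc f"
  shows "convergent_on_disc (fps_const c * f)"
  unfolding convergent_on_disc_def
proof (intro allI impI)
  fix r :: real
  assume r: "0 < r \<and> r < 1"
  then obtain B where "gauss_le r B f" using assms unfolding convergent_on_disc_def by blast
  then have "gauss_le r (absval c * B) (fps_const c * f)"
    using r by (intro gauss_le_mult gauss_le_const) auto
  then show "\<exists>B. gauss_le r B (fps_const c * f)" by blast
qed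

lemma convergent_uminus: "convergent_on_disc f \<Longrightarrow> convergent_on_disc (- f)"
  using convergent_cmult[of f "-1"] by (simp flip: fps_const_neg)

lemma convergent_diff:
  "convergent_on_disc f \<Longrightarrow> convergent_on_disc g \<Longrightarrow> convergent_on_disc (f - g)"
  using convergent_add[of f "- g"] convergent_uminus[of g] by simp

lemma convergent_zero [simp]: "convergent_on_disc 0"
  by (auto simp: convergent_on_disc_def gauss_le_def)

lemma convergent_sum:
  "(\<And>i. i \<in> A \<Longrightarrow> convergent_on_disc (f i)) \<Longrightarrow> convergent_on_disc (sum f A)"
  by (induction A rule: infinite_finite_induct) (auto intro: convergent_add)

lemma fps_subst_diff:
  fixes f :: "'c::{nonarch_field, complete_space} fps"
  assumes "convergent_on_disc f" "convergent_on_disc g" "u \<in> points"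
  shows "fps_subst (f - g) u = fps_subst f u - fps_subst g u"
  using fps_subst_add[of "f - g" g u] assms by (simp add: convergent_diff)

lemma fps_subst_sum:
  fixes f :: "'i \<Rightarrow> 'c::{nonarch_field, complete_space} fps"
  assumes "\<And>i. i \<in> A \<Longrightarrow> convergent_on_disc (f i)" "u \<in> points"
  shows "fps_subst (sum f A) u = (\<Sum>i\<in>A. fps_subst (f i) u)"
  using assms
  by (induction A rule: infinite_finite_induct) (auto simp: fps_subst_add convergent_sum)

lemma fps_has_sum_finite_support:
  assumes "finite M" "M \<subseteq> I" "\<And>i. i \<in> I - M \<Longrightarrow> a i = 0"
  shows "fps_has_sum a I (\<Sum>i\<in>M. a i)"
  unfolding fps_has_sum_def
  using assms by (intro allI has_sum_finite_neutralI[where B = M]) (auto simp: fps_sum_nth)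

lemma fps_has_sum_const:
  fixes c :: "'i \<Rightarrow> 'c::nonarch_field"
  assumes "(c has_sum s) I"
  shows "fps_has_sum (\<lambda>i. fps_const (c i) * v) I (fps_const s * v)"
  using assms by (auto simp: fps_has_sum_def intro: has_sum_cmult_left)

lemma fps_nth_power_eq_0: "(u :: 'a::comm_ring_1 fps) $ 0 = 0 \<Longrightarrow> n < k \<Longrightarrow> (u ^ k) $ n = 0"
  by (rule startsby_zero_power_prefix[rule_format])

lemma fps_subst_eq_compose:
  assumes "u $ 0 = 0"
  shows "fps_subst f u = fps_compose f u"
proof (rule fps_subst_unique)
  have "((\<lambda>k. (fps_const (f $ k) * u ^ k) $ n) has_sum fps_compose f u $ n) UNIV" for n
    by (rule has_sum_finite_neutralI[where B = "{0..n}"])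
      (auto simp: fps_compose_nth fps_nth_power_eq_0 assms)
  then show "fps_has_sum (\<lambda>k. fps_const (f $ k) * u ^ k) UNIV (fps_compose f u)"
    by (simp add: fps_has_sum_def)
qed

lemma fps_subst_X [simp]: "fps_subst f fps_X = f"
  by (simp add: fps_subst_eq_compose)

lemma fps_X_subst [simp]: "fps_subst fps_X u = u"
proof (rule fps_subst_unique)
  have "fps_has_sum (\<lambda>k. fps_const (fps_X $ k) * u ^ k) UNIV (\<Sum>k\<in>{1}. fps_const (fps_X $ k) * u ^ k)"
    by (intro fps_has_sum_finite_support) auto
  then show "fps_has_sum (\<lambda>k. fps_const (fps_X $ k) * u ^ k) UNIV u" by simp
qed

lemma fps_X_point [simp]: "fps_X \<in> points"
  by (auto simp: points_def fps_X_nth)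

lemma const_point [simp]: "fps_const z \<in> points \<longleftrightarrow> absval z < 1"
  by (auto simp: points_def)

lemma zero_point [simp]: "0 \<in> points"
  by (simp add: points_def)

lemma fps_power_nth_0: "(u ^ k) $ 0 = (u $ 0) ^ k" for u :: "'a::comm_ring_1 fps"
  by (induction k) auto

lemma fps_subst_nth_0_has_sum:
  fixes f :: "'c::{nonarch_field, complete_space} fps"
  assumes "convergent_on_disc f" "u \<in> points"
  shows "((\<lambda>k. f $ k * (u $ 0) ^ k) has_sum fps_subst f u $ 0) UNIV"
  using fps_has_sumD[OF fps_subst_has_sum[OF assms], of 0] by (simp add: fps_power_nth_0)

lemma fps_subst_nth_0_le:
  fixes f :: "'c::{nonarch_field, complete_space} fps"
  assumes "f \<in> integral_fps" "u \<in> points"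
  shows "absval (fps_subst f u $ 0) \<le> max (absval (f $ 0)) (absval (u $ 0))"
proof (rule absval_has_sum_le[OF fps_subst_nth_0_has_sum])
  fix k :: nat
  show "absval (f $ k * (u $ 0) ^ k) \<le> max (absval (f $ 0)) (absval (u $ 0))"
  proof (cases k)
    case (Suc m)
    have "absval (f $ k) * absval (u $ 0) ^ k \<le> 1 * absval (u $ 0) ^ 1"
      using assms Suc by (intro mult_mono power_decreasing) (auto simp: points_def integral_fps_def)
    then show ?thesis by (simp add: absval_mult absval_power)
  qed auto
qed (use assms in \<open>auto simp: integral_convergent le_max_iff_disj\<close>)

lemma fps_subst_integral:
  fixes f :: "'c::{nonarch_field, complete_space} fps"
  assumes "f \<in> integral_fps" "u \<in> points"
  shows "fps_subst f u \<in> integral_fps"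
  unfolding integral_gauss_le
proof (rule fps_has_sum_gauss_le[OF fps_subst_has_sum])
  fix k
  have "u ^ k \<in> integral_fps" using assms by (intro integral_power points_integral)
  moreover have "fps_const (f $ k) \<in> integral_fps" using assms by (auto simp: integral_fps_def)
  ultimately show "gauss_le 1 1 (fps_const (f $ k) * u ^ k)"
    unfolding integral_gauss_le[symmetric] by (intro integral_mult)
qed (use assms in \<open>auto simp: integral_convergent\<close>)

lemma fps_subst_points:
  fixes f :: "'c::{nonarch_field, complete_space} fps"
  assumes "f \<in> points" "u \<in> points"
  shows "fps_subst f u \<in> points"
  using fps_subst_integral[of f u] fps_subst_nth_0_le[of f u] assms points_integral[OF assms(1)]
  by (auto simp: points_def integral_fps_def)

lemma max_power_le: "0 \<le> a \<Longrightarrow> 0 \<le> b \<Longrightarrow> a ^ m * b ^ n \<le> max a b ^ (m + n)" for a b :: real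
  by (simp add: power_add mult_mono power_mono)

text \<open>The expanded family is \<open>f $ k * (g ^ k) $ n\<close> times \<open>u ^ n\<close>.
  Summed over \<open>n\<close> it gives \<open>f $ k\<close> times the \<open>k\<close>-th power of
  \<open>g(u)\<close>; summed over \<open>k\<close> it gives the \<open>n\<close>-th term of
  \<open>(f o g)(u)\<close>.\<close>

lemma fps_subst_assoc:
  fixes f :: "'c::{nonarch_field, complete_space} fps"
  assumes f: "convergent_on_disc f" and g: "g \<in> points" and u: "u \<in> points"
  shows "fps_subst f (fps_subst g u) = fps_subst (fps_subst f g) u"
proof (rule fps_subst_unique[symmetric])
  have gu: "fps_subst g u \<in> points" using g u by (rule fps_subst_points)
  define a where "a k n = fps_const (f $ k * (g ^ k) $ n) * u ^ n" for k n
  show "fps_has_sum (\<lambda>n. fps_const (fps_subst f g $ n) * u ^ n) UNIV (fps_subst f (fps_subst g u))"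
  proof (rule fps_has_sum_swap[where a = a and I = UNIV])
    fix m
    obtain s :: real where s: "1 / 2 \<le> s" "s < 1" "\<And>k. gauss_le (1 / 2) (s ^ k) (u ^ k)"
      by (rule subst_term_gauss_le[OF u, of "1 / 2"]) auto
    \<comment> \<open>The radii are nested: \<open>u\<close> has norm at most \<open>s\<close> at
      \<open>1 / 2\<close>, \<open>g\<close> has norm at most \<open>\<sigma>\<close> at some
      \<open>\<rho> > s\<close>, and \<open>f\<close> is measured at \<open>\<sigma> < 1\<close>.
      The gap between \<open>s\<close> and \<open>\<rho>\<close> gives decay in \<open>n\<close>,
      the convergence of \<open>f\<close> gives decay in \<open>k\<close>.\<close>
    define \<rho> where "\<rho> = (1 + s) / 2"
    have \<rho>: "0 < \<rho>" "\<rho> < 1" "s < \<rho>" using s by (auto simp: \<rho>_def)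
    obtain \<sigma> :: real where \<sigma>: "\<rho> \<le> \<sigma>" "\<sigma> < 1" "\<And>k. gauss_le \<rho> (\<sigma> ^ k) (g ^ k)"
      by (rule subst_term_gauss_le[OF g, of \<rho>]) (use \<rho> in auto)
    obtain B t where Bt: "B \<ge> 0" "0 < t" "t < 1" "\<And>k. absval (f $ k) * \<sigma> ^ k \<le> B * t ^ k"
      using convergent_geometric[OF f, of \<sigma>] \<rho> \<sigma> by auto
    define T where "T = max t (s / \<rho>)"
    show "vanishing (\<lambda>(k, n). a k n $ m) (UNIV \<times> UNIV)"
      unfolding case_prod_unfold
    proof (rule gauss_le_vanishing[where r = "1 / 2" and t = T and w = "\<lambda>(k, n). k + n" and B = B])
      show "finite {i \<in> UNIV \<times> UNIV. (case i of (k, n) \<Rightarrow> k + n) \<le> N}" for N :: nat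
        by (rule finite_subset[of _ "{..N} \<times> {..N}"]) auto
      fix x :: "nat \<times> nat"
      obtain k n where x: "x = (k, n)" by (cases x)
      have "absval ((g ^ k) $ n) * \<rho> ^ n \<le> \<sigma> ^ k" using \<sigma>(3)[of k] by (simp add: gauss_le_def)
      then have gkn: "absval ((g ^ k) $ n) * s ^ n \<le> \<sigma> ^ k * (s / \<rho>) ^ n"
        using \<rho> s mult_right_mono[of "absval ((g ^ k) $ n) * \<rho> ^ n" "\<sigma> ^ k" "(s / \<rho>) ^ n"]
        by (simp add: power_divide)
      have "absval (f $ k * (g ^ k) $ n) * s ^ n = absval (f $ k) * (absval ((g ^ k) $ n) * s ^ n)"
        by (simp add: absval_mult)
      also have "\<dots> \<le> absval (f $ k) * (\<sigma> ^ k * (s / \<rho>) ^ n)"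
        using gkn by (rule mult_left_mono) simp
      also have "\<dots> = (absval (f $ k) * \<sigma> ^ k) * (s / \<rho>) ^ n" by simp
      also have "\<dots> \<le> (B * t ^ k) * (s / \<rho>) ^ n"
        using Bt \<rho> s by (intro mult_right_mono) auto
      also have "\<dots> = B * (t ^ k * (s / \<rho>) ^ n)" by simp
      also have "\<dots> \<le> B * T ^ (k + n)"
        unfolding T_def using Bt \<rho> s by (intro mult_left_mono max_power_le) auto
      finally have "absval (f $ k * (g ^ k) $ n) * s ^ n \<le> B * T ^ (k + n)" .
      moreover have "gauss_le (1 / 2) (absval (f $ k * (g ^ k) $ n) * s ^ n) (a k n)"
        unfolding a_def by (intro gauss_le_mult gauss_le_const s) auto
      ultimately show "gauss_le (1 / 2) (B * T ^ (case x of (k, n) \<Rightarrow> k + n)) (a (fst x) (snd x))"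
        using x by (auto intro: gauss_le_mono)
    qed (use Bt \<rho> s in \<open>auto simp: T_def\<close>)
  next
    fix k
    have "fps_has_sum (\<lambda>n. fps_const (f $ k) * (fps_const ((g ^ k) $ n) * u ^ n)) UNIV
        (fps_const (f $ k) * fps_subst (g ^ k) u)"
      using g u by (intro fps_has_sum_cmult fps_subst_has_sum integral_convergent integral_power
          points_integral)
    then show "fps_has_sum (a k) UNIV (fps_const (f $ k) * fps_subst g u ^ k)"
      using g u by (simp add: a_def[abs_def] fps_subst_power points_integral mult.assoc flip: fps_const_mult)
  next
    fix n
    show "fps_has_sum (\<lambda>k. a k n) UNIV (fps_const (fps_subst f g $ n) * u ^ n)"
      unfolding a_def
      using fps_has_sumD[OF fps_subst_has_sum[OF f g], of n] by (intro fps_has_sum_const) simp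
  next
    show "fps_has_sum (\<lambda>k. fps_const (f $ k) * fps_subst g u ^ k) UNIV (fps_subst f (fps_subst g u))"
      using f gu by (rule fps_subst_has_sum)
  qed
qed

lemma fps_subst_const_const:
  fixes f :: "'c::{nonarch_field, complete_space} fps"
  assumes "convergent_on_disc f" "absval z < 1"
  shows "fps_subst f (fps_const z) = fps_const (fps_subst f (fps_const z) $ 0)"
proof -
  have "fps_subst f (fps_const z) $ n = 0" if "n > 0" for n
  proof (rule has_sum_unique)
    show "((\<lambda>k. (fps_const (f $ k) * fps_const z ^ k) $ n) has_sum fps_subst f (fps_const z) $ n) UNIV"
      using assms by (intro fps_has_sumD fps_subst_has_sum) auto
    show "((\<lambda>k. (fps_const (f $ k) * fps_const z ^ k) $ n) has_sum 0) UNIV"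
      using that by (intro has_sum_0) (simp add: fps_const_power)
  qed
  then show ?thesis by (auto simp: fps_eq_iff)
qed

subsection \<open>Substitution into series in two variables\<close>

definition integral_fps2 :: "'c::nonarch_field fps fps set" where
  "integral_fps2 = {F. \<forall>i. F $ i \<in> integral_fps}"

lemma integral_fps2_nth: "F \<in> integral_fps2 \<Longrightarrow> F $ i \<in> integral_fps"
  by (simp add: integral_fps2_def)

lemma integral_fps2_nth2: "F \<in> integral_fps2 \<Longrightarrow> absval (F $ i $ j) \<le> 1"
  by (simp add: integral_fps2_def integral_fps_def)

lemma integral_sum: "(\<And>i. i \<in> A \<Longrightarrow> f i \<in> integral_fps) \<Longrightarrow> sum f A \<in> integral_fps"
  by (auto simp: integral_fps_def fps_sum_nth intro!: absval_sum_le)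

lemma integral_fps2_mult: "F \<in> integral_fps2 \<Longrightarrow> G \<in> integral_fps2 \<Longrightarrow> F * G \<in> integral_fps2"
  by (auto simp: integral_fps2_def fps_mult_nth intro!: integral_sum integral_mult)

lemma integral_fps2_power: "F \<in> integral_fps2 \<Longrightarrow> F ^ k \<in> integral_fps2"
proof (induction k)
  case 0
  have "(1 :: 'a fps fps) $ i \<in> integral_fps" for i by (auto simp: integral_fps_def)
  then show ?case by (simp add: integral_fps2_def)
qed (auto intro: integral_fps2_mult)

lemma fps2_power_nth_eq_0:
  fixes F :: "'a::comm_ring_1 fps fps"
  assumes "F $ 0 $ 0 = 0" "i + j < k"
  shows "(F ^ k) $ i $ j = 0"
  using assms(2)
proof (induction k arbitrary: i j)
  case (Suc k)
  have "F $ a $ b * (F ^ k) $ (i - a) $ (j - b) = 0" if "a \<le> i" "b \<le> j" for a b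
  proof (cases "a = 0 \<and> b = 0")
    case False
    then have "i - a + (j - b) < k" using Suc.prems that by linarith
    then show ?thesis using Suc.IH by simp
  qed (use assms(1) in auto)
  then show ?case
    by (simp add: fps_mult_nth fps_sum_nth)
qed auto

lemma fps_has_sum_SigmaD:
  assumes "fps_has_sum (\<lambda>(i, j). a i j) (Sigma A B) S" "\<And>i. i \<in> A \<Longrightarrow> fps_has_sum (a i) (B i) (R i)"
  shows "fps_has_sum R A S"
  unfolding fps_has_sum_def
proof
  fix n
  show "((\<lambda>i. R i $ n) has_sum S $ n) A"
    using fps_has_sumD[OF assms(1), of n] assms(2)
    by (intro has_sum_SigmaD[where B = B and f = "\<lambda>(i, j). a i j $ n"])
      (auto simp: fps_has_sum_def case_prod_unfold)
qed

lemma points_common_bound: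
  assumes "u \<in> points" "v \<in> points" "w \<in> points"
  obtains s :: real where "0 < s" "s < 1" "\<And>k. gauss_le (1 / 2) (s ^ k) (u ^ k)"
    "\<And>k. gauss_le (1 / 2) (s ^ k) (v ^ k)" "\<And>k. gauss_le (1 / 2) (s ^ k) (w ^ k)"
proof -
  obtain su :: real where su: "1 / 2 \<le> su" "su < 1" "gauss_le (1 / 2) su u"
    using points_gauss_le[OF assms(1), of "1 / 2"] by auto
  obtain sv :: real where sv: "1 / 2 \<le> sv" "sv < 1" "gauss_le (1 / 2) sv v"
    using points_gauss_le[OF assms(2), of "1 / 2"] by auto
  obtain sw :: real where sw: "1 / 2 \<le> sw" "sw < 1" "gauss_le (1 / 2) sw w"
    using points_gauss_le[OF assms(3), of "1 / 2"] by auto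
  define s where "s = max su (max sv sw)"
  have "gauss_le (1 / 2) s u" "gauss_le (1 / 2) s v" "gauss_le (1 / 2) s w"
    using su sv sw by (auto simp: s_def intro: gauss_le_mono)
  then show ?thesis
    using su sv sw by (intro that[of s] gauss_le_power) (auto simp: s_def)
qed

lemma finite_pairs_sum_le: "finite {i \<in> UNIV. (case i of (a, b) \<Rightarrow> a + b) \<le> (N::nat)}"
  by (rule finite_subset[of _ "{..N} \<times> {..N}"]) auto

lemma fps_subst2_has_sum:
  fixes F :: "'c::{nonarch_field, complete_space} fps fps"
  assumes F: "F \<in> integral_fps2" and u: "u \<in> points" and v: "v \<in> points"
  shows "fps_has_sum (\<lambda>(i, j). fps_const (F $ i $ j) * (u ^ i * v ^ j)) UNIV (fps_subst2 F u v)"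
proof -
  obtain s :: real where s: "0 < s" "s < 1" "\<And>k. gauss_le (1 / 2) (s ^ k) (u ^ k)"
    "\<And>k. gauss_le (1 / 2) (s ^ k) (v ^ k)"
    using points_common_bound[OF u v v] by metis
  have "vanishing (\<lambda>x. (\<lambda>(i, j). fps_const (F $ i $ j) * (u ^ i * v ^ j)) x $ n) UNIV" for n
  proof (rule gauss_le_vanishing[where r = "1 / 2" and t = s and w = "\<lambda>(i, j). i + j" and B = 1])
    fix x :: "nat \<times> nat"
    obtain i j where x: "x = (i, j)" by (cases x)
    have "gauss_le (1 / 2) (1 * (s ^ i * s ^ j)) (fps_const (F $ i $ j) * (u ^ i * v ^ j))"
      using F s(1) by (intro gauss_le_mult gauss_le_const s) (auto simp: integral_fps2_nth2)
    then show "gauss_le (1 / 2) (1 * s ^ (case x of (i, j) \<Rightarrow> i + j))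
        (case x of (i, j) \<Rightarrow> fps_const (F $ i $ j) * (u ^ i * v ^ j))"
      by (simp add: x power_add)
  qed (use s finite_pairs_sum_le in auto)
  then show ?thesis
    unfolding fps_has_sum_def fps_subst2_def
    by (auto intro!: has_sum_infsum vanishing_imp_summable simp: case_prod_unfold)
qed

lemma fps_subst2_unique:
  assumes "fps_has_sum (\<lambda>(i, j). fps_const (F $ i $ j) * (u ^ i * v ^ j)) UNIV S"
  shows "fps_subst2 F u v = S"
  unfolding fps_eq_iff fps_subst2_def
  using fps_has_sumD[OF assms] by (auto intro!: infsumI simp: case_prod_unfold)

text \<open>Read as a series in \<open>u\<close> with coefficients
  \<open>fps_subst (F $ i) v\<close>, a product of two such series becomes a Cauchy product; this
  reduces \<open>fps_subst2_mult\<close> to the laws in one variable.\<close>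

lemma fps_subst2_has_sum_iterated:
  fixes F :: "'c::{nonarch_field, complete_space} fps fps"
  assumes F: "F \<in> integral_fps2" and u: "u \<in> points" and v: "v \<in> points"
  shows "fps_has_sum (\<lambda>i. u ^ i * fps_subst (F $ i) v) UNIV (fps_subst2 F u v)"
proof (rule fps_has_sum_SigmaD[where B = "\<lambda>_. UNIV"])
  show "fps_has_sum (\<lambda>(i, j). u ^ i * (fps_const (F $ i $ j) * v ^ j)) (UNIV \<times> UNIV) (fps_subst2 F u v)"
    using fps_subst2_has_sum[OF assms] by (simp add: mult_ac)
  show "fps_has_sum (\<lambda>j. u ^ i * (fps_const (F $ i $ j) * v ^ j)) UNIV (u ^ i * fps_subst (F $ i) v)" for i
    using F v by (intro fps_has_sum_cmult fps_subst_has_sum integral_convergent) (auto simp: integral_fps2_nth)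
qed

lemma fps_subst2_mult:
  fixes F :: "'c::{nonarch_field, complete_space} fps fps"
  assumes F: "F \<in> integral_fps2" and G: "G \<in> integral_fps2" and u: "u \<in> points" and v: "v \<in> points"
  shows "fps_subst2 (F * G) u v = fps_subst2 F u v * fps_subst2 G u v"
proof (rule fps_has_sum_unique)
  show "fps_has_sum (\<lambda>n. u ^ n * fps_subst ((F * G) $ n) v) UNIV (fps_subst2 (F * G) u v)"
    using assms by (intro fps_subst2_has_sum_iterated integral_fps2_mult)
  have "u ^ n * fps_subst ((F * G) $ n) v =
      (\<Sum>i\<le>n. (u ^ i * fps_subst (F $ i) v) * (u ^ (n - i) * fps_subst (G $ (n - i)) v))" for n
  proof -
    have "fps_subst ((F * G) $ n) v = (\<Sum>i\<le>n. fps_subst (F $ i) v * fps_subst (G $ (n - i)) v)"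
      using F G v
      by (simp add: fps_mult_nth fps_subst_sum fps_subst_mult integral_convergent integral_fps2_nth
          integral_mult atLeast0AtMost)
    moreover have "u ^ n = u ^ i * u ^ (n - i)" if "i \<le> n" for i
      using that by (simp flip: power_add)
    ultimately show ?thesis
      by (auto simp: sum_distrib_left mult_ac intro!: sum.cong)
  qed
  then show "fps_has_sum (\<lambda>n. u ^ n * fps_subst ((F * G) $ n) v) UNIV (fps_subst2 F u v * fps_subst2 G u v)"
    using fps_has_sum_cauchy_product[OF fps_subst2_has_sum_iterated[OF F u v]
        fps_subst2_has_sum_iterated[OF G u v]] by presburger
qed

lemma fps_subst2_one: "fps_subst2 1 u v = 1"
proof (rule fps_subst2_unique)
  have "fps_has_sum (\<lambda>(i, j). fps_const (1 $ i $ j) * (u ^ i * v ^ j)) UNIV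
      (\<Sum>x\<in>{(0, 0)}. (\<lambda>(i, j). fps_const (1 $ i $ j) * (u ^ i * v ^ j)) x)"
    by (intro fps_has_sum_finite_support) (auto split: if_splits)
  then show "fps_has_sum (\<lambda>(i, j). fps_const (1 $ i $ j) * (u ^ i * v ^ j)) UNIV 1"
    by simp
qed

lemma fps_subst2_power:
  fixes F :: "'c::{nonarch_field, complete_space} fps fps"
  assumes "F \<in> integral_fps2" "u \<in> points" "v \<in> points"
  shows "fps_subst2 (F ^ k) u v = fps_subst2 F u v ^ k"
  using assms by (induction k) (auto simp: fps_subst2_mult fps_subst2_one integral_fps2_power)

lemma fps_subst2_points:
  fixes F :: "'c::{nonarch_field, complete_space} fps fps"
  assumes F: "F \<in> integral_fps2" "F $ 0 $ 0 = 0" and u: "u \<in> points" and v: "v \<in> points"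
  shows "fps_subst2 F u v \<in> points"
    and "absval (fps_subst2 F u v $ 0) \<le> max (absval (u $ 0)) (absval (v $ 0))"
proof -
  note hs = fps_subst2_has_sum[OF F(1) u v]
  have "gauss_le 1 1 (fps_subst2 F u v)"
  proof (rule fps_has_sum_gauss_le[OF hs])
    fix x :: "nat \<times> nat"
    have "u ^ i * v ^ j \<in> integral_fps" for i j
      using u v by (intro integral_mult integral_power points_integral)
    moreover have "fps_const (F $ i $ j) \<in> integral_fps" for i j
      using F by (auto simp: integral_fps_def integral_fps2_nth2)
    ultimately show "gauss_le 1 1 (case x of (i, j) \<Rightarrow> fps_const (F $ i $ j) * (u ^ i * v ^ j))"
      unfolding integral_gauss_le[symmetric] by (auto split: prod.split intro: integral_mult)
  qed auto
  then have int: "absval (fps_subst2 F u v $ n) \<le> 1" for n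
    by (auto simp: gauss_le_def)
  show le: "absval (fps_subst2 F u v $ 0) \<le> max (absval (u $ 0)) (absval (v $ 0))"
  proof (rule absval_has_sum_le[OF fps_has_sumD[OF hs]])
    fix x :: "nat \<times> nat"
    obtain i j where x: "x = (i, j)" by (cases x)
    have uv: "absval (u $ 0) \<le> 1" "absval (v $ 0) \<le> 1" using u v by (auto simp: points_def)
    have "absval (F $ i $ j) * (absval (u $ 0) ^ i * absval (v $ 0) ^ j) \<le>
        max (absval (u $ 0)) (absval (v $ 0))"
    proof (cases "i = 0 \<and> j = 0")
      case True
      then show ?thesis using F(2) by (simp add: le_max_iff_disj)
    next
      case False
      define M where "M = max (absval (u $ 0)) (absval (v $ 0))"
      have M: "0 \<le> M" "M \<le> 1" using uv by (auto simp: M_def le_max_iff_disj)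
      have "absval (F $ i $ j) * (absval (u $ 0) ^ i * absval (v $ 0) ^ j) \<le> 1 * M ^ (i + j)"
        using F unfolding M_def by (intro mult_mono max_power_le) (auto simp: integral_fps2_nth2)
      also have "\<dots> \<le> M ^ 1"
        unfolding mult_1 using False M by (intro power_decreasing) auto
      finally show ?thesis by (simp add: M_def)
    qed
    then show "absval ((case x of (i, j) \<Rightarrow> fps_const (F $ i $ j) * (u ^ i * v ^ j)) $ 0) \<le>
        max (absval (u $ 0)) (absval (v $ 0))"
      by (simp add: x absval_mult absval_power fps_power_nth_0)
  qed (auto simp: le_max_iff_disj)
  with int u v show "fps_subst2 F u v \<in> points"
    by (auto simp: points_def)
qed

text \<open>A term of \<open>F ^ k\<close> of total degree \<open>n\<close> can be nonzero only for
  \<open>k \<le> n\<close>. Half of the decay in \<open>n\<close> can therefore be spent on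
  \<open>k\<close>, which makes \<open>k + n\<close> a usable weight.\<close>

lemma power_le_sqrt_power: "0 \<le> s \<Longrightarrow> s \<le> 1 \<Longrightarrow> k \<le> n \<Longrightarrow> s ^ n \<le> sqrt s ^ (k + n)" for s :: real
proof -
  assume s: "0 \<le> s" "s \<le> 1" and kn: "k \<le> n"
  have "s ^ n = sqrt s ^ (2 * n)" using s by (simp add: power_mult)
  also have "\<dots> \<le> sqrt s ^ (k + n)" using s kn by (intro power_decreasing) auto
  finally show ?thesis .
qed

text \<open>Stated for \<open>f\<close> convergent on the disc so that it covers the logarithm as
  well as the endomorphisms \<open>br a\<close>.\<close>

lemma fps_subst_subst2:
  fixes f :: "'c::{nonarch_field, complete_space} fps"
  assumes f: "convergent_on_disc f" and F: "F \<in> integral_fps2" "F $ 0 $ 0 = 0"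
    and u: "u \<in> points" and v: "v \<in> points"
  shows "fps_subst f (fps_subst2 F u v) = fps_subst2 (comp_outer f F) u v"
proof (rule fps_subst2_unique[symmetric])
  have Fuv: "fps_subst2 F u v \<in> points" using F u v by (rule fps_subst2_points)
  define a where "a k x = (case x of (i, j) \<Rightarrow> fps_const (f $ k * (F ^ k) $ i $ j) * (u ^ i * v ^ j))" for k x
  show "fps_has_sum (\<lambda>(i, j). fps_const (comp_outer f F $ i $ j) * (u ^ i * v ^ j)) UNIV
      (fps_subst f (fps_subst2 F u v))"
  proof (rule fps_has_sum_swap[where a = a and I = UNIV])
    fix m
    obtain s :: real where s: "0 < s" "s < 1" "\<And>k. gauss_le (1 / 2) (s ^ k) (u ^ k)"
      "\<And>k. gauss_le (1 / 2) (s ^ k) (v ^ k)"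
      using points_common_bound[OF u v v] by metis
    have ss: "0 < sqrt s" "sqrt s < 1" using s by auto
    \<comment> \<open>The series \<open>f\<close> is measured at \<open>sqrt s\<close>: a factor
      \<open>sqrt s ^ k\<close> is taken out of \<open>s ^ (i + j)\<close> for it, and the remaining
      factor decays in \<open>i + j\<close>.\<close>
    obtain B t where Bt: "B \<ge> 0" "0 < t" "t < 1" "\<And>k. absval (f $ k) * sqrt s ^ k \<le> B * t ^ k"
      using convergent_geometric[OF f, of "sqrt s"] ss by auto
    define T where "T = max t (sqrt s)"
    show "vanishing (\<lambda>(k, x). a k x $ m) (UNIV \<times> UNIV)"
      unfolding case_prod_unfold
    proof (rule gauss_le_vanishing[where r = "1 / 2" and t = T and w = "\<lambda>(k, i, j). k + (i + j)" and B = B])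
      show "finite {i \<in> UNIV \<times> UNIV. (case i of (k, i, j) \<Rightarrow> k + (i + j)) \<le> N}" for N :: nat
        by (rule finite_subset[of _ "{..N} \<times> {..N} \<times> {..N}"]) auto
      fix x :: "nat \<times> nat \<times> nat"
      obtain k i j where x: "x = (k, i, j)" by (cases x)
      show "gauss_le (1 / 2) (B * T ^ (case x of (k, i, j) \<Rightarrow> k + (i + j))) (a (fst x) (snd x))"
      proof (cases "i + j < k")
        case True
        have "a k (i, j) = 0" by (simp add: a_def fps2_power_nth_eq_0[OF F(2) True])
        then show ?thesis using Bt ss by (auto simp: x gauss_le_def T_def le_max_iff_disj)
      next
        case False
        have "absval (f $ k * (F ^ k) $ i $ j) * s ^ (i + j) \<le> absval (f $ k) * s ^ (i + j)"
          using s F by (intro mult_right_mono)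
            (auto simp: absval_mult integral_fps2_power integral_fps2_nth2 mult_left_le)
        also have "\<dots> \<le> absval (f $ k) * sqrt s ^ (k + (i + j))"
          using False s by (intro mult_left_mono power_le_sqrt_power) auto
        also have "\<dots> = (absval (f $ k) * sqrt s ^ k) * sqrt s ^ (i + j)" by (simp add: power_add)
        also have "\<dots> \<le> (B * t ^ k) * sqrt s ^ (i + j)"
          using Bt s by (intro mult_right_mono) auto
        also have "\<dots> = B * (t ^ k * sqrt s ^ (i + j))" by simp
        also have "\<dots> \<le> B * T ^ (k + (i + j))"
          unfolding T_def using Bt ss by (intro mult_left_mono max_power_le) auto
        finally have "absval (f $ k * (F ^ k) $ i $ j) * s ^ (i + j) \<le> B * T ^ (k + (i + j))" .
        moreover have "gauss_le (1 / 2) (absval (f $ k * (F ^ k) $ i $ j) * (s ^ i * s ^ j)) (a k (i, j))"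
          unfolding a_def prod.case using s(1) by (intro gauss_le_mult gauss_le_const s) auto
        ultimately show ?thesis
          using x by (auto simp: power_add intro: gauss_le_mono)
      qed
    qed (use Bt ss in \<open>auto simp: T_def\<close>)
  next
    fix k
    have "fps_has_sum (\<lambda>x. fps_const (f $ k) * (case x of (i, j) \<Rightarrow> fps_const ((F ^ k) $ i $ j) * (u ^ i * v ^ j)))
        UNIV (fps_const (f $ k) * fps_subst2 (F ^ k) u v)"
      using F u v by (intro fps_has_sum_cmult fps_subst2_has_sum integral_fps2_power)
    then show "fps_has_sum (a k) UNIV (fps_const (f $ k) * fps_subst2 F u v ^ k)"
      using F u v by (simp add: a_def[abs_def] fps_subst2_power mult.assoc case_prod_unfold flip: fps_const_mult)
  next
    fix x :: "nat \<times> nat"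
    obtain i j where x: "x = (i, j)" by (cases x)
    have "((\<lambda>k. f $ k * (F ^ k) $ i $ j) has_sum (comp_outer f F $ i $ j)) UNIV"
      by (rule has_sum_finite_neutralI[where B = "{..i + j}"])
        (auto simp: comp_outer_def fps2_power_nth_eq_0[OF F(2)])
    then show "fps_has_sum (\<lambda>k. a k x) UNIV (case x of (i, j) \<Rightarrow> fps_const (comp_outer f F $ i $ j) * (u ^ i * v ^ j))"
      unfolding a_def x prod.case by (rule fps_has_sum_const)
  next
    show "fps_has_sum (\<lambda>k. fps_const (f $ k) * fps_subst2 F u v ^ k) UNIV (fps_subst f (fps_subst2 F u v))"
      using f Fuv by (rule fps_subst_has_sum)
  qed
qed

lemma fps_subst2_subst_subst:
  fixes F :: "'c::{nonarch_field, complete_space} fps fps"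
  assumes F: "F \<in> integral_fps2" and g: "g \<in> integral_fps" "g $ 0 = 0"
    and h: "h \<in> integral_fps" "h $ 0 = 0" and u: "u \<in> points" and v: "v \<in> points"
  shows "fps_subst2 F (fps_subst g u) (fps_subst h v) = fps_subst2 (comp_inner F g h) u v"
proof (rule fps_subst2_unique[symmetric])
  have gp: "g \<in> points" and hp: "h \<in> points"
    using g h by (auto simp: points_def integral_fps_def)
  note gu = fps_subst_points[OF gp u] and hv = fps_subst_points[OF hp v]
  define a where "a y x = (case y of (k, l) \<Rightarrow> case x of (i, j) \<Rightarrow>
      fps_const (F $ k $ l * (g ^ k) $ i * (h ^ l) $ j) * (u ^ i * v ^ j))" for y x
  define R where "R y = (case y of (k, l) \<Rightarrow>
      fps_const (F $ k $ l) * (fps_subst g u ^ k * fps_subst h v ^ l))" for y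
  show "fps_has_sum (\<lambda>(i, j). fps_const (comp_inner F g h $ i $ j) * (u ^ i * v ^ j)) UNIV
      (fps_subst2 F (fps_subst g u) (fps_subst h v))"
  proof (rule fps_has_sum_swap[where a = a and I = UNIV and R = R])
    fix m
    obtain s :: real where s: "0 < s" "s < 1" "\<And>k. gauss_le (1 / 2) (s ^ k) (u ^ k)"
      "\<And>k. gauss_le (1 / 2) (s ^ k) (v ^ k)"
      using points_common_bound[OF u v v] by metis
    have ss: "0 < sqrt s" "sqrt s < 1" using s by auto
    show "vanishing (\<lambda>(y, x). a y x $ m) (UNIV \<times> UNIV)"
      unfolding case_prod_unfold
    proof (rule gauss_le_vanishing[where r = "1 / 2" and t = "sqrt s"
            and w = "\<lambda>((k, l), i, j). (k + l) + (i + j)" and B = 1])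
      show "finite {i \<in> UNIV \<times> UNIV. (\<lambda>((k, l), i, j). (k + l) + (i + j)) i \<le> N}" for N :: nat
        by (rule finite_subset[of _ "({..N} \<times> {..N}) \<times> {..N} \<times> {..N}"]) auto
      fix x :: "(nat \<times> nat) \<times> nat \<times> nat"
      obtain k l i j where x: "x = ((k, l), i, j)" by (metis surj_pair)
      show "gauss_le (1 / 2) (1 * sqrt s ^ ((\<lambda>((k, l), i, j). (k + l) + (i + j)) x))
          (a (fst x) (snd x))"
      proof (cases "i < k \<or> j < l")
        case True
        then have "a (k, l) (i, j) = 0"
          using g(2) h(2) by (auto simp: a_def fps_nth_power_eq_0)
        then show ?thesis using ss by (auto simp: x gauss_le_def)
      next
        case False
        have "absval (F $ k $ l * (g ^ k) $ i * (h ^ l) $ j) \<le> 1"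
          using F integral_power[OF g(1), of k] integral_power[OF h(1), of l]
          by (intro absval_mult_le_one) (auto simp: integral_fps2_nth2 integral_fps_def)
        then have "gauss_le (1 / 2) (1 * (s ^ i * s ^ j)) (a (k, l) (i, j))"
          unfolding a_def prod.case using s(1) by (intro gauss_le_mult gauss_le_const s) auto
        moreover have "s ^ (i + j) \<le> sqrt s ^ ((k + l) + (i + j))"
          using False s by (intro power_le_sqrt_power) auto
        ultimately show ?thesis
          using x by (auto simp: power_add intro: gauss_le_mono)
      qed
    qed (use ss in auto)
  next
    fix y :: "nat \<times> nat"
    obtain k l where y: "y = (k, l)" by (cases y)
    have "fps_has_sum (\<lambda>x. fps_const (F $ k $ l) *
          (case x of (i, j) \<Rightarrow> (fps_const ((g ^ k) $ i) * u ^ i) * (fps_const ((h ^ l) $ j) * v ^ j)))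
        (UNIV \<times> UNIV) (fps_const (F $ k $ l) * (fps_subst (g ^ k) u * fps_subst (h ^ l) v))"
      using g h u v
      by (intro fps_has_sum_cmult fps_has_sum_mult fps_subst_has_sum integral_convergent integral_power)
    then show "fps_has_sum (a y) UNIV (R y)"
      using g h u v
      by (simp add: a_def[abs_def] R_def y fps_subst_power case_prod_unfold mult_ac flip: fps_const_mult)
  next
    fix x :: "nat \<times> nat"
    obtain i j where x: "x = (i, j)" by (cases x)
    have "((\<lambda>(k, l). F $ k $ l * (g ^ k) $ i * (h ^ l) $ j) has_sum (comp_inner F g h $ i $ j)) UNIV"
    proof (rule has_sum_finite_neutralI[where B = "{..i} \<times> {..j}"])
      show "(case y of (k, l) \<Rightarrow> F $ k $ l * (g ^ k) $ i * (h ^ l) $ j) = 0"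
        if "y \<in> UNIV - {..i} \<times> {..j}" for y
        using that g h by (cases y) (auto simp: fps_nth_power_eq_0)
    qed (auto simp: comp_inner_def sum.cartesian_product)
    then have "fps_has_sum (\<lambda>y. fps_const (case y of (k, l) \<Rightarrow> F $ k $ l * (g ^ k) $ i * (h ^ l) $ j) *
        (u ^ i * v ^ j)) UNIV (fps_const (comp_inner F g h $ i $ j) * (u ^ i * v ^ j))"
      by (rule fps_has_sum_const)
    then show "fps_has_sum (\<lambda>y. a y x) UNIV
        (case x of (i, j) \<Rightarrow> fps_const (comp_inner F g h $ i $ j) * (u ^ i * v ^ j))"
      unfolding a_def x by (simp add: case_prod_unfold)
  next
    show "fps_has_sum R UNIV (fps_subst2 F (fps_subst g u) (fps_subst h v))"
      unfolding R_def[abs_def] by (rule fps_subst2_has_sum[OF F gu hv])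
  qed
qed

text \<open>Here \<open>g\<close> and \<open>h\<close> are themselves series in the variable that is
  replaced by \<open>u\<close>. This is what turns \<open>br (a + b)\<close> into a sum of points
  and lets formal addition commute with translation and with \<open>br \<pi>\<close>.\<close>

lemma fps_subst_of_subst2:
  fixes F :: "'c::{nonarch_field, complete_space} fps fps"
  assumes F: "F \<in> integral_fps2" and g: "g \<in> points" and h: "h \<in> points" and u: "u \<in> points"
  shows "fps_subst (fps_subst2 F g h) u = fps_subst2 F (fps_subst g u) (fps_subst h u)"
proof (rule fps_subst_unique)
  note gu = fps_subst_points[OF g u] and hu = fps_subst_points[OF h u]
  define a where "a y n = (case y of (k, l) \<Rightarrow>
      fps_const (F $ k $ l * (g ^ k * h ^ l) $ n) * u ^ n)" for y n
  define R where "R y = (case y of (k, l) \<Rightarrow>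
      fps_const (F $ k $ l) * (fps_subst g u ^ k * fps_subst h u ^ l))" for y
  show "fps_has_sum (\<lambda>n. fps_const (fps_subst2 F g h $ n) * u ^ n) UNIV
      (fps_subst2 F (fps_subst g u) (fps_subst h u))"
  proof (rule fps_has_sum_swap[where a = a and I = UNIV and R = R])
    fix m
    obtain s :: real where s: "1 / 2 \<le> s" "s < 1" "\<And>k. gauss_le (1 / 2) (s ^ k) (u ^ k)"
      by (rule subst_term_gauss_le[OF u, of "1 / 2"]) auto
    define \<rho> where "\<rho> = (1 + s) / 2"
    have \<rho>: "0 < \<rho>" "\<rho> < 1" "s < \<rho>" using s by (auto simp: \<rho>_def)
    obtain \<sigma>g :: real where \<sigma>g: "\<rho> \<le> \<sigma>g" "\<sigma>g < 1" "gauss_le \<rho> \<sigma>g g"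
      using points_gauss_le[OF g, of \<rho>] \<rho> by auto
    obtain \<sigma>h :: real where \<sigma>h: "\<rho> \<le> \<sigma>h" "\<sigma>h < 1" "gauss_le \<rho> \<sigma>h h"
      using points_gauss_le[OF h, of \<rho>] \<rho> by auto
    define \<sigma> where "\<sigma> = max \<sigma>g \<sigma>h"
    have \<sigma>: "0 < \<sigma>" "\<sigma> < 1" "gauss_le \<rho> \<sigma> g" "gauss_le \<rho> \<sigma> h"
      using \<sigma>g \<sigma>h \<rho> by (auto simp: \<sigma>_def less_max_iff_disj intro: gauss_le_mono)
    define T where "T = max \<sigma> (s / \<rho>)"
    show "vanishing (\<lambda>(y, n). a y n $ m) (UNIV \<times> UNIV)"
      unfolding case_prod_unfold
    proof (rule gauss_le_vanishing[where r = "1 / 2" and t = T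
            and w = "\<lambda>((k, l), n). (k + l) + n" and B = 1])
      show "finite {i \<in> UNIV \<times> UNIV. (\<lambda>((k, l), n). (k + l) + n) i \<le> N}" for N :: nat
        by (rule finite_subset[of _ "({..N} \<times> {..N}) \<times> {..N}"]) auto
      fix x :: "(nat \<times> nat) \<times> nat"
      obtain k l n where x: "x = ((k, l), n)" by (metis surj_pair)
      have "gauss_le \<rho> (\<sigma> ^ k * \<sigma> ^ l) (g ^ k * h ^ l)"
        using \<rho> \<sigma> by (intro gauss_le_mult gauss_le_power) auto
      then have 1: "absval ((g ^ k * h ^ l) $ n) * \<rho> ^ n \<le> \<sigma> ^ (k + l)"
        by (simp add: gauss_le_def power_add)
      have "absval (F $ k $ l * (g ^ k * h ^ l) $ n) * s ^ n \<le> absval ((g ^ k * h ^ l) $ n) * s ^ n"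
        using F s by (intro mult_right_mono) (auto simp: absval_mult integral_fps2_nth2 mult_left_le_one_le)
      also have "\<dots> \<le> \<sigma> ^ (k + l) * (s / \<rho>) ^ n"
        using \<rho> s mult_right_mono[OF 1, of "(s / \<rho>) ^ n"] by (simp add: power_divide)
      also have "\<dots> \<le> T ^ ((k + l) + n)"
        unfolding T_def using \<sigma> \<rho> s by (intro max_power_le) auto
      finally have "absval (F $ k $ l * (g ^ k * h ^ l) $ n) * s ^ n \<le> T ^ ((k + l) + n)" .
      moreover have "gauss_le (1 / 2) (absval (F $ k $ l * (g ^ k * h ^ l) $ n) * s ^ n) (a (k, l) n)"
        unfolding a_def prod.case by (intro gauss_le_mult gauss_le_const s) auto
      ultimately show "gauss_le (1 / 2) (1 * T ^ ((\<lambda>((k, l), n). (k + l) + n) x))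
          (a (fst x) (snd x))"
        using x by (auto intro: gauss_le_mono)
    qed (use \<sigma> \<rho> s in \<open>auto simp: T_def\<close>)
  next
    fix y :: "nat \<times> nat"
    obtain k l where y: "y = (k, l)" by (cases y)
    have "fps_has_sum (\<lambda>n. fps_const (F $ k $ l) * (fps_const ((g ^ k * h ^ l) $ n) * u ^ n)) UNIV
        (fps_const (F $ k $ l) * fps_subst (g ^ k * h ^ l) u)"
      using g h u
      by (intro fps_has_sum_cmult fps_subst_has_sum integral_convergent integral_mult integral_power
          points_integral)
    then show "fps_has_sum (a y) UNIV (R y)"
      using g h u
      by (simp add: a_def[abs_def] R_def y fps_subst_power fps_subst_mult integral_convergent
          integral_power points_integral mult_ac flip: fps_const_mult)
  next
    fix n
    have "((\<lambda>(k, l). F $ k $ l * (g ^ k * h ^ l) $ n) has_sum (fps_subst2 F g h $ n)) UNIV"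
      using fps_has_sumD[OF fps_subst2_has_sum[OF F g h], of n] by (simp add: case_prod_unfold)
    then have "fps_has_sum (\<lambda>y. fps_const (case y of (k, l) \<Rightarrow> F $ k $ l * (g ^ k * h ^ l) $ n) * u ^ n)
        UNIV (fps_const (fps_subst2 F g h $ n) * u ^ n)"
      by (rule fps_has_sum_const)
    then show "fps_has_sum (\<lambda>y. a y n) UNIV (fps_const (fps_subst2 F g h $ n) * u ^ n)"
      unfolding a_def by (simp add: case_prod_unfold)
  next
    show "fps_has_sum R UNIV (fps_subst2 F (fps_subst g u) (fps_subst h u))"
      unfolding R_def[abs_def] by (rule fps_subst2_has_sum[OF F gu hu])
  qed
qed

lemma fps_subst2_subst2_has_sum:
  fixes F :: "'c::{nonarch_field, complete_space} fps fps"
  assumes F: "F \<in> integral_fps2" "F $ 0 $ 0 = 0"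
    and u: "u \<in> points" and v: "v \<in> points" and w: "w \<in> points"
  shows "fps_has_sum (\<lambda>((i, j), k). fps_const (\<Sum>m\<le>i + j. F $ m $ k * (F ^ m) $ i $ j) *
      (u ^ i * v ^ j * w ^ k)) UNIV (fps_subst2 F (fps_subst2 F u v) w)"
proof -
  have Fuv: "fps_subst2 F u v \<in> points" using F u v by (rule fps_subst2_points)
  define a where "a m x = (case x of ((i, j), k) \<Rightarrow>
      fps_const (F $ m $ k * (F ^ m) $ i $ j) * (u ^ i * v ^ j * w ^ k))" for m x
  define R where "R m = fps_subst2 F u v ^ m * fps_subst (F $ m) w" for m
  show ?thesis
  proof (rule fps_has_sum_swap[where a = a and I = UNIV and R = R])
    fix n
    obtain s :: real where s: "0 < s" "s < 1" "\<And>k. gauss_le (1 / 2) (s ^ k) (u ^ k)"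
      "\<And>k. gauss_le (1 / 2) (s ^ k) (v ^ k)" "\<And>k. gauss_le (1 / 2) (s ^ k) (w ^ k)"
      using points_common_bound[OF u v w] by metis
    have ss: "0 < sqrt s" "sqrt s < 1" using s by auto
    show "vanishing (\<lambda>(m, x). a m x $ n) (UNIV \<times> UNIV)"
      unfolding case_prod_unfold
    proof (rule gauss_le_vanishing[where r = "1 / 2" and t = "sqrt s"
            and w = "\<lambda>(m, (i, j), k). m + (i + j + k)" and B = 1])
      show "finite {i \<in> UNIV \<times> UNIV. (\<lambda>(m, (i, j), k). m + (i + j + k)) i \<le> N}" for N :: nat
        by (rule finite_subset[of _ "{..N} \<times> ({..N} \<times> {..N}) \<times> {..N}"]) auto
      fix x :: "nat \<times> (nat \<times> nat) \<times> nat"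
      obtain m i j k where x: "x = (m, (i, j), k)" by (metis surj_pair)
      show "gauss_le (1 / 2) (1 * sqrt s ^ ((\<lambda>(m, (i, j), k). m + (i + j + k)) x))
          (a (fst x) (snd x))"
      proof (cases "i + j < m")
        case True
        then have "a m ((i, j), k) = 0"
          by (simp add: a_def fps2_power_nth_eq_0[OF F(2)])
        then show ?thesis using ss by (auto simp: x gauss_le_def)
      next
        case False
        have "absval (F $ m $ k * (F ^ m) $ i $ j) \<le> 1"
          using F by (intro absval_mult_le_one) (auto simp: integral_fps2_nth2 integral_fps2_power)
        then have "gauss_le (1 / 2) (1 * (s ^ i * s ^ j * s ^ k)) (a m ((i, j), k))"
          unfolding a_def prod.case using s(1) by (intro gauss_le_mult gauss_le_const s) auto
        moreover have "s ^ (i + j + k) \<le> sqrt s ^ (m + (i + j + k))"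
          using False s by (intro power_le_sqrt_power) auto
        ultimately show ?thesis
          using x by (auto simp: power_add intro: gauss_le_mono)
      qed
    qed (use ss in auto)
  next
    fix m
    have "fps_has_sum (\<lambda>(x, k). (case x of (i, j) \<Rightarrow> fps_const ((F ^ m) $ i $ j) * (u ^ i * v ^ j)) *
          (fps_const (F $ m $ k) * w ^ k)) (UNIV \<times> UNIV) (fps_subst2 (F ^ m) u v * fps_subst (F $ m) w)"
      using F u v w
      by (intro fps_has_sum_mult fps_subst2_has_sum fps_subst_has_sum integral_convergent
          integral_fps2_power integral_fps2_nth)
    then show "fps_has_sum (a m) UNIV (R m)"
      using F u v by (simp add: a_def[abs_def] R_def fps_subst2_power case_prod_unfold mult_ac
          flip: fps_const_mult)
  next
    fix x :: "(nat \<times> nat) \<times> nat"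
    obtain i j k where x: "x = ((i, j), k)" by (metis surj_pair)
    have "((\<lambda>m. F $ m $ k * (F ^ m) $ i $ j) has_sum (\<Sum>m\<le>i + j. F $ m $ k * (F ^ m) $ i $ j)) UNIV"
      by (rule has_sum_finite_neutralI[where B = "{..i + j}"])
        (auto simp: fps2_power_nth_eq_0[OF F(2)])
    then show "fps_has_sum (\<lambda>m. a m x) UNIV ((\<lambda>((i, j), k).
        fps_const (\<Sum>m\<le>i + j. F $ m $ k * (F ^ m) $ i $ j) * (u ^ i * v ^ j * w ^ k)) x)"
      unfolding a_def x prod.case by (rule fps_has_sum_const)
  next
    show "fps_has_sum R UNIV (fps_subst2 F (fps_subst2 F u v) w)"
      unfolding R_def[abs_def] by (rule fps_subst2_has_sum_iterated[OF F(1) Fuv w])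
  qed
qed

lemma fps_subst2_commute:
  fixes F :: "'c::{nonarch_field, complete_space} fps fps"
  assumes F: "F \<in> integral_fps2" and sym: "\<And>i j. F $ i $ j = F $ j $ i"
    and u: "u \<in> points" and v: "v \<in> points"
  shows "fps_subst2 F u v = fps_subst2 F v u"
proof (rule fps_subst2_unique)
  have "fps_has_sum (\<lambda>(i, j). fps_const (F $ i $ j) * (v ^ i * u ^ j)) UNIV (fps_subst2 F v u)"
    using F v u by (rule fps_subst2_has_sum)
  then have "fps_has_sum ((\<lambda>(i, j). fps_const (F $ i $ j) * (v ^ i * u ^ j)) \<circ> prod.swap) UNIV (fps_subst2 F v u)"
    unfolding fps_has_sum_def
    by (subst (asm) has_sum_reindex_bij_betw[of prod.swap UNIV UNIV, symmetric]) auto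
  then show "fps_has_sum (\<lambda>(i, j). fps_const (F $ i $ j) * (u ^ i * v ^ j)) UNIV (fps_subst2 F v u)"
    by (simp add: case_prod_unfold o_def mult.commute sym[of "snd _"])
qed

text \<open>By symmetry \<open>F(u, F(v, w))\<close> is \<open>F(F(v, w), u)\<close>, so the
  expansion of the left-nested sum serves for both sides.\<close>

lemma fps_subst2_assoc:
  fixes F :: "'c::{nonarch_field, complete_space} fps fps"
  assumes F: "F \<in> integral_fps2" "F $ 0 $ 0 = 0" and sym: "\<And>i j. F $ i $ j = F $ j $ i"
    and assoc: "\<And>i j k. (\<Sum>m\<le>i + j. F $ m $ k * (F ^ m) $ i $ j) = (\<Sum>m\<le>j + k. F $ i $ m * (F ^ m) $ j $ k)"
    and u: "u \<in> points" and v: "v \<in> points" and w: "w \<in> points"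
  shows "fps_subst2 F (fps_subst2 F u v) w = fps_subst2 F u (fps_subst2 F v w)"
proof -
  define c where "c i j k = (\<Sum>m\<le>i + j. F $ m $ k * (F ^ m) $ i $ j)" for i j k
  define a where "a = (\<lambda>((i, j), k). fps_const (c i j k) * (u ^ i * v ^ j * w ^ k))"
  define b where "b = (\<lambda>((i, j), k). fps_const (c i j k) * (v ^ i * w ^ j * u ^ k))"
  \<comment> \<open>Associativity and symmetry of \<open>F\<close> together say that the
    coefficients of the left-nested expansion are invariant under cyclic permutation of the three
    variables.\<close>
  have c: "c j k i = c i j k" for i j k
  proof -
    have "c i j k = (\<Sum>m\<le>j + k. F $ i $ m * (F ^ m) $ j $ k)" unfolding c_def by (rule assoc)
    also have "\<dots> = c j k i" unfolding c_def by (intro sum.cong) (simp_all add: sym[of i])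
    finally show ?thesis ..
  qed
  have a: "fps_has_sum a UNIV (fps_subst2 F (fps_subst2 F u v) w)"
    unfolding a_def c_def using F u v w by (rule fps_subst2_subst2_has_sum)
  have "fps_has_sum b UNIV (fps_subst2 F (fps_subst2 F v w) u)"
    unfolding b_def c_def using F v w u by (rule fps_subst2_subst2_has_sum)
  moreover have "bij (\<lambda>((i, j), k). ((j, k), i))"
    by (rule o_bij[where g = "\<lambda>((j, k), i). ((i, j), k)"]) auto
  ultimately have "fps_has_sum (b \<circ> (\<lambda>((i, j), k). ((j, k), i))) UNIV (fps_subst2 F (fps_subst2 F v w) u)"
    unfolding fps_has_sum_def
    by (subst (asm) has_sum_reindex_bij_betw[of "\<lambda>((i, j), k). ((j, k), i)" UNIV UNIV, symmetric]) auto
  moreover have "b \<circ> (\<lambda>((i, j), k). ((j, k), i)) = a"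
    by (auto simp: a_def b_def c mult_ac)
  ultimately have "fps_subst2 F (fps_subst2 F u v) w = fps_subst2 F (fps_subst2 F v w) u"
    using a fps_has_sum_unique by metis
  also have "\<dots> = fps_subst2 F u (fps_subst2 F v w)"
    using F sym u v w by (intro fps_subst2_commute fps_subst2_points) auto
  finally show ?thesis .
qed

subsection \<open>Finite extensions of the p-adic numbers are closed\<close>

lemma padic_numbers_closed: "closed padic_numbers"
  by (simp add: padic_numbers_def)

lemma padic_numbers_seq:
  "x \<in> padic_numbers \<longleftrightarrow> (\<exists>f. (\<forall>n. f n \<in> \<rat>) \<and> f \<longlonglongrightarrow> x)"
  by (simp add: padic_numbers_def closure_sequential)

lemma padic_numbers_Rats: "x \<in> \<rat> \<Longrightarrow> x \<in> padic_numbers"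
  using closure_subset unfolding padic_numbers_def by blast

lemma padic_numbers_add: "x \<in> padic_numbers \<Longrightarrow> y \<in> padic_numbers \<Longrightarrow> x + y \<in> padic_numbers"
proof -
  assume "x \<in> padic_numbers" "y \<in> padic_numbers"
  then obtain f g where "\<And>n. f n \<in> \<rat>" "f \<longlonglongrightarrow> x" "\<And>n. g n \<in> \<rat>" "g \<longlonglongrightarrow> y"
    unfolding padic_numbers_seq by blast
  then show ?thesis
    unfolding padic_numbers_seq by (intro exI[of _ "\<lambda>n. f n + g n"]) (auto intro: tendsto_add)
qed

lemma padic_numbers_mult: "x \<in> padic_numbers \<Longrightarrow> y \<in> padic_numbers \<Longrightarrow> x * y \<in> padic_numbers"
proof -
  assume "x \<in> padic_numbers" "y \<in> padic_numbers"
  then obtain f g where "\<And>n. f n \<in> \<rat>" "f \<longlonglongrightarrow> x" "\<And>n. g n \<in> \<rat>" "g \<longlonglongrightarrow> y"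
    unfolding padic_numbers_seq by blast
  then show ?thesis
    unfolding padic_numbers_seq by (intro exI[of _ "\<lambda>n. f n * g n"]) (auto intro: tendsto_mult)
qed

lemma padic_numbers_uminus: "x \<in> padic_numbers \<Longrightarrow> - x \<in> padic_numbers"
  using padic_numbers_mult[of "-1" x] padic_numbers_Rats[of "-1"] by simp

lemma padic_numbers_inverse:
  assumes "x \<in> padic_numbers"
  shows "inverse x \<in> padic_numbers"
proof (cases "x = 0")
  case False
  have "\<exists>y\<in>\<rat>. dist y (inverse x) < e" if e: "e > 0" for e
  proof -
    have "min (absval x) (e * absval x ^ 2) > 0" using e False by simp
    then have "\<exists>y\<in>\<rat>. dist y x < min (absval x) (e * absval x ^ 2)"
      using assms unfolding padic_numbers_def closure_approachable by blast
    then obtain y where y: "y \<in> \<rat>" "absval (y - x) < absval x" "absval (y - x) < e * absval x ^ 2"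
      by (auto simp: dist_eq_absval)
    \<comment> \<open>An approximation closer than \<open>absval x\<close> has the same absolute
      value, which controls the denominator of the difference of inverses.\<close>
    have yx: "absval y = absval x"
      using absval_add_eq[OF y(2)] by simp
    then have "y \<noteq> 0" using False by (metis absval_eq_0_iff)
    then have "inverse y - inverse x = (x - y) / (y * x)"
      using False by (simp add: field_simps)
    then have "absval (inverse y - inverse x) = absval (y - x) / absval x ^ 2"
      by (simp add: absval_divide absval_mult yx absval_minus_commute power2_eq_square)
    also have "\<dots> < e"
      using y(3) False by (simp add: divide_less_eq)
    finally show ?thesis
      using y(1) by (auto simp: dist_eq_absval intro!: bexI[of _ "inverse y"])
  qed
  then show ?thesis
    unfolding padic_numbers_def closure_approachable by blast
qed (simp add: padic_numbers_Rats)

text \<open>The usual argument over a complete field, by induction on the generators: a generator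
  outside the closed span \<open>V\<close> of the others has positive distance \<open>d\<close> from
  it, so convergence of \<open>v + a * b\<close> forces convergence of the coefficient
  \<open>a\<close>.\<close>

lemma finite_span_closed:
  fixes k :: "'c::{nonarch_field, complete_space} set"
  assumes k: "closed k" "0 \<in> k" "1 \<in> k" "\<And>x y. x \<in> k \<Longrightarrow> y \<in> k \<Longrightarrow> x + y \<in> k"
    "\<And>x y. x \<in> k \<Longrightarrow> y \<in> k \<Longrightarrow> x * y \<in> k" "\<And>x. x \<in> k \<Longrightarrow> - x \<in> k" "\<And>x. x \<in> k \<Longrightarrow> inverse x \<in> k"
    and "finite B"
  shows "closed {\<Sum>b\<in>B. c b * b | c. \<forall>b\<in>B. c b \<in> k}"
  using assms(8)
proof (induction B rule: finite_induct)
  case (insert b B)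
  define V where "V = {\<Sum>b\<in>B. c b * b | c. \<forall>b\<in>B. c b \<in> k}"
  have V0: "0 \<in> V" unfolding V_def using k(2) by (auto intro!: exI[of _ "\<lambda>_. 0"])
  have Vadd: "x + y \<in> V" if "x \<in> V" "y \<in> V" for x y
    using that k(4) unfolding V_def
    by (force simp: distrib_right sum.distrib intro: exI[of _ "\<lambda>b. f b + g b" for f g])
  have Vscale: "a * x \<in> V" if "x \<in> V" "a \<in> k" for x a
    using that k(5) unfolding V_def
    by (force simp: sum_distrib_left mult.assoc intro: exI[of _ "\<lambda>b. a * f b" for f])
  have Vdiff: "x - y \<in> V" if "x \<in> V" "y \<in> V" for x y
    using Vadd[OF that(1) Vscale[OF that(2) k(6)[OF k(3)]]] by simp
  have eq: "{\<Sum>b\<in>insert b B. c b * b | c. \<forall>b\<in>insert b B. c b \<in> k} = {v + a * b | v a. v \<in> V \<and> a \<in> k}"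
  proof (intro equalityI subsetI)
    fix x assume "x \<in> {\<Sum>b\<in>insert b B. c b * b | c. \<forall>b\<in>insert b B. c b \<in> k}"
    then show "x \<in> {v + a * b | v a. v \<in> V \<and> a \<in> k}"
    proof safe
      fix c assume c: "\<forall>b\<in>insert b B. c b \<in> k"
      show "\<exists>v a. (\<Sum>b\<in>insert b B. c b * b) = v + a * b \<and> v \<in> V \<and> a \<in> k"
        using c insert.hyps unfolding V_def
        by (intro exI[of _ "\<Sum>b\<in>B. c b * b"] exI[of _ "c b"]) (auto simp: add.commute)
    qed
  next
    fix x assume "x \<in> {v + a * b | v a. v \<in> V \<and> a \<in> k}"
    then obtain c a where c: "x = (\<Sum>b\<in>B. c b * b) + a * b" "\<forall>b\<in>B. c b \<in> k" "a \<in> k"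
      unfolding V_def by auto
    have "(\<Sum>b'\<in>B. (c(b := a)) b' * b') = (\<Sum>b\<in>B. c b * b)"
      using insert.hyps by (intro sum.cong) auto
    then show "x \<in> {\<Sum>b\<in>insert b B. c b * b | c. \<forall>b\<in>insert b B. c b \<in> k}"
      using c insert.hyps by (auto intro!: exI[of _ "c(b := a)"] simp: add.commute)
  qed
  have Vcl: "closed V" using insert.IH by (simp add: V_def)
  show ?case
  proof (cases "b \<in> V")
    case True
    then have "{v + a * b | v a. v \<in> V \<and> a \<in> k} = V"
      using Vadd Vscale k(2) by force
    then show ?thesis using eq Vcl by simp
  next
    case False
    then have "open (- V)" "b \<in> - V" using Vcl by auto
    then obtain d where d: "d > 0" "ball b d \<subseteq> - V" by (meson openE)
    \<comment> \<open>Dividing by \<open>a\<close> reduces the claim to the distance between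
      \<open>b\<close> and the element \<open>- inverse a * v\<close> of \<open>V\<close>.\<close>
    have dist: "absval a * d \<le> absval (v + a * b)" if "v \<in> V" "a \<in> k" for v a
    proof (cases "a = 0")
      case a: False
      have "(- inverse a) * v \<in> V" using that k(6,7) by (intro Vscale) auto
      then have "(- inverse a) * v \<notin> ball b d" using d by auto
      then have "d \<le> absval (b + inverse a * v)" by (auto simp: dist_eq_absval)
      then have "absval a * d \<le> absval (a * (b + inverse a * v))"
        by (simp add: absval_mult mult_left_mono)
      also have "a * (b + inverse a * v) = v + a * b" using a by (simp add: algebra_simps)
      finally show ?thesis .
    qed auto
    show ?thesis
      unfolding eq closed_sequential_limits
    proof (intro allI impI)
      fix x l assume xl: "(\<forall>n. x n \<in> {v + a * b | v a. v \<in> V \<and> a \<in> k}) \<and> x \<longlonglongrightarrow> l"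
      then have "\<forall>n. \<exists>v a. x n = v + a * b \<and> v \<in> V \<and> a \<in> k" by auto
      then obtain v a where va: "\<And>n. x n = v n + a n * b" "\<And>n. v n \<in> V" "\<And>n. a n \<in> k" by metis
      have ad: "absval (a m - a n) * d \<le> dist (x m) (x n)" for m n
      proof -
        have "a m - a n \<in> k" using va(3) k(4,6) by (metis diff_conv_add_uminus)
        then have "absval (a m - a n) * d \<le> absval ((v m - v n) + (a m - a n) * b)"
          using va by (intro dist Vdiff) auto
        also have "(v m - v n) + (a m - a n) * b = x m - x n" by (simp add: va algebra_simps)
        finally show ?thesis by (simp add: dist_eq_absval)
      qed
      have "Cauchy x" using xl LIMSEQ_imp_Cauchy by blast
      then have "Cauchy a"
        unfolding Cauchy_def
      proof (intro allI impI)
        fix e :: real assume "e > 0" and *: "\<forall>e>0. \<exists>M. \<forall>m\<ge>M. \<forall>n\<ge>M. dist (x m) (x n) < e"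
        then have "e * d > 0" using d by simp
        then obtain M where M: "\<And>m n. m \<ge> M \<Longrightarrow> n \<ge> M \<Longrightarrow> dist (x m) (x n) < e * d" using * by blast
        have "dist (a m) (a n) < e" if "m \<ge> M" "n \<ge> M" for m n
        proof -
          have "absval (a m - a n) * d < e * d" using ad[of m n] M[OF that] by linarith
          then show ?thesis using d by (simp add: dist_eq_absval)
        qed
        then show "\<exists>M. \<forall>m\<ge>M. \<forall>n\<ge>M. dist (a m) (a n) < e" by blast
      qed
      then obtain a' where a': "a \<longlonglongrightarrow> a'" using Cauchy_convergent convergent_def by blast
      have "a' \<in> k" using k(1) va(3) a' closed_sequentially by blast
      moreover have "(\<lambda>n. x n - a n * b) \<longlonglongrightarrow> l - a' * b"
        using xl a' by (intro tendsto_intros) auto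
      then have "v \<longlonglongrightarrow> l - a' * b" by (simp add: va)
      then have "l - a' * b \<in> V" using Vcl va(2) closed_sequentially by blast
      moreover have "l = (l - a' * b) + a' * b" by simp
      ultimately show "l \<in> {v + a * b | v a. v \<in> V \<and> a \<in> k}" by blast
    qed
  qed
qed simp

text \<open>\<open>K\<close> is the span of finitely many elements over the closed field of p-adic
  numbers. Closedness keeps the coefficients of infinite sums, and the fixed points of contractions,
  inside \<open>K\<close>.\<close>

lemma padic_extension_closed:
  fixes K :: "'c::{nonarch_field, complete_space} set"
  assumes "finite_padic_extension p K"
    and add: "\<And>x y. x \<in> K \<Longrightarrow> y \<in> K \<Longrightarrow> x + y \<in> K"
    and mult: "\<And>x y. x \<in> K \<Longrightarrow> y \<in> K \<Longrightarrow> x * y \<in> K"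
  shows "closed K"
proof -
  have Q: "padic_numbers \<subseteq> K" using assms(1) by (simp add: finite_padic_extension_def)
  obtain B where B: "finite B" "B \<subseteq> K"
    "\<And>x. x \<in> K \<Longrightarrow> \<exists>c. (\<forall>b\<in>B. c b \<in> padic_numbers) \<and> x = (\<Sum>b\<in>B. c b * b)"
    using assms(1) unfolding finite_padic_extension_def by blast
  have "0 \<in> K" using Q padic_numbers_Rats[of 0] by auto
  have "K = {\<Sum>b\<in>B. c b * b | c. \<forall>b\<in>B. c b \<in> padic_numbers}"
  proof (intro equalityI subsetI)
    fix x assume "x \<in> {\<Sum>b\<in>B. c b * b | c. \<forall>b\<in>B. c b \<in> padic_numbers}"
    then obtain c where c: "x = (\<Sum>b\<in>B. c b * b)" "\<forall>b\<in>B. c b \<in> padic_numbers" by blast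
    then have "\<forall>b\<in>B. c b * b \<in> K" using Q B(2) mult by blast
    with \<open>finite B\<close> show "x \<in> K" unfolding c(1)
      by (induction B rule: finite_induct) (auto intro: add \<open>0 \<in> K\<close>)
  qed (use B(3) in blast)
  moreover have "closed {\<Sum>b\<in>B. c b * b | c. \<forall>b\<in>B. c b \<in> (padic_numbers :: 'c set)}"
    using B(1)
    by (intro finite_span_closed)
      (auto simp: padic_numbers_closed padic_numbers_Rats padic_numbers_add padic_numbers_mult padic_numbers_uminus
        padic_numbers_inverse)
  ultimately show ?thesis by simp
qed

subsection \<open>Integral polynomials that are small at representatives of the residue field\<close>

text \<open>Modulo the maximal ideal, a polynomial of degree below the number of its roots is zero;
  the hypothesis on \<open>s - t\<close> says that the points have distinct reductions. With
  absolute values the argument runs by synthetic division, without a residue field.\<close>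

lemma small_values_imp_small_coeffs:
  fixes P :: "'c::nonarch_field poly"
  assumes "finite S" "\<And>s. s \<in> S \<Longrightarrow> absval s \<le> 1"
    "\<And>s t. s \<in> S \<Longrightarrow> t \<in> S \<Longrightarrow> s \<noteq> t \<Longrightarrow> absval (s - t) = 1"
    "\<And>i. absval (poly.coeff P i) \<le> 1" "\<And>i. i \<ge> card S \<Longrightarrow> poly.coeff P i = 0"
    "\<And>s. s \<in> S \<Longrightarrow> absval (poly P s) < 1"
  shows "absval (poly.coeff P i) < 1"
  using assms
proof (induction S arbitrary: P i rule: finite_induct)
  case (insert s S)
  define Q where "Q = synthetic_div P s"
  have PQ: "P = [:- s, 1:] * Q + [:poly P s:]"
    using synthetic_div_correct'[of s P] by (simp add: Q_def)
  have coeff: "poly.coeff P (Suc n) = poly.coeff Q n - s * poly.coeff Q (Suc n)" for n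
    by (subst PQ) simp
  have coeff0: "poly.coeff P 0 = poly P s - s * poly.coeff Q 0"
    by (subst (1) PQ) simp
  have Qzero: "poly.coeff Q n = 0" if "n \<ge> card S" for n
  proof (cases "P = 0 \<or> Polynomial.degree P = 0")
    case True
    then have "Polynomial.degree P = 0" by auto
    then have "Q = 0" unfolding Q_def by (rule synthetic_div_eq_0_iff[THEN iffD2])
    then show ?thesis by simp
  next
    case False
    then have "poly.coeff P (Polynomial.degree P) \<noteq> 0" by auto
    then have "Polynomial.degree P < card (insert s S)" using insert.prems(4) by (meson not_le)
    then have "Polynomial.degree P - 1 < n" using that insert.hyps False by simp linarith
    then have "Polynomial.degree Q < n" by (simp add: Q_def degree_synthetic_div)
    then show ?thesis by (rule coeff_eq_0)
  qed
  \<comment> \<open>Descending induction: beyond the degree the coefficients vanish, and each lower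
    one is a coefficient of \<open>P\<close> plus \<open>s\<close> times the next one.\<close>
  have Qint: "absval (poly.coeff Q n) \<le> 1" for n
  proof (cases "n \<le> card S")
    case True
    then show ?thesis
    proof (induction n rule: inc_induct)
      case base
      then show ?case by (simp add: Qzero)
    next
      case (step n)
      have "poly.coeff Q n = poly.coeff P (Suc n) + s * poly.coeff Q (Suc n)" by (simp add: coeff)
      then show ?case
        using step.IH insert.prems(1)[of s] insert.prems(3)
        by (auto intro!: absval_add_bound absval_mult_le_one)
    qed
  qed (simp add: Qzero)
  have Qsmall: "absval (poly.coeff Q n) < 1" for n
  proof (rule insert.IH)
    fix t assume t: "t \<in> S"
    then have st: "absval (t - s) = 1" using insert.prems(2)[of t s] insert.hyps by auto
    have "poly P t - poly P s = (t - s) * poly Q t"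
      using arg_cong[OF PQ, of "\<lambda>R. poly R t"] by (simp add: algebra_simps)
    then have "absval (poly Q t) = absval (poly P t - poly P s)"
      by (simp add: absval_mult st)
    also have "\<dots> < 1"
      using insert.prems(5)[of t] insert.prems(5)[of s] t absval_diff_le[of "poly P t" "poly P s"] by simp
    finally show "absval (poly Q t) < 1" .
  qed (use insert.prems Qint Qzero in auto)
  have small: "absval (x - s * poly.coeff Q m) < 1" if "absval x < 1" for x m
  proof -
    have "absval (s * poly.coeff Q m) < 1"
      using Qsmall[of m] insert.prems(1)[of s] mult_right_mono[of "absval s" 1 "absval (poly.coeff Q m)"]
      by (simp add: absval_mult)
    then show ?thesis using that absval_diff_le[of x "s * poly.coeff Q m"] by simp
  qed
  show ?case
    using coeff coeff0 small Qsmall insert.prems(5)[of s] by (cases i) auto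
qed simp

subsection \<open>The ring of integers\<close>

lemma ring_of_type_algebra_simps [simp]:
  "carrier (ring_of_type_algebra :: 'a::ring_1 ring) = UNIV"
  "mult (ring_of_type_algebra :: 'a ring) = (*)" "one (ring_of_type_algebra :: 'a ring) = 1"
  "ring.zero (ring_of_type_algebra :: 'a ring) = 0" "ring.add (ring_of_type_algebra :: 'a ring) = (+)"
  by (simp_all add: ring_of_type_algebra_def fun_eq_iff)

lemma ring_of_integers_simps [simp]:
  "carrier (ring_of_integers K) = {x \<in> K. absval x \<le> 1}"
  "mult (ring_of_integers K) = (*)" "one (ring_of_integers K) = 1"
  "ring.zero (ring_of_integers K) = 0" "ring.add (ring_of_integers K) = (+)"
  by (simp_all add: ring_of_integers_def)

lemma subfield_type_algebra:
  fixes K :: "'a::Fields.field set"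
  assumes "subfield K ring_of_type_algebra"
  shows "0 \<in> K" "1 \<in> K" "x \<in> K \<Longrightarrow> y \<in> K \<Longrightarrow> x + y \<in> K" "x \<in> K \<Longrightarrow> y \<in> K \<Longrightarrow> x * y \<in> K"
    "x \<in> K \<Longrightarrow> - x \<in> K" "x \<in> K \<Longrightarrow> inverse x \<in> K"
proof -
  interpret R: field "ring_of_type_algebra :: 'a ring" by (rule field_from_type_algebra)
  note sr = subringE[OF subfieldE(1)[OF assms]]
  show "0 \<in> K" "1 \<in> K" using sr(2,3) by simp_all
  show "x + y \<in> K" "x * y \<in> K" if "x \<in> K" "y \<in> K" using sr(6,7) that by simp_all
  have neg: "\<ominus>\<^bsub>ring_of_type_algebra\<^esub> x = - x" for x :: 'a
    using R.minus_equality[of "- x" x] by simp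
  show "- x \<in> K" if "x \<in> K" using sr(5)[OF that] by (simp add: neg)
  show "inverse x \<in> K" if "x \<in> K"
  proof (cases "x = 0")
    case False
    then have x: "x \<in> K - {\<zero>\<^bsub>ring_of_type_algebra\<^esub>}" using that by simp
    have "x * inv\<^bsub>ring_of_type_algebra\<^esub> x = 1"
      using R.subfield_m_inv(2)[OF assms x] by simp
    then have "inv\<^bsub>ring_of_type_algebra\<^esub> x = inverse x" by (metis inverse_unique)
    then show ?thesis using R.subfield_m_inv(1)[OF assms x] by simp
  qed (use that in simp)
qed

lemma ring_of_integers_cring:
  assumes "subfield K (ring_of_type_algebra :: 'c::nonarch_field ring)"
  shows "cring (ring_of_integers K)"
proof (rule cringI)
  note sf = subfield_type_algebra[OF assms]
  show "abelian_group (ring_of_integers K)"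
  proof (rule abelian_groupI)
    fix x assume "x \<in> carrier (ring_of_integers K)"
    then show "\<exists>y\<in>carrier (ring_of_integers K). y \<oplus>\<^bsub>ring_of_integers K\<^esub> x = \<zero>\<^bsub>ring_of_integers K\<^esub>"
      using sf by (intro bexI[of _ "- x"]) auto
  qed (auto simp: sf absval_add_bound algebra_simps)
  show "comm_monoid (ring_of_integers K)"
    by (rule comm_monoidI) (auto simp: sf absval_mult_le_one algebra_simps)
qed (simp add: algebra_simps)

text \<open>Representatives of the residue field. Distinct classes differ by an element of absolute
  value exactly 1, so computations in the residue field become estimates in
  \<open>K\<close>.\<close>

definition residue_system :: "'c::nonarch_field set \<Rightarrow> 'c set \<Rightarrow> bool" where
  "residue_system K S \<longleftrightarrow> S \<subseteq> K \<and> finite S \<and> card S = residue_card K \<and> (\<forall>s\<in>S. absval s \<le> 1) \<and>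
    (\<forall>s\<in>S. \<forall>t\<in>S. s \<noteq> t \<longrightarrow> absval (s - t) = 1) \<and>
    (\<forall>x\<in>K. absval x \<le> 1 \<longrightarrow> (\<exists>s\<in>S. absval (x - s) < 1))"

lemma residue_systemD:
  assumes "residue_system K S"
  shows "S \<subseteq> K" "finite S" "card S = residue_card K" "\<And>s. s \<in> S \<Longrightarrow> absval s \<le> 1"
    "\<And>s t. s \<in> S \<Longrightarrow> t \<in> S \<Longrightarrow> s \<noteq> t \<Longrightarrow> absval (s - t) = 1"
    "\<And>x. x \<in> K \<Longrightarrow> absval x \<le> 1 \<Longrightarrow> \<exists>s\<in>S. absval (x - s) < 1"
  using assms unfolding residue_system_def by blast+

lemma residue_system_exists:
  fixes K :: "'c::nonarch_field set"
  assumes K: "subfield K (ring_of_type_algebra :: 'c ring)" and q: "residue_card K > 0"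
  shows "\<exists>S. residue_system K S"
proof -
  note sf = subfield_type_algebra[OF K]
  define coset where "coset a = {y \<in> K. absval y \<le> 1 \<and> absval (y - a) < 1}" for a
  define Q where "Q = coset ` {x \<in> K. absval x \<le> 1}"
  have diff: "x - y \<in> K" if "x \<in> K" "y \<in> K" for x y
    using sf(3)[OF that(1) sf(5)[OF that(2)]] by simp
  have "max_ideal K +>\<^bsub>ring_of_integers K\<^esub> a = coset a" if "a \<in> K" "absval a \<le> 1" for a
  proof -
    have "y \<in> (\<lambda>h. h + a) ` max_ideal K \<longleftrightarrow> y \<in> coset a" for y
    proof
      assume "y \<in> (\<lambda>h. h + a) ` max_ideal K"
      then show "y \<in> coset a"
        using that sf(3) by (auto simp: coset_def max_ideal_def intro!: absval_add_bound)
    next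
      assume "y \<in> coset a"
      then show "y \<in> (\<lambda>h. h + a) ` max_ideal K"
        using that diff by (intro image_eqI[of _ _ "y - a"]) (auto simp: coset_def max_ideal_def)
    qed
    then show ?thesis
      by (auto simp: a_r_coset_def r_coset_def)
  qed
  then have "carrier (ring_of_integers K Quot max_ideal K) = Q"
    by (auto simp: FactRing_def A_RCOSETS_def' Q_def)
  then have card: "card Q = residue_card K" by (simp add: residue_card_def)
  \<comment> \<open>\<open>card\<close> is 0 on infinite sets, so positivity of
    \<open>residue_card K\<close> yields finiteness of the residue field.\<close>
  then have fin: "finite Q" using q card_ge_0_finite by metis
  define r where "r C = (SOME x. x \<in> C)" for C :: "'c set"
  have r: "r C \<in> C" if "C \<in> Q" for C
  proof -
    obtain a where "C = coset a" "a \<in> K" "absval a \<le> 1"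
      using \<open>C \<in> Q\<close> by (auto simp: Q_def)
    then have "a \<in> C" by (simp add: coset_def)
    then show ?thesis unfolding r_def by (rule someI)
  qed
  have eq: "absval (x - y) < 1 \<Longrightarrow> coset x = coset y" for x y
  proof -
    assume xy: "absval (x - y) < 1"
    have "absval (z - x) < 1 \<longleftrightarrow> absval (z - y) < 1" for z
    proof -
      have "(z - x) + (x - y) = z - y" "(z - y) - (x - y) = z - x" by simp_all
      then have "absval (z - y) \<le> max (absval (z - x)) (absval (x - y))"
        "absval (z - x) \<le> max (absval (z - y)) (absval (x - y))"
        using absval_add_le[of "z - x" "x - y"] absval_diff_le[of "z - y" "x - y"] by metis+
      then show ?thesis using xy by linarith
    qed
    then show ?thesis by (simp add: coset_def)
  qed
  have cr: "coset (r C) = C" if "C \<in> Q" for C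
  proof -
    obtain a where a: "C = coset a" using \<open>C \<in> Q\<close> by (auto simp: Q_def)
    then have "absval (r C - a) < 1" using r[OF that] by (auto simp: coset_def)
    then show ?thesis using eq a by blast
  qed
  have inj: "inj_on r Q" using cr by (metis inj_onI)
  show ?thesis
    unfolding residue_system_def
  proof (intro exI[of _ "r ` Q"] conjI ballI impI)
    have rK: "r C \<in> K \<and> absval (r C) \<le> 1" if C: "C \<in> Q" for C
    proof -
      obtain a where "C = coset a" using C by (auto simp: Q_def)
      then show ?thesis using r[OF C] by (simp add: coset_def)
    qed
    then show "r ` Q \<subseteq> K" by blast
    show "finite (r ` Q)" using fin by simp
    show "card (r ` Q) = residue_card K" using inj card by (simp add: card_image)
    show le: "absval s \<le> 1" if "s \<in> r ` Q" for s
      using that rK by blast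
    show "absval (s - t) = 1" if st: "s \<in> r ` Q" "t \<in> r ` Q" "s \<noteq> t" for s t
    proof -
      have "\<not> absval (s - t) < 1"
        using eq[of s t] st cr by auto
      moreover have "absval (s - t) \<le> 1"
        using le st by (intro absval_diff_bound) auto
      ultimately show ?thesis by simp
    qed
    show "\<exists>s\<in>r ` Q. absval (x - s) < 1" if x: "x \<in> K" "absval x \<le> 1" for x
    proof -
      have "coset x \<in> Q" using x by (auto simp: Q_def)
      then have "r (coset x) \<in> coset x" by (rule r)
      then have "absval (x - r (coset x)) < 1" by (simp add: coset_def absval_minus_commute)
      then show ?thesis using \<open>coset x \<in> Q\<close> by blast
    qed
  qed
qed

lemma absval_prod: "absval (prod f A) = (\<Prod>i\<in>A. absval (f i))"
  by (induction A rule: infinite_finite_induct) (auto simp: absval_mult)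

lemma prod_cong_small:
  fixes f g :: "'i \<Rightarrow> 'c::nonarch_field"
  assumes "\<And>i. i \<in> A \<Longrightarrow> absval (f i) \<le> 1" "\<And>i. i \<in> A \<Longrightarrow> absval (g i) \<le> 1"
    "\<And>i. i \<in> A \<Longrightarrow> absval (f i - g i) < 1"
  shows "absval (prod f A - prod g A) < 1"
  using assms
proof (induction A rule: infinite_finite_induct)
  case (insert a A)
  have eq: "prod f (insert a A) - prod g (insert a A) =
      f a * (prod f A - prod g A) + (f a - g a) * prod g A"
    using insert.hyps by (simp add: algebra_simps)
  have "absval (f a * (prod f A - prod g A)) < 1"
    using insert.IH insert.prems mult_right_mono[of "absval (f a)" 1 "absval (prod f A - prod g A)"]
    by (auto simp: absval_mult intro: le_less_trans)
  moreover have "absval (prod g A) \<le> 1"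
    unfolding absval_prod using insert.prems by (intro prod_le_1) auto
  then have "absval ((f a - g a) * prod g A) < 1"
    using insert.prems(3)[of a] mult_left_mono[of "absval (prod g A)" 1 "absval (f a - g a)"]
    by (auto simp: absval_mult intro: le_less_trans)
  ultimately show ?case
    unfolding eq using absval_add_le[of "f a * (prod f A - prod g A)" "(f a - g a) * prod g A"] by simp
qed auto

text \<open>Fermat's little theorem in the residue field: multiplication by a unit permutes the nonzero
  residue classes.\<close>

lemma residue_fermat:
  fixes K :: "'c::nonarch_field set"
  assumes K: "subfield K (ring_of_type_algebra :: 'c ring)" and q: "residue_card K > 0"
    and a: "a \<in> K" "absval a \<le> 1"
  shows "absval (a ^ residue_card K - a) < 1"
proof (cases "absval a < 1")
  case True
  have "absval (a ^ residue_card K) \<le> absval a"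
    using power_decreasing[of 1 "residue_card K" "absval a"] q a by (simp add: absval_power)
  then show ?thesis using True absval_diff_le[of "a ^ residue_card K" a] by simp
next
  case False
  with a have a1: "absval a = 1" by simp
  note sf = subfield_type_algebra[OF K]
  obtain S where "residue_system K S" using residue_system_exists[OF K q] by blast
  note S = residue_systemD[OF this]
  \<comment> \<open>\<open>z\<close> represents the zero class; all other representatives are
    units.\<close>
  obtain z where z: "z \<in> S" "absval z < 1" using S(6)[of 0] sf(1) by auto
  define T where "T = S - {z}"
  have T1: "absval s = 1" if "s \<in> T" for s
    using S(5)[of s z] that z absval_add_eq[of z "s - z"] by (auto simp: T_def)
  have cT: "card T = residue_card K - 1" using S z by (simp add: T_def)
  have fT: "finite T" using S by (simp add: T_def)
  have ex: "\<exists>t. t \<in> T \<and> absval (a * s - t) < 1" if "s \<in> T" for s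
  proof -
    have "a * s \<in> K" using a S(1) that sf(4) by (auto simp: T_def)
    moreover have as1: "absval (a * s) = 1" using a1 T1[OF that] by (simp add: absval_mult)
    ultimately obtain t where t: "t \<in> S" "absval (a * s - t) < 1" using S(6)[of "a * s"] by auto
    have "t \<noteq> z"
      using t z as1 absval_add_le[of "a * s - t" t] by auto
    then show ?thesis using t by (auto simp: T_def)
  qed
  define f where "f s = (SOME t. t \<in> T \<and> absval (a * s - t) < 1)" for s
  have f: "f s \<in> T" "absval (a * s - f s) < 1" if "s \<in> T" for s
    using someI_ex[OF ex[OF that]] by (simp_all add: f_def)
  have "inj_on f T"
  proof (rule inj_onI, rule ccontr)
    fix s t assume st: "s \<in> T" "t \<in> T" "f s = f t" "s \<noteq> t"
    have "absval (a * (s - t)) = 1"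
      using S(5)[of s t] st a1 by (simp add: T_def absval_mult)
    moreover have "a * (s - t) = (a * s - f s) - (a * t - f t)" using st by (simp add: algebra_simps)
    ultimately show False
      using f(2)[OF st(1)] f(2)[OF st(2)] absval_diff_le[of "a * s - f s" "a * t - f t"] by simp
  qed
  moreover have "f ` T \<subseteq> T" using f(1) by auto
  ultimately have "bij_betw f T T"
    using fT by (simp add: bij_betw_def endo_inj_surj)
  then have "(\<Prod>s\<in>T. f s) = (\<Prod>s\<in>T. s)" by (rule prod.reindex_bij_betw)
  moreover have "absval ((\<Prod>s\<in>T. a * s) - (\<Prod>s\<in>T. f s)) < 1"
    using f T1 a1 by (intro prod_cong_small) (auto simp: absval_mult)
  moreover have "(\<Prod>s\<in>T. a * s) = a ^ (residue_card K - 1) * (\<Prod>s\<in>T. s)"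
    by (simp add: prod.distrib cT)
  ultimately have "absval ((a ^ (residue_card K - 1) - 1) * (\<Prod>s\<in>T. s)) < 1"
    by (simp add: algebra_simps)
  moreover have "absval (\<Prod>s\<in>T. s) = 1" using T1 by (simp add: absval_prod)
  ultimately have 1: "absval (a ^ (residue_card K - 1) - 1) < 1" by (simp add: absval_mult)
  have "a ^ residue_card K = a ^ Suc (residue_card K - 1)" using q by simp
  then have "a ^ residue_card K - a = a * (a ^ (residue_card K - 1) - 1)" by (simp add: algebra_simps)
  then show ?thesis using 1 a1 by (simp add: absval_mult)
qed

text \<open>By \<open>residue_fermat\<close> the polynomial \<open>(x + 1)^q - x^q - 1\<close> is
  small at every representative. It has degree below \<open>q\<close>, so
  \<open>small_values_imp_small_coeffs\<close> applies.\<close>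

lemma residue_binomial:
  fixes K :: "'c::nonarch_field set"
  assumes K: "subfield K (ring_of_type_algebra :: 'c ring)" and q: "residue_card K > 0"
    and i: "0 < i" "i < residue_card K"
  shows "absval (of_nat (residue_card K choose i) :: 'c) < 1"
proof -
  define q where "q = residue_card K"
  note sf = subfield_type_algebra[OF K]
  obtain S where "residue_system K S" using residue_system_exists[OF K q] by blast
  note S = residue_systemD[OF this, folded q_def]
  define P :: "'c poly" where "P = (\<Sum>j\<in>{0<..<q}. Polynomial.monom (of_nat (q choose j)) j)"
  have coeff: "poly.coeff P j = (if 0 < j \<and> j < q then of_nat (q choose j) else 0)" for j
    by (simp add: P_def coeff_sum)
  have "absval (poly.coeff P i) < 1"
  proof (rule small_values_imp_small_coeffs[of S])
    fix s assume s: "s \<in> S"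
    have "{..q} = insert 0 (insert q {0<..<q})" using i by (auto simp: q_def)
    then have "(s + 1) ^ q = 1 + s ^ q + poly P s"
      using i by (simp add: binomial_ring P_def poly_sum poly_monom q_def)
    then have "poly P s = ((s + 1) ^ q - (s + 1)) - (s ^ q - s)" by (simp add: algebra_simps)
    moreover have "absval ((s + 1) ^ q - (s + 1)) < 1"
      unfolding q_def using S(1,4) s sf by (intro residue_fermat[OF K q] absval_add_bound) auto
    moreover have "absval (s ^ q - s) < 1"
      unfolding q_def using S(1,4) s by (intro residue_fermat[OF K q]) auto
    ultimately show "absval (poly P s) < 1"
      using absval_diff_le[of "(s + 1) ^ q - (s + 1)" "s ^ q - s"] by simp
  qed (use S in \<open>auto simp: coeff\<close>)
  then show ?thesis using i by (simp add: coeff q_def)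
qed

subsection \<open>Formal composition with a series in two variables\<close>

lemma fps2_mult_nth:
  "((A :: 'a::comm_ring_1 fps fps) * B) $ i $ j = (\<Sum>a=0..i. \<Sum>b=0..j. A $ a $ b * B $ (i - a) $ (j - b))"
  by (simp add: fps_mult_nth fps_sum_nth)

text \<open>A coefficient of total degree at most \<open>N\<close> depends only on the powers of
  \<open>F\<close> up to \<open>N\<close>. Agreement up to \<open>N\<close> lets the finite sum
  \<open>comp_outer_trunc\<close>, to which the ring laws apply directly, stand for the
  composite.\<close>

definition agree_upto :: "nat \<Rightarrow> 'a::comm_ring_1 fps fps \<Rightarrow> 'a fps fps \<Rightarrow> bool" where
  "agree_upto N A B \<longleftrightarrow> (\<forall>i j. i + j \<le> N \<longrightarrow> A $ i $ j = B $ i $ j)"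

lemma agree_upto_mult: "agree_upto N A A' \<Longrightarrow> agree_upto N B B' \<Longrightarrow> agree_upto N (A * B) (A' * B')"
  unfolding agree_upto_def fps2_mult_nth by (intro allI impI sum.cong refl) simp

lemma fps_of_nat_mult_nth: "(of_nat k * A) $ n = of_nat k * A $ n" for A :: "'a::comm_ring_1 fps"
  by (induction k) (auto simp: distrib_right)

definition comp_outer_trunc :: "nat \<Rightarrow> 'a::comm_ring_1 fps \<Rightarrow> 'a fps fps \<Rightarrow> 'a fps fps" where
  "comp_outer_trunc N g F = (\<Sum>k\<le>N. fps_const (fps_const (g $ k)) * F ^ k)"

lemma comp_outer_trunc_nth: "comp_outer_trunc N g F $ i $ j = (\<Sum>k\<le>N. g $ k * (F ^ k) $ i $ j)"
  by (simp add: comp_outer_trunc_def fps_sum_nth)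

lemma comp_outer_nth:
  assumes "F $ 0 $ 0 = 0" "i + j \<le> N"
  shows "comp_outer g F $ i $ j = (\<Sum>k\<le>N. g $ k * (F ^ k) $ i $ j)"
proof -
  have "(\<Sum>k\<le>N. g $ k * (F ^ k) $ i $ j) = (\<Sum>k\<le>i + j. g $ k * (F ^ k) $ i $ j)"
    using assms by (intro sum.mono_neutral_right) (auto simp: fps2_power_nth_eq_0)
  then show ?thesis by (simp add: comp_outer_def)
qed

lemma agree_upto_comp_outer: "F $ 0 $ 0 = 0 \<Longrightarrow> agree_upto N (comp_outer g F) (comp_outer_trunc N g F)"
  by (simp add: agree_upto_def comp_outer_trunc_nth comp_outer_nth)

lemma comp_outer_mult:
  assumes F: "F $ 0 $ 0 = 0"
  shows "comp_outer (g * h) F = comp_outer g F * comp_outer h F"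
proof -
  have "comp_outer (g * h) F $ i $ j = (comp_outer g F * comp_outer h F) $ i $ j" for i j
  proof -
    define N where "N = i + j"
    have "(comp_outer g F * comp_outer h F) $ i $ j =
        (comp_outer_trunc N g F * comp_outer_trunc N h F) $ i $ j"
      using agree_upto_mult[OF agree_upto_comp_outer[OF F] agree_upto_comp_outer[OF F], of N g h]
      by (simp add: agree_upto_def N_def)
    also have "comp_outer_trunc N g F * comp_outer_trunc N h F =
        (\<Sum>(a, b)\<in>{..N} \<times> {..N}. fps_const (fps_const (g $ a * h $ b)) * F ^ (a + b))"
      by (simp add: comp_outer_trunc_def sum_product sum.cartesian_product power_add mult_ac
          flip: fps_const_mult)
    also have "\<dots> $ i $ j = (\<Sum>(a, b)\<in>{..N} \<times> {..N}. g $ a * h $ b * (F ^ (a + b)) $ i $ j)"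
      by (simp add: fps_sum_nth case_prod_unfold)
    \<comment> \<open>For \<open>a + b > N\<close> the power \<open>F ^ (a + b)\<close> has no term
      of total degree \<open>N\<close>.\<close>
    also have "\<dots> = (\<Sum>(a, b)\<in>{(a, b). a + b \<le> N}. g $ a * h $ b * (F ^ (a + b)) $ i $ j)"
    proof (intro sum.mono_neutral_right)
      show "\<forall>x\<in>{..N} \<times> {..N} - {(a, b). a + b \<le> N}.
          (case x of (a, b) \<Rightarrow> g $ a * h $ b * (F ^ (a + b)) $ i $ j) = 0"
      proof
        fix x assume x: "x \<in> {..N} \<times> {..N} - {(a, b). a + b \<le> N}"
        obtain a b where ab: "x = (a, b)" by (cases x)
        then have "(F ^ (a + b)) $ i $ j = 0"
          using x by (intro fps2_power_nth_eq_0[OF F]) (simp add: N_def)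
        then show "(case x of (a, b) \<Rightarrow> g $ a * h $ b * (F ^ (a + b)) $ i $ j) = 0"
          by (simp add: ab)
      qed
    qed auto
    also have "\<dots> = (\<Sum>k\<le>N. \<Sum>a\<le>k. g $ a * h $ (k - a) * (F ^ k) $ i $ j)"
      by (subst sum.triangle_reindex_eq) (auto intro!: sum.cong)
    also have "\<dots> = comp_outer (g * h) F $ i $ j"
      by (simp add: comp_outer_nth[OF F, of i j N] N_def fps_mult_nth sum_distrib_right atLeast0AtMost)
    finally show ?thesis ..
  qed
  then show ?thesis by (simp add: fps_eq_iff)
qed

lemma comp_outer_one: "comp_outer 1 F = 1"
proof -
  have "comp_outer 1 F $ i $ j = (\<Sum>k\<le>i + j. if k = 0 then 1 $ i $ j else 0)" for i j
    unfolding comp_outer_def fps_nth_Abs_fps by (intro sum.cong) auto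
  then show ?thesis by (simp add: fps_eq_iff)
qed

text \<open>Since \<open>fps_deriv\<close> acts on the outer index, this is the chain rule for the
  partial derivative in the first variable.\<close>

lemma fps_deriv_comp_outer:
  fixes F :: "'a::{comm_ring_1, ring_char_0} fps fps"
  assumes F: "F $ 0 $ 0 = 0"
  shows "fps_deriv (comp_outer g F) = comp_outer (fps_deriv g) F * fps_deriv F"
proof -
  have "fps_deriv (comp_outer g F) $ i $ j = (comp_outer (fps_deriv g) F * fps_deriv F) $ i $ j" for i j
  proof -
    define N where "N = i + j"
    have deriv: "fps_deriv A $ i $ j = of_nat (Suc i) * A $ Suc i $ j" for A :: "'a fps fps"
      by (simp add: fps_of_nat_mult_nth del: of_nat_Suc)
    \<comment> \<open>Differentiation lowers the degree by one, hence the truncation at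
      \<open>Suc N\<close> here and at \<open>N\<close> afterwards.\<close>
    have "fps_deriv (comp_outer g F) $ i $ j = of_nat (Suc i) * (\<Sum>k\<le>Suc N. g $ k * (F ^ k) $ Suc i $ j)"
      unfolding deriv by (subst comp_outer_nth[OF F, of "Suc i" j "Suc N" g]) (simp_all add: N_def)
    also have "\<dots> = (\<Sum>k\<le>Suc N. g $ k * fps_deriv (F ^ k) $ i $ j)"
      unfolding deriv sum_distrib_left by (intro sum.cong) (simp_all add: mult_ac del: of_nat_Suc)
    also have "\<dots> = (\<Sum>k\<le>N. g $ Suc k * fps_deriv (F ^ Suc k) $ i $ j)"
      unfolding sum.atMost_Suc_shift by simp
    also have "\<dots> = (\<Sum>k\<le>N. fps_deriv g $ k * (F ^ k * fps_deriv F) $ i $ j)"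
    proof (intro sum.cong refl)
      fix k
      have "fps_deriv (F ^ Suc k) = of_nat (Suc k) * (F ^ k * fps_deriv F)"
        unfolding fps_deriv_power' by (simp only: diff_Suc_1 mult_ac)
      then have "fps_deriv (F ^ Suc k) $ i $ j = of_nat (Suc k) * (F ^ k * fps_deriv F) $ i $ j"
        by (simp only: fps_of_nat_mult_nth)
      moreover have "fps_deriv g $ k = of_nat (Suc k) * g $ Suc k" by simp
      ultimately show "g $ Suc k * fps_deriv (F ^ Suc k) $ i $ j = fps_deriv g $ k * (F ^ k * fps_deriv F) $ i $ j"
        by (simp only: mult_ac)
    qed
    also have "\<dots> = (comp_outer_trunc N (fps_deriv g) F * fps_deriv F) $ i $ j"
      by (simp add: comp_outer_trunc_def sum_distrib_right fps_sum_nth mult.assoc)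
    also have "\<dots> = (comp_outer (fps_deriv g) F * fps_deriv F) $ i $ j"
      using agree_upto_mult[OF agree_upto_comp_outer[OF F], of N "fps_deriv F" "fps_deriv F" "fps_deriv g"]
      by (simp add: agree_upto_def N_def)
    finally show ?thesis .
  qed
  then show ?thesis by (simp add: fps_eq_iff)
qed

text \<open>As a series in \<open>x\<close>, \<open>F\<close> starts with
  \<open>y + F_1(y) x\<close>; this is the linear term in the binomial expansion of its
  power.\<close>

lemma fps2_power_nth_1:
  fixes F :: "'a::comm_ring_1 fps fps"
  assumes "F $ 0 = fps_X"
  shows "(F ^ Suc k) $ 1 $ j = of_nat (Suc k) * (fps_X ^ k * F $ 1) $ j"
proof -
  have "fps_deriv (F ^ Suc k) = of_nat (Suc k) * (F ^ k * fps_deriv F)"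
    unfolding fps_deriv_power' by (simp only: diff_Suc_1 mult_ac)
  then have "fps_deriv (F ^ Suc k) $ 0 = of_nat (Suc k) * (fps_X ^ k * F $ 1)"
    by (simp add: fps_of_nat_mult_nth fps_power_nth_0 assms del: of_nat_Suc power_Suc) simp
  moreover have "fps_deriv (F ^ Suc k) $ 0 = (F ^ Suc k) $ 1" by simp
  ultimately show ?thesis by (simp only: fps_of_nat_mult_nth)
qed

text \<open>The derivative of \<open>g(F(x, y))\<close> at \<open>x = 0\<close>. It turns an
  additivity or homomorphism law for \<open>g\<close> into a differential equation.\<close>

lemma comp_outer_nth_1:
  fixes F :: "'a::comm_ring_1 fps fps"
  assumes F: "F $ 0 = fps_X"
  shows "comp_outer g F $ 1 = fps_deriv g * F $ 1"
proof (rule fps_ext)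
  fix j
  have "comp_outer g F $ 1 $ j = (\<Sum>k\<le>Suc j. g $ k * (F ^ k) $ 1 $ j)"
    by (rule comp_outer_nth) (use F in auto)
  also have "\<dots> = (\<Sum>k\<le>j. g $ Suc k * (F ^ Suc k) $ 1 $ j)"
    unfolding sum.atMost_Suc_shift by simp
  also have "\<dots> = (\<Sum>k\<le>j. fps_deriv g $ k * F $ 1 $ (j - k))"
    unfolding fps2_power_nth_1[OF F]
    by (intro sum.cong) (auto simp: fps_X_power_mult_nth mult_ac simp del: of_nat_Suc)
  also have "\<dots> = (fps_deriv g * F $ 1) $ j"
    by (simp add: fps_mult_nth atLeast0AtMost)
  finally show "comp_outer g F $ 1 $ j = (fps_deriv g * F $ 1) $ j" .
qed

subsection \<open>The formal logarithm\<close>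

text \<open>Regards a series in the first variable as a series in both.\<close>

definition fps_lift :: "'a::comm_ring_1 fps \<Rightarrow> 'a fps fps" where
  "fps_lift g = Abs_fps (\<lambda>i. fps_const (g $ i))"

lemma fps_lift_mult: "fps_lift (g * h) = fps_lift g * fps_lift h"
  by (rule fps_ext) (simp add: fps_lift_def fps_mult_nth fps_const_sum)

lemma fps_lift_one: "fps_lift 1 = 1"
  by (rule fps_ext) (simp add: fps_lift_def)

text \<open>Differentiating the associativity law at the origin of the first variable turns the invariant
  differential \<open>inverse (F $ 1)\<close> into the derivative of an additive series.\<close>

lemma formal_log_additive:
  fixes F :: "'a::field_char_0 fps fps"
  assumes F0: "F $ 0 = fps_X" and F10: "F $ 1 $ 0 = 1"
    and assoc: "\<And>j k. (\<Sum>m\<le>1 + j. F $ m $ k * (F ^ m) $ 1 $ j) = (\<Sum>m\<le>j + k. F $ 1 $ m * (F ^ m) $ j $ k)"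
  defines "l \<equiv> fps_integral0 (inverse (F $ 1))"
  shows "comp_outer l F $ i $ j = (if j = 0 then l $ i else 0) + (if i = 0 then l $ j else 0)"
proof -
  have F00: "F $ 0 $ 0 = 0" using F0 by simp
  \<comment> \<open>Comparison of the coefficients of the first power of \<open>t\<close> in
    \<open>F(F(t, x), y) = F(t, F(x, y))\<close>.\<close>
  have key: "comp_outer (F $ 1) F = fps_deriv F * fps_lift (F $ 1)"
  proof (rule fps_ext, rule fps_ext)
    fix j k
    have "comp_outer (F $ 1) F $ j $ k = (\<Sum>m\<le>Suc j. F $ m $ k * (F ^ m) $ 1 $ j)"
      using assoc[of k j] by (simp add: comp_outer_def)
    also have "\<dots> = (\<Sum>m\<le>j. F $ Suc m $ k * (F ^ Suc m) $ 1 $ j)"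
      unfolding sum.atMost_Suc_shift by simp
    also have "\<dots> = (\<Sum>m\<le>j. of_nat (Suc m) * F $ Suc m $ k * F $ 1 $ (j - m))"
      unfolding fps2_power_nth_1[OF F0]
      by (intro sum.cong) (auto simp: fps_X_power_mult_nth mult_ac simp del: of_nat_Suc)
    also have "\<dots> = (fps_deriv F * fps_lift (F $ 1)) $ j $ k"
      by (simp add: fps_mult_nth[of "fps_deriv F"] fps_lift_def fps_sum_nth atLeast0AtMost
          fps_of_nat_mult_nth del: of_nat_Suc)
    finally show "comp_outer (F $ 1) F $ j $ k = (fps_deriv F * fps_lift (F $ 1)) $ j $ k" .
  qed
  define \<omega> where "\<omega> = inverse (F $ 1)"
  have F1\<omega>: "F $ 1 * \<omega> = 1" unfolding \<omega>_def using F10 by (intro inverse_mult_eq_1') simp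
  have dl: "fps_deriv l = \<omega>" by (simp add: l_def \<omega>_def fps_deriv_fps_integral)
  have "fps_deriv (comp_outer l F) = comp_outer \<omega> F * fps_deriv F * (fps_lift (F $ 1) * fps_lift \<omega>)"
    unfolding fps_deriv_comp_outer[OF F00] dl fps_lift_mult[symmetric] F1\<omega> fps_lift_one by simp
  also have "\<dots> = comp_outer \<omega> F * comp_outer (F $ 1) F * fps_lift \<omega>"
    unfolding key by (simp only: mult_ac)
  also have "\<dots> = fps_lift \<omega>"
    using F1\<omega> by (simp add: comp_outer_mult[OF F00, symmetric] comp_outer_one mult.commute)
  finally have d: "fps_deriv (comp_outer l F) = fps_lift (fps_deriv l)" by (simp add: dl)
  \<comment> \<open>The identity of derivatives determines the coefficients with a positive exponent
    of \<open>x\<close>; those with exponent 0 come from \<open>F(0, y) = y\<close>.\<close>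
  show ?thesis
  proof (cases i)
    case 0
    have "comp_outer l F $ 0 $ j = (\<Sum>k\<le>j. l $ k * (fps_X ^ k) $ j)"
      by (simp add: comp_outer_def fps_power_nth_0 F0)
    also have "\<dots> = l $ j"
      by (simp add: fps_X_power_nth mult_delta_right)
    finally show ?thesis using 0 by (auto simp: l_def)
  next
    case (Suc i')
    have "fps_deriv (comp_outer l F) $ i' $ j = fps_lift (fps_deriv l) $ i' $ j" by (simp add: d)
    then have "of_nat (Suc i') * comp_outer l F $ i $ j = (if j = 0 then of_nat (Suc i') * l $ i else 0)"
      using Suc by (auto simp: fps_lift_def fps_of_nat_mult_nth simp del: of_nat_Suc)
    then show ?thesis using Suc by (auto simp del: of_nat_Suc split: if_splits)
  qed
qed

subsection \<open>The Lubin-Tate module\<close>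

locale lubin_tate_module =
  fixes p :: nat and K :: "'c::{nonarch_field, alg_closed_field, complete_space} set"
    and \<pi> :: 'c and F :: "'c fps fps" and br :: "'c \<Rightarrow> 'c fps"
  assumes padic: "finite_padic_extension p K"
    and unif: "uniformizer K \<pi>"
    and q_gt_2: "residue_card K > 2"
    and lubin_tate: "lubin_tate K \<pi> F br"
begin

abbreviation q :: nat where "q \<equiv> residue_card K"
abbreviation R :: "'c ring" where "R \<equiv> ring_of_integers K"

definition OK :: "'c set" where "OK = {x \<in> K. absval x \<le> 1}"

lemma carrier_R: "carrier R = OK"
  by (simp add: OK_def)

lemma subfield_K: "subfield K (ring_of_type_algebra :: 'c ring)"
  using padic by (simp add: finite_padic_extension_def)

lemmas K_zero = subfield_type_algebra(1)[OF subfield_K]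
  and K_one = subfield_type_algebra(2)[OF subfield_K]
  and K_add = subfield_type_algebra(3)[OF subfield_K]
  and K_mult = subfield_type_algebra(4)[OF subfield_K]
  and K_uminus = subfield_type_algebra(5)[OF subfield_K]
  and K_inverse = subfield_type_algebra(6)[OF subfield_K]

lemma K_diff: "x \<in> K \<Longrightarrow> y \<in> K \<Longrightarrow> x - y \<in> K"
  using K_add[of x "- y"] K_uminus by simp

lemma K_divide: "x \<in> K \<Longrightarrow> y \<in> K \<Longrightarrow> x / y \<in> K"
  using K_mult[of x "inverse y"] K_inverse by (simp add: divide_inverse)

lemma K_sum: "(\<And>i. i \<in> A \<Longrightarrow> f i \<in> K) \<Longrightarrow> sum f A \<in> K"
  by (induction A rule: infinite_finite_induct) (auto intro: K_add K_zero)

lemma K_power: "x \<in> K \<Longrightarrow> x ^ n \<in> K"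
  by (induction n) (auto intro: K_mult K_one)

lemma K_of_nat: "of_nat n \<in> K"
  by (induction n) (auto intro: K_add K_zero K_one)

lemma K_closed: "closed K"
  using padic_extension_closed[OF padic] K_add K_mult by blast

lemma K_has_sum: "(f has_sum s) A \<Longrightarrow> (\<And>i. i \<in> A \<Longrightarrow> f i \<in> K) \<Longrightarrow> s \<in> K"
  by (rule has_sum_in_closed[OF _ _ K_closed K_zero K_add])

lemma R_cring: "cring R"
  by (rule ring_of_integers_cring[OF subfield_K])

lemma OK_ring: "0 \<in> OK" "1 \<in> OK" "x \<in> OK \<Longrightarrow> y \<in> OK \<Longrightarrow> x + y \<in> OK"
  "x \<in> OK \<Longrightarrow> y \<in> OK \<Longrightarrow> x * y \<in> OK" "x \<in> OK \<Longrightarrow> - x \<in> OK" "x \<in> OK \<Longrightarrow> y \<in> OK \<Longrightarrow> x - y \<in> OK"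
  by (auto simp: OK_def intro: K_zero K_one K_add K_mult K_uminus K_diff absval_add_bound
      absval_diff_bound absval_mult_le_one)

lemma OK_of_nat: "of_nat n \<in> OK"
  by (simp add: OK_def K_of_nat)

lemma OK_sum: "(\<And>i. i \<in> A \<Longrightarrow> f i \<in> OK) \<Longrightarrow> sum f A \<in> OK"
  by (induction A rule: infinite_finite_induct) (auto intro: OK_ring)

text \<open>The last inequality is the discreteness of the valuation on \<open>K\<close>: there is a
  gap between \<open>absval \<pi>\<close> and 1. The ambient field has no such gap, hence the
  condition \<open>x \<in> K\<close>.\<close>

lemma unif_K: "\<pi> \<in> K" and unif_lt_1: "absval \<pi> < 1" and unif_nonzero: "\<pi> \<noteq> 0"
  and absval_le_unif: "x \<in> K \<Longrightarrow> absval x < 1 \<Longrightarrow> absval x \<le> absval \<pi>"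
proof -
  have max: "{x * \<pi> | x. x \<in> OK} = {x \<in> K. absval x < 1}" and "\<pi> \<in> OK"
    using unif by (auto simp: uniformizer_def cgenideal_def max_ideal_def OK_def)
  have "\<pi> = 1 * \<pi>" by simp
  then have \<pi>: "\<pi> \<in> {x \<in> K. absval x < 1}" unfolding max[symmetric] using OK_ring by blast
  then show "\<pi> \<in> K" "absval \<pi> < 1" by auto
  \<comment> \<open>The prime \<open>p\<close> is a nonzero element of the maximal ideal, which is
    therefore not generated by 0.\<close>
  have p: "Factorial_Ring.prime p" "absval (of_nat p :: 'c) = 1 / real p"
    using padic by (auto simp: finite_padic_extension_def)
  then have "p > 1" using prime_gt_1_nat by blast
  then have "(of_nat p :: 'c) \<in> {x \<in> K. absval x < 1}"
    using p by (auto simp: K_of_nat)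
  then obtain y where "of_nat p = y * \<pi>" unfolding max[symmetric] by blast
  moreover have "(of_nat p :: 'c) \<noteq> 0" using \<open>p > 1\<close> by simp
  ultimately show "\<pi> \<noteq> 0" by auto
  show "absval x \<le> absval \<pi>" if x: "x \<in> K" "absval x < 1"
  proof -
    have "x \<in> {x * \<pi> | x. x \<in> OK}" unfolding max using x by simp
    then obtain y where "x = y * \<pi>" "absval y \<le> 1" by (auto simp: OK_def)
    then show ?thesis by (simp add: absval_mult mult_left_le_one_le)
  qed
qed

lemma unif_OK: "\<pi> \<in> OK"
  using unif_K unif_lt_1 by (simp add: OK_def)

lemma unif_pos: "absval \<pi> > 0"
  using unif_nonzero by simp

text \<open>Only the power of \<open>p\<close> in \<open>n\<close> matters, because by Bezout an
  integer prime to \<open>p\<close> is a unit; and that power is at most \<open>n\<close>. This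
  controls the denominators of the logarithm.\<close>

lemma absval_of_nat_ge: "n > 0 \<Longrightarrow> absval (of_nat n :: 'c) \<ge> 1 / real n"
proof -
  assume n: "n > 0"
  have p: "Factorial_Ring.prime p" "absval (of_nat p :: 'c) = 1 / real p"
    using padic by (auto simp: finite_padic_extension_def)
  have p1: "p > 1" using p prime_gt_1_nat by blast
  define m where "m = n div p ^ multiplicity p n"
  have nm: "n = p ^ multiplicity p n * m" by (simp add: m_def multiplicity_dvd)
  have "\<not> p dvd m"
    unfolding m_def using n p p1 by (intro multiplicity_decompose) auto
  then have "coprime p m" using p(1) by (metis prime_imp_coprime)
  then have "coprime (int m) (int p)" by (simp add: coprime_commute)
  then obtain a b :: int where ab: "a * int m + b * int p = 1"
    using bezout_int[of "int m" "int p"] by (auto simp: coprime_iff_gcd_eq_1)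
  have int_le: "absval (of_int z :: 'c) \<le> 1" for z :: int
    by (cases z) (simp_all del: of_nat_Suc)
  have "absval (of_nat m :: 'c) = 1"
  proof (rule ccontr)
    assume "absval (of_nat m :: 'c) \<noteq> 1"
    moreover have "absval (of_nat m :: 'c) \<le> 1" by (rule absval_of_nat_le)
    ultimately have m1: "absval (of_nat m :: 'c) < 1" by linarith
    have "(1 :: 'c) = of_int (a * int m + b * int p)" using ab by simp
    also have "\<dots> = of_int a * of_nat m + of_int b * of_nat p" by simp
    finally have "1 \<le> max (absval (of_int a * of_nat m :: 'c)) (absval (of_int b * of_nat p :: 'c))"
      by (metis absval_add_le absval_one)
    moreover have "absval (of_int a * of_nat m :: 'c) < 1"
      using m1 int_le[of a] mult_right_mono[OF int_le[of a], of "absval (of_nat m :: 'c)"]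
      by (simp add: absval_mult)
    moreover have "absval (of_int b * of_nat p :: 'c) < 1"
      using p p1 int_le[of b] mult_right_mono[OF int_le[of b], of "absval (of_nat p :: 'c)"]
      by (simp add: absval_mult)
    ultimately show False by simp
  qed
  then have "absval (of_nat n :: 'c) = 1 / real (p ^ multiplicity p n)"
    by (subst nm) (simp add: absval_mult absval_power p power_divide)
  moreover have "real (p ^ multiplicity p n) \<le> real n"
    using n by (intro of_nat_mono dvd_imp_le multiplicity_dvd)
  moreover have "real (p ^ multiplicity p n) > 0" using p1 by simp
  ultimately show ?thesis by (simp add: frac_le)
qed

section \<open>The axioms of the Lubin-Tate module in usable form\<close>

lemmas lubin_tate_conj = lubin_tate[unfolded lubin_tate_def carrier_R]

lemma fgl: "formal_group_law K F"
  by (rule lubin_tate_conj[THEN conjunct1])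

lemmas fgl_conj = fgl[unfolded formal_group_law_def carrier_R]

lemma F_nth_OK: "F $ i $ j \<in> OK"
  by (rule fgl_conj[THEN conjunct1, rule_format])

lemma F_integral: "F \<in> integral_fps2"
  using F_nth_OK by (simp add: integral_fps2_def integral_fps_def OK_def)

lemma F_nth_0_right: "F $ i $ 0 = (if i = 1 then 1 else 0)"
  by (rule fgl_conj[THEN conjunct2, THEN conjunct1, rule_format])

lemma F_nth_0: "F $ 0 = fps_X"
proof (rule fps_ext)
  fix j
  have "F $ 0 $ j = (if j = 1 then 1 else 0)"
    by (rule fgl_conj[THEN conjunct2, THEN conjunct2, THEN conjunct1, rule_format])
  then show "F $ 0 $ j = fps_X $ j" by (simp add: fps_X_nth)
qed

lemma F_nth_0_0: "F $ 0 $ 0 = 0"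
  by (simp add: F_nth_0)

lemma F_sym: "F $ i $ j = F $ j $ i"
  by (rule fgl_conj[THEN conjunct2, THEN conjunct2, THEN conjunct2, THEN conjunct1, rule_format])

lemma F_assoc: "(\<Sum>m\<le>i + j. F $ m $ k * (F ^ m) $ i $ j) = (\<Sum>m\<le>j + k. F $ i $ m * (F ^ m) $ j $ k)"
  by (rule fgl_conj[THEN conjunct2, THEN conjunct2, THEN conjunct2, THEN conjunct2, rule_format])

lemma
  assumes "a \<in> OK"
  shows br_nth_OK: "br a $ n \<in> OK" and br_nth_0: "br a $ 0 = 0" and br_nth_1: "br a $ 1 = a"
    and br_hom: "comp_outer (br a) F = comp_inner F (br a) (br a)"
proof -
  have "formal_endomorphism K F (br a) \<and> br a $ 1 = a"
    by (rule lubin_tate_conj[THEN conjunct2, THEN conjunct1, rule_format, OF assms])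
  then show "br a $ n \<in> OK" "br a $ 0 = 0" "br a $ 1 = a" "comp_outer (br a) F = comp_inner F (br a) (br a)"
    unfolding formal_endomorphism_def int_fps_def carrier_R by auto
qed

lemma br_one: "br 1 = fps_X"
  by (rule lubin_tate_conj[THEN conjunct2, THEN conjunct2, THEN conjunct1])

lemma br_add: "a \<in> OK \<Longrightarrow> b \<in> OK \<Longrightarrow> br (a + b) = fps_subst2 F (br a) (br b)"
  and br_mult: "a \<in> OK \<Longrightarrow> b \<in> OK \<Longrightarrow> br (a * b) = br a oo br b"
  using lubin_tate_conj[THEN conjunct2, THEN conjunct2, THEN conjunct2, THEN conjunct1, rule_format, of a b]
  by simp_all

lemma br_integral: "a \<in> OK \<Longrightarrow> br a \<in> integral_fps"
  using br_nth_OK by (auto simp: integral_fps_def OK_def)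

lemma br_point: "a \<in> OK \<Longrightarrow> br a \<in> points"
  using br_nth_OK[of a] br_nth_0[of a] by (auto simp: points_def OK_def)

lemma br_unif_cong: "absval (br \<pi> $ n - (if n = q then 1 else 0)) \<le> absval \<pi>"
proof -
  have "br \<pi> - fps_X ^ q \<in> scaled_int_fps K \<pi>"
    by (rule lubin_tate_conj[THEN conjunct2, THEN conjunct2, THEN conjunct2, THEN conjunct2])
  then obtain h where h: "br \<pi> - fps_X ^ q = fps_const \<pi> * h" "h \<in> int_fps K"
    by (auto simp: scaled_int_fps_def)
  have "br \<pi> $ n - (if n = q then 1 else 0) = (br \<pi> - fps_X ^ q) $ n"
    by (simp add: fps_X_power_nth)
  also have "\<dots> = \<pi> * h $ n" by (simp add: h)
  finally show ?thesis
    using h(2) unif_pos by (simp add: absval_mult int_fps_def mult_left_le)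
qed

subsection \<open>The logarithm of the Lubin-Tate module\<close>

abbreviation lam :: "'c fps" where "lam \<equiv> formal_log F"

text \<open>Existence is \<open>formal_log_additive\<close>. For uniqueness, the coefficient of the
  first power of \<open>x\<close> in the additivity law reads \<open>l'(y) * F_1(y) = 1\<close>,
  which determines \<open>l\<close> together with \<open>l(0) = 0\<close>.\<close>

lemma formal_log_eq: "formal_log F = fps_integral0 (inverse (F $ 1))"
  unfolding formal_log_def
proof (rule the_equality)
  have F10: "F $ 1 $ 0 = 1" by (simp add: F_nth_0_right)
  have F1: "F $ 1 $ 0 \<noteq> 0" using F10 by simp
  let ?l = "fps_integral0 (inverse (F $ 1))"
  have "comp_outer ?l F $ i $ j = (if j = 0 then ?l $ i else 0) + (if i = 0 then ?l $ j else 0)" for i j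
    by (rule formal_log_additive[OF F_nth_0 F10 F_assoc])
  moreover have "?l $ 1 = 1" using F10 by (simp add: fps_integral_def)
  ultimately show "?l $ 0 = 0 \<and> ?l $ 1 = 1 \<and> (\<forall>i j. comp_outer ?l F $ i $ j =
      (if j = 0 then ?l $ i else 0) + (if i = 0 then ?l $ j else 0))" by simp
  fix l assume l: "l $ 0 = 0 \<and> l $ 1 = 1 \<and> (\<forall>i j. comp_outer l F $ i $ j =
      (if j = 0 then l $ i else 0) + (if i = 0 then l $ j else 0))"
  have "fps_deriv l * F $ 1 = 1"
    unfolding comp_outer_nth_1[OF F_nth_0, symmetric] using l by (intro fps_ext) auto
  then have "fps_deriv l = inverse (F $ 1)"
    by (metis fps_inverse_unique mult.commute)
  then show "l = ?l"
    using l fps_integral0_deriv[of l] by simp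
qed

lemma lam_nth_0: "lam $ 0 = 0" and lam_nth_1: "lam $ 1 = 1"
  by (simp_all add: formal_log_eq fps_integral_def F_nth_0_right)

lemma lam_additive: "comp_outer lam F $ i $ j = (if j = 0 then lam $ i else 0) + (if i = 0 then lam $ j else 0)"
  unfolding formal_log_eq by (rule formal_log_additive[OF F_nth_0 _ F_assoc]) (simp add: F_nth_0_right)

lemma lam_deriv: "fps_deriv lam = inverse (F $ 1)"
  by (simp add: formal_log_eq fps_deriv_fps_integral)

lemma inverse_F1_OK: "inverse (F $ 1) $ n \<in> OK"
proof (induction n rule: less_induct)
  case (less n)
  have F1: "F $ 1 $ 0 = 1" by (simp add: F_nth_0_right)
  show ?case
  proof (cases n)
    case 0
    then show ?thesis using F1 OK_ring by simp
  next
    case (Suc m)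
    have "(F $ 1 * inverse (F $ 1)) $ n = 0"
      using F1 Suc by (simp add: inverse_mult_eq_1')
    then have "inverse (F $ 1) $ n = - (\<Sum>i=1..n. F $ 1 $ i * inverse (F $ 1) $ (n - i))"
      using F1 by (simp add: fps_mult_nth sum.atLeast_Suc_atMost eq_neg_iff_add_eq_0)
    also have "\<dots> \<in> OK"
      using less.IH Suc by (intro OK_ring OK_sum F_nth_OK) auto
    finally show ?thesis .
  qed
qed

lemma lam_nth: "n > 0 \<Longrightarrow> of_nat n * lam $ n \<in> OK"
  using inverse_F1_OK[of "n - 1", folded lam_deriv] by simp

lemma lam_nth_K: "lam $ n \<in> K"
proof (cases "n = 0")
  case False
  then have "of_nat n * lam $ n / of_nat n \<in> K"
    using lam_nth[of n] by (intro K_divide K_of_nat) (auto simp: OK_def)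
  then show ?thesis using False by simp
qed (simp add: lam_nth_0 K_zero)

lemma lam_nth_le: "absval (lam $ n) \<le> real n"
proof (cases "n = 0")
  case False
  have "absval (of_nat n :: 'c) * absval (lam $ n) \<le> 1"
    using lam_nth[of n] False by (simp add: OK_def flip: absval_mult)
  moreover have "1 / real n * absval (lam $ n) \<le> absval (of_nat n :: 'c) * absval (lam $ n)"
    using absval_of_nat_ge[of n] False by (intro mult_right_mono) auto
  ultimately have "absval (lam $ n) / real n \<le> 1" by simp
  then show ?thesis using False by (simp add: divide_le_eq)
qed (simp add: lam_nth_0)

lemma lam_convergent: "convergent_on_disc lam"
  unfolding convergent_on_disc_def
proof (intro allI impI)
  fix r :: real assume r: "0 < r \<and> r < 1"
  have "(\<lambda>n. real n * r ^ n) \<longlonglongrightarrow> 0"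
    using r by (intro powser_times_n_limit_0) auto
  then have "Bseq (\<lambda>n. real n * r ^ n)"
    by (intro convergent_imp_Bseq) (auto simp: convergent_def)
  then obtain B where B: "\<And>n. norm (real n * r ^ n) \<le> B" unfolding Bseq_def by blast
  have "absval (lam $ n) * r ^ n \<le> B" for n
  proof -
    have "absval (lam $ n) * r ^ n \<le> real n * r ^ n"
      using r by (intro mult_right_mono lam_nth_le) auto
    also have "\<dots> \<le> B" using B[of n] r by simp
    finally show ?thesis .
  qed
  then show "\<exists>B. gauss_le r B lam" by (auto simp: gauss_le_def)
qed

text \<open>The logarithm has linear coefficient 1 and no constant term, so it has a compositional
  inverse over the field.\<close>

lemma lam_cancel:
  assumes "lam oo f = lam oo g" "f $ 0 = 0" "g $ 0 = 0"
  shows "f = g"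
proof -
  have inv: "fps_inv lam oo lam = fps_X"
    by (rule fps_inv[OF lam_nth_0]) (unfold lam_nth_1, simp)
  have "fps_inv lam oo (lam oo h) = h" if "h $ 0 = 0" for h
    using that by (simp add: fps_compose_assoc lam_nth_0 inv)
  then show ?thesis using assms by metis
qed

text \<open>For \<open>g = br a\<close>, the homomorphism law differentiated at \<open>x = 0\<close>
  gives \<open>g' * F_1 = a * (F_1 o g)\<close>. Since \<open>F_1\<close> is inverse to the
  derivative of the logarithm, both sides of the claim have the same derivative.\<close>

lemma lam_br:
  assumes "a \<in> OK"
  shows "lam oo br a = fps_const a * lam"
proof -
  let ?g = "br a"
  have g0: "?g $ 0 = 0" and g1: "?g $ 1 = a" using br_nth_0 br_nth_1 assms by blast+
  have F1: "F $ 1 $ 0 \<noteq> 0" by (simp add: F_nth_0_right)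
  have "comp_inner F ?g ?g $ 1 $ j = (fps_const a * (F $ 1 oo ?g)) $ j" for j
  proof -
    have "comp_inner F ?g ?g $ 1 $ j = (\<Sum>l\<le>j. F $ 1 $ l * a * (?g ^ l) $ j)"
      using g1 by (simp add: comp_inner_def)
    then show ?thesis
      by (simp add: fps_compose_nth atLeast0AtMost sum_distrib_left mult_ac)
  qed
  then have 1: "fps_deriv ?g * F $ 1 = fps_const a * (F $ 1 oo ?g)"
    using br_hom[OF assms] comp_outer_nth_1[OF F_nth_0, of ?g] by (simp add: fps_eq_iff)
  have inv: "F $ 1 * inverse (F $ 1) = 1" using F1 by (rule inverse_mult_eq_1')
  have "(inverse (F $ 1) oo ?g) * (F $ 1 oo ?g) = (F $ 1 * inverse (F $ 1)) oo ?g"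
    using g0 by (simp add: fps_compose_mult_distrib mult.commute)
  then have inv2: "(inverse (F $ 1) oo ?g) * (F $ 1 oo ?g) = 1" using inv by simp
  have "fps_deriv (lam oo ?g) = (inverse (F $ 1) oo ?g) * fps_deriv ?g"
    by (simp add: fps_compose_deriv g0 lam_deriv)
  also have "\<dots> = (inverse (F $ 1) oo ?g) * (fps_deriv ?g * F $ 1) * inverse (F $ 1)"
    using inv by (simp add: mult.assoc)
  also have "\<dots> = fps_const a * ((inverse (F $ 1) oo ?g) * (F $ 1 oo ?g)) * inverse (F $ 1)"
    unfolding 1 by (simp only: mult_ac)
  also have "\<dots> = fps_deriv (fps_const a * lam)"
    unfolding inv2 by (simp add: lam_deriv)
  finally have eq: "lam oo ?g = fps_const ((lam oo ?g) $ 0 - (fps_const a * lam) $ 0) + fps_const a * lam"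
    by (simp only: fps_deriv_eq_iff)
  show ?thesis by (subst eq) (simp add: lam_nth_0)
qed

lemma br_unique:
  assumes "a \<in> OK" "g $ 0 = 0" "lam oo g = fps_const a * lam"
  shows "g = br a"
  by (rule lam_cancel) (simp_all add: assms lam_br br_nth_0)

lemma br_zero: "br 0 = 0"
  by (rule br_unique[symmetric]) (auto simp: OK_ring lam_nth_0)

subsection \<open>The module of points\<close>

abbreviation lt_add :: "'c fps \<Rightarrow> 'c fps \<Rightarrow> 'c fps" where "lt_add \<equiv> fps_subst2 F"
abbreviation lt_smul :: "'c \<Rightarrow> 'c fps \<Rightarrow> 'c fps" where "lt_smul a u \<equiv> fps_subst (br a) u"
abbreviation Lam :: "'c fps \<Rightarrow> 'c fps" where "Lam \<equiv> fps_subst lam"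

lemma lt_add_points: "u \<in> points \<Longrightarrow> v \<in> points \<Longrightarrow> lt_add u v \<in> points"
  by (rule fps_subst2_points[OF F_integral F_nth_0_0])

lemma lt_add_nth_0_le:
  "u \<in> points \<Longrightarrow> v \<in> points \<Longrightarrow> absval (lt_add u v $ 0) \<le> max (absval (u $ 0)) (absval (v $ 0))"
  by (rule fps_subst2_points[OF F_integral F_nth_0_0])

lemma lt_add_commute: "u \<in> points \<Longrightarrow> v \<in> points \<Longrightarrow> lt_add u v = lt_add v u"
  by (rule fps_subst2_commute[OF F_integral F_sym])

lemma lt_add_assoc: "u \<in> points \<Longrightarrow> v \<in> points \<Longrightarrow> w \<in> points \<Longrightarrow> lt_add (lt_add u v) w = lt_add u (lt_add v w)"
  by (rule fps_subst2_assoc[OF F_integral F_nth_0_0 F_sym F_assoc])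

lemma lt_add_zero_left:
  assumes "v \<in> points"
  shows "lt_add 0 v = v"
proof (rule fps_has_sum_unique)
  show "fps_has_sum (\<lambda>i. 0 ^ i * fps_subst (F $ i) v) UNIV (lt_add 0 v)"
    using assms by (intro fps_subst2_has_sum_iterated F_integral) auto
  have "fps_has_sum (\<lambda>i. 0 ^ i * fps_subst (F $ i) v) UNIV (\<Sum>i\<in>{0}. 0 ^ i * fps_subst (F $ i) v)"
    by (rule fps_has_sum_finite_support) (auto simp: power_0_left)
  then show "fps_has_sum (\<lambda>i. 0 ^ i * fps_subst (F $ i) v) UNIV v"
    by (simp add: F_nth_0)
qed

lemma lt_smul_points: "a \<in> OK \<Longrightarrow> u \<in> points \<Longrightarrow> lt_smul a u \<in> points"
  by (intro fps_subst_points br_point)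

lemma lt_smul_nth_0_le: "a \<in> OK \<Longrightarrow> u \<in> points \<Longrightarrow> absval (lt_smul a u $ 0) \<le> absval (u $ 0)"
  using fps_subst_nth_0_le[OF br_integral, of a u] by (simp add: br_nth_0)

lemma lt_smul_add_right:
  assumes "a \<in> OK" "u \<in> points" "v \<in> points"
  shows "lt_smul a (lt_add u v) = lt_add (lt_smul a u) (lt_smul a v)"
  using assms
  by (simp add: fps_subst_subst2 fps_subst2_subst_subst integral_convergent br_integral F_integral
      F_nth_0_0 br_hom br_nth_0)

lemma lt_smul_add_left:
  assumes "a \<in> OK" "b \<in> OK" "u \<in> points"
  shows "lt_smul (a + b) u = lt_add (lt_smul a u) (lt_smul b u)"
  using assms by (simp add: br_add fps_subst_of_subst2 F_integral br_point)

lemma lt_smul_assoc: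
  assumes "a \<in> OK" "b \<in> OK" "u \<in> points"
  shows "lt_smul (a * b) u = lt_smul a (lt_smul b u)"
  using assms
  by (simp add: br_mult fps_subst_assoc br_point integral_convergent br_integral br_nth_0
      flip: fps_subst_eq_compose)

lemma lt_smul_one: "lt_smul 1 u = u"
  by (simp add: br_one)

lemma lt_smul_zero_left: "lt_smul 0 u = 0"
  by (simp add: br_zero)

lemma lt_add_neg:
  assumes "u \<in> points"
  shows "lt_add (lt_smul (-1) u) u = 0" "lt_add u (lt_smul (-1) u) = 0"
  using lt_smul_add_left[of "-1" 1 u] lt_smul_add_left[of 1 "-1" u] assms
  by (simp_all add: lt_smul_one br_zero OK_ring)

lemma lt_add_neg_eq_0_iff:
  assumes "u \<in> points" "v \<in> points" "lt_add u (lt_smul (-1) v) = 0"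
  shows "u = v"
proof -
  have "v = lt_add (lt_add u (lt_smul (-1) v)) v" using assms by (simp add: lt_add_zero_left)
  also have "\<dots> = lt_add u (lt_add (lt_smul (-1) v) v)"
    using assms by (intro lt_add_assoc lt_smul_points) (auto simp: OK_ring)
  also have "\<dots> = u"
    using assms by (simp add: lt_add_neg lt_add_commute[of u 0] lt_add_zero_left)
  finally show ?thesis ..
qed

abbreviation pts :: "('c, 'c fps) module" where "pts \<equiv> lt_points F br"

lemma pts_simps [simp]:
  "carrier pts = points" "ring.zero pts = 0" "ring.add pts = lt_add" "smult pts = lt_smul"
  by (simp_all add: lt_points_def points_def)

lemma pts_abelian_group: "abelian_group pts"
proof (rule abelian_groupI)
  show "\<exists>y\<in>carrier pts. y \<oplus>\<^bsub>pts\<^esub> u = \<zero>\<^bsub>pts\<^esub>" if "u \<in> carrier pts" for u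
    using that by (intro bexI[of _ "lt_smul (-1) u"]) (auto simp: lt_add_neg OK_ring lt_smul_points)
  show "u \<oplus>\<^bsub>pts\<^esub> v = v \<oplus>\<^bsub>pts\<^esub> u" if "u \<in> carrier pts" "v \<in> carrier pts" for u v
    using that by (simp add: lt_add_commute[of u v])
qed (simp_all add: lt_add_points lt_add_assoc lt_add_zero_left)

lemma pts_module: "Module.module R pts"
  by (rule moduleI)
    (simp_all add: R_cring pts_abelian_group carrier_R lt_smul_points lt_smul_add_left
      lt_smul_add_right lt_smul_assoc lt_smul_one del: ring_of_integers_simps(1))

lemma Lam_add:
  assumes "u \<in> points" "v \<in> points"
  shows "Lam (lt_add u v) = Lam u + Lam v"
proof -
  have eq: "Lam (lt_add u v) = fps_subst2 (comp_outer lam F) u v"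
    by (rule fps_subst_subst2[OF lam_convergent F_integral F_nth_0_0 assms])
  define A B :: "nat \<times> nat \<Rightarrow> 'c fps"
    where "A = (\<lambda>(i, j). if j = 0 then fps_const (lam $ i) * u ^ i else 0)"
    and "B = (\<lambda>(i, j). if i = 0 then fps_const (lam $ j) * v ^ j else 0)"
  have "fps_has_sum A UNIV (Lam u)"
    unfolding fps_has_sum_def
  proof
    fix n
    have "((\<lambda>i. (fps_const (lam $ i) * u ^ i) $ n) has_sum Lam u $ n) UNIV"
      by (rule fps_has_sumD[OF fps_subst_has_sum[OF lam_convergent]]) (rule assms)
    then have "((\<lambda>x. A x $ n) has_sum Lam u $ n) (range (\<lambda>i. (i, 0)))"
      by (subst has_sum_reindex) (simp_all add: inj_on_def A_def o_def)
    then show "((\<lambda>x. A x $ n) has_sum Lam u $ n) UNIV"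
      by (rule has_sum_cong_neutral[THEN iffD1, rotated -1]) (auto simp: A_def)
  qed
  moreover have "fps_has_sum B UNIV (Lam v)"
    unfolding fps_has_sum_def
  proof
    fix n
    have "((\<lambda>j. (fps_const (lam $ j) * v ^ j) $ n) has_sum Lam v $ n) UNIV"
      by (rule fps_has_sumD[OF fps_subst_has_sum[OF lam_convergent]]) (rule assms)
    then have "((\<lambda>x. B x $ n) has_sum Lam v $ n) (range (\<lambda>j. (0, j)))"
      by (subst has_sum_reindex) (simp_all add: inj_on_def B_def o_def)
    then show "((\<lambda>x. B x $ n) has_sum Lam v $ n) UNIV"
      by (rule has_sum_cong_neutral[THEN iffD1, rotated -1]) (auto simp: B_def)
  qed
  ultimately have "fps_has_sum (\<lambda>x. A x + B x) UNIV (Lam u + Lam v)"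
    by (rule fps_has_sum_add)
  \<comment> \<open>The composite has coefficients on the two axes only. The families
    \<open>A\<close> and \<open>B\<close> overlap at the origin, where both vanish because the
    logarithm has no constant term.\<close>
  moreover have "(\<lambda>x. A x + B x) = (\<lambda>(i, j). fps_const (comp_outer lam F $ i $ j) * (u ^ i * v ^ j))"
    by (auto simp: A_def B_def lam_additive lam_nth_0 fun_eq_iff)
  ultimately show ?thesis
    unfolding eq by (intro fps_subst2_unique) simp
qed

lemma Lam_smul:
  assumes "a \<in> OK" "u \<in> points"
  shows "Lam (lt_smul a u) = fps_const a * Lam u"
  using assms
  by (simp add: fps_subst_assoc lam_convergent br_point fps_subst_eq_compose br_nth_0 lam_br
      fps_subst_cmult)

lemma Lam_subst: "f \<in> points \<Longrightarrow> w \<in> points \<Longrightarrow> Lam (fps_subst f w) = fps_subst (Lam f) w"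
  by (rule fps_subst_assoc[OF lam_convergent])

lemma Lam_convergent: "u \<in> points \<Longrightarrow> convergent_on_disc (Lam u)"
  by (rule fps_subst_convergent[OF lam_convergent])

subsection \<open>Zeros of the logarithm near the origin\<close>

lemma q_ge_3: "q \<ge> 3"
  using q_gt_2 by simp

lemma br_unif_nth_le: "n \<noteq> q \<Longrightarrow> absval (br \<pi> $ n) \<le> absval \<pi>"
  using br_unif_cong[of n] by simp

lemma br_unif_nth_le_1: "absval (br \<pi> $ n) \<le> 1"
  using br_integral[OF unif_OK] by (simp add: integral_fps_def)

lemma br_unif_nth_q: "absval (br \<pi> $ q) = 1"
  using br_unif_cong[of q] unif_lt_1 absval_add_eq[of "br \<pi> $ q - 1" 1] by simp

lemma br_unif_nth_0: "br \<pi> $ 0 = 0" and br_unif_nth_1: "br \<pi> $ 1 = \<pi>"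
  using br_nth_0 br_nth_1 unif_OK by blast+

lemma br_unif_term_le:
  assumes "n \<ge> 2" "absval y \<le> 1"
  shows "absval (br \<pi> $ n * y ^ n) \<le> max (absval \<pi> * absval y) (absval y ^ (q - 1)) * absval y"
proof (cases "n = q")
  case True
  have "absval (br \<pi> $ n * y ^ n) \<le> absval y ^ q"
    by (simp add: absval_mult absval_power True br_unif_nth_q)
  also have "\<dots> = absval y ^ (q - 1) * absval y"
    using q_ge_3 by (simp flip: power_Suc2)
  also have "\<dots> \<le> max (absval \<pi> * absval y) (absval y ^ (q - 1)) * absval y"
    by (intro mult_right_mono) auto
  finally show ?thesis .
next
  case False
  have "absval (br \<pi> $ n * y ^ n) \<le> absval \<pi> * absval y ^ 2"
    unfolding absval_mult absval_power
    using False assms by (intro mult_mono br_unif_nth_le power_decreasing) auto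
  also have "\<dots> = (absval \<pi> * absval y) * absval y" by (simp add: power2_eq_square)
  also have "\<dots> \<le> max (absval \<pi> * absval y) (absval y ^ (q - 1)) * absval y"
    by (intro mult_right_mono) auto
  finally show ?thesis .
qed

lemma H_power_nth_diag: "(br \<pi> ^ n) $ n = \<pi> ^ n"
proof (induction n)
  case (Suc n)
  have "(br \<pi> * br \<pi> ^ n) $ Suc n = (\<Sum>i\<in>{1}. br \<pi> $ i * (br \<pi> ^ n) $ (Suc n - i))"
    unfolding fps_mult_nth
  proof (rule sum.mono_neutral_right)
    show "\<forall>i\<in>{0..Suc n} - {1}. br \<pi> $ i * (br \<pi> ^ n) $ (Suc n - i) = 0"
    proof
      fix i assume i: "i \<in> {0..Suc n} - {1}"
      show "br \<pi> $ i * (br \<pi> ^ n) $ (Suc n - i) = 0"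
      proof (cases "i = 0")
        case False
        then have "Suc n - i < n" using i by auto
        then show ?thesis using br_unif_nth_0 by (simp add: fps_nth_power_eq_0)
      qed (simp add: br_unif_nth_0)
    qed
  qed auto
  then show ?case using Suc br_unif_nth_1 by simp
qed simp

lemma absval_1_minus:
  assumes "absval x < 1"
  shows "absval (1 - x) = 1"
  using absval_add_eq[of "- x" 1] assms by simp

text \<open>Comparing coefficients in \<open>lam oo br \<pi> = \<pi> lam\<close> shows that \<open>lam (\<pi> x) / \<pi>\<close> is
  integral and congruent to \<open>x\<close> modulo \<open>\<pi>\<close>; the congruence uses \<open>q > 2\<close>.\<close>

lemma lam_nth_scaled_le: "n \<ge> 2 \<Longrightarrow> absval (lam $ n) * absval \<pi> ^ n \<le> absval \<pi> ^ 2"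
proof (induction n rule: less_induct)
  case (less n)
  let ?P = "absval \<pi>"
  have P: "0 < ?P" "?P < 1" "?P \<le> 1" using unif_pos unif_lt_1 by auto
  \<comment> \<open>The monomial of degree \<open>q\<close> has a unit coefficient; its size at
    radius \<open>absval \<pi>\<close> is bounded by the cube because
    \<open>q \<ge> 3\<close>.\<close>
  have h2: "absval (br \<pi> $ m) * ?P ^ m \<le> ?P ^ 3" if "m \<ge> 2" for m
  proof (cases "m = q")
    case True
    then show ?thesis using P q_ge_3 br_unif_nth_q by (simp add: power_decreasing)
  next
    case False
    have "absval (br \<pi> $ m) * ?P ^ m \<le> ?P * ?P ^ 2"
      using False that P by (intro mult_mono br_unif_nth_le power_decreasing) auto
    then show ?thesis by (simp add: power3_eq_cube power2_eq_square)
  qed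
  have gauss: "gauss_le ?P (?P ^ 2) (br \<pi>)"
    unfolding gauss_le_def
  proof
    fix m :: nat
    have "?P ^ 3 \<le> ?P ^ 2" using P by (intro power_decreasing) auto
    consider "m = 0" | "m = 1" | "m \<ge> 2" by linarith
    then show "absval (br \<pi> $ m) * ?P ^ m \<le> ?P ^ 2"
      by cases (use h2[of m] \<open>?P ^ 3 \<le> ?P ^ 2\<close> br_unif_nth_0 br_unif_nth_1 in
        \<open>auto simp: power2_eq_square\<close>)
  qed
  have Hk: "absval ((br \<pi> ^ k) $ n) * ?P ^ n \<le> ?P ^ (2 * k)" for k
    using gauss_le_power[OF P(1) _ gauss, of k] by (simp add: gauss_le_def power_mult)
  have "(lam oo br \<pi>) $ n = \<pi> * lam $ n" using lam_br[OF unif_OK] by simp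
  then have "(\<Sum>k<n. lam $ k * (br \<pi> ^ k) $ n) + lam $ n * \<pi> ^ n = \<pi> * lam $ n"
    by (simp add: fps_compose_nth atLeast0AtMost lessThan_Suc_atMost[symmetric] H_power_nth_diag)
  moreover have "\<pi> ^ n = \<pi> * \<pi> ^ (n - 1)" using less.prems by (simp flip: power_Suc)
  \<comment> \<open>The summand \<open>k = n\<close> moves to the left, where
    \<open>1 - \<pi> ^ (n - 1)\<close> is a unit.\<close>
  ultimately have eq: "lam $ n * \<pi> * (1 - \<pi> ^ (n - 1)) = (\<Sum>k<n. lam $ k * (br \<pi> ^ k) $ n)"
    by (simp add: algebra_simps)
  have summand: "absval (lam $ k * (br \<pi> ^ k) $ n) \<le> ?P ^ 3 / ?P ^ n" if "k < n" for k
  proof -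
    consider "k = 0" | "k = 1" | "k \<ge> 2" by linarith
    then have "absval (lam $ k) * (absval ((br \<pi> ^ k) $ n) * ?P ^ n) \<le> ?P ^ 3"
    proof cases
      case 2
      then show ?thesis using h2[OF less.prems] lam_nth_1 by simp
    next
      case 3
      have "absval (lam $ k) * (absval ((br \<pi> ^ k) $ n) * ?P ^ n) \<le> absval (lam $ k) * ?P ^ (2 * k)"
        by (intro mult_left_mono Hk) auto
      also have "\<dots> = (absval (lam $ k) * ?P ^ k) * ?P ^ k" by (simp add: mult_2 power_add)
      also have "\<dots> \<le> ?P ^ 2 * ?P ^ 1"
        using less.IH[OF that 3] P 3 by (intro mult_mono power_decreasing) auto
      finally show ?thesis by (simp add: power3_eq_cube power2_eq_square)
    qed (use P in \<open>auto simp: lam_nth_0\<close>)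
    then show ?thesis using P by (simp add: absval_mult pos_le_divide_eq mult.assoc)
  qed
  have "absval (\<pi> ^ (n - 1)) < 1"
    using P less.prems by (simp add: absval_power power_less_one_iff)
  then have "absval (lam $ n) * ?P = absval (\<Sum>k<n. lam $ k * (br \<pi> ^ k) $ n)"
    unfolding eq[symmetric] by (simp add: absval_mult absval_1_minus)
  also have "\<dots> \<le> ?P ^ 3 / ?P ^ n"
    using summand P by (intro absval_sum_le) auto
  finally have "absval (lam $ n) * ?P * ?P ^ n \<le> ?P ^ 3"
    using P by (simp add: pos_le_divide_eq)
  then have "?P * (absval (lam $ n) * ?P ^ n) \<le> ?P * ?P ^ 2"
    by (simp add: power3_eq_cube power2_eq_square mult_ac)
  then show ?case using P by simp
qed

lemma lam_term_le:
  assumes "n \<ge> 2" "absval y \<le> absval \<pi>"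
  shows "absval (lam $ n * y ^ n) \<le> absval \<pi> * absval y"
proof -
  let ?P = "absval \<pi>"
  obtain m where m: "n = Suc m" using assms(1) by (cases n) auto
  have "absval (lam $ n) * ?P ^ m * ?P \<le> ?P * ?P"
    using lam_nth_scaled_le[OF assms(1)] by (simp add: m power2_eq_square mult_ac)
  then have "absval (lam $ n) * ?P ^ m \<le> ?P" using unif_pos by simp
  moreover have "absval (lam $ n) * absval y ^ m \<le> absval (lam $ n) * ?P ^ m"
    using assms by (intro mult_left_mono power_mono) auto
  ultimately have "absval (lam $ n) * absval y ^ m \<le> ?P" by linarith
  then have "absval (lam $ n) * absval y ^ m * absval y \<le> ?P * absval y"
    by (rule mult_right_mono) simp
  then show ?thesis by (simp add: absval_mult absval_power m mult_ac)
qed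

lemma absval_series_approx:
  fixes f :: "'c fps"
  assumes "convergent_on_disc f" "absval y < 1" "f $ 0 = 0"
    "\<And>n. n \<ge> 2 \<Longrightarrow> absval (f $ n * y ^ n) \<le> B"
  shows "absval (fps_subst f (fps_const y) $ 0 - f $ 1 * y) \<le> B"
proof -
  have "B \<ge> 0" using assms(4)[of 2] by (meson absval_nonneg order_refl order_trans)
  let ?g = "\<lambda>n. f $ n * y ^ n + (if n = 1 then - (f $ 1 * y) else 0)"
  have "((\<lambda>n. f $ n * y ^ n) has_sum fps_subst f (fps_const y) $ 0) UNIV"
    using fps_subst_nth_0_has_sum[OF assms(1), of "fps_const y"] assms(2) by simp
  moreover have "((\<lambda>n. if n = 1 then - (f $ 1 * y) else 0) has_sum - (f $ 1 * y)) UNIV"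
    by (rule has_sum_finite_neutralI[where B = "{1}"]) auto
  ultimately have "(?g has_sum fps_subst f (fps_const y) $ 0 + - (f $ 1 * y)) UNIV"
    by (rule has_sum_add)
  then have "absval (fps_subst f (fps_const y) $ 0 + - (f $ 1 * y)) \<le> B"
  proof (rule absval_has_sum_le)
    fix n :: nat
    consider "n = 0" | "n = 1" | "n \<ge> 2" by linarith
    then show "absval (?g n) \<le> B" by cases (use assms \<open>B \<ge> 0\<close> in auto)
  qed fact
  then show ?thesis by simp
qed

text \<open>On the disc of radius \<open>absval \<pi>\<close> the linear term of the logarithm
  strictly dominates the others.\<close>

lemma Lam_const_eq_0:
  assumes "absval y \<le> absval \<pi>" "Lam (fps_const y) $ 0 = 0"
  shows "y = 0"
proof (rule ccontr)
  assume y: "y \<noteq> 0"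
  have "absval (Lam (fps_const y) $ 0 - lam $ 1 * y) \<le> absval \<pi> * absval y"
    using assms(1) unif_lt_1 lam_nth_0 lam_term_le by (intro absval_series_approx lam_convergent) auto
  then have "absval y \<le> absval \<pi> * absval y" using assms(2) lam_nth_1 by simp
  moreover have "absval \<pi> * absval y < 1 * absval y"
    using y unif_lt_1 by (intro mult_strict_right_mono) auto
  ultimately show False by simp
qed

lemma br_unif_const_eq_0:
  assumes "absval y < 1" "absval y ^ (q - 1) < absval \<pi>" "lt_smul \<pi> (fps_const y) $ 0 = 0"
  shows "y = 0"
proof (rule ccontr)
  assume y: "y \<noteq> 0"
  let ?c = "max (absval \<pi> * absval y) (absval y ^ (q - 1))"
  have "absval (lt_smul \<pi> (fps_const y) $ 0 - br \<pi> $ 1 * y) \<le> ?c * absval y"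
    using assms(1) br_unif_nth_0 br_unif_term_le
    by (intro absval_series_approx integral_convergent br_integral unif_OK) auto
  then have "absval \<pi> * absval y \<le> ?c * absval y"
    using assms(3) br_unif_nth_1 by (simp add: absval_mult)
  moreover have "?c < absval \<pi>"
    using assms(1,2) unif_pos by simp
  then have "?c * absval y < absval \<pi> * absval y"
    using y by (intro mult_strict_right_mono) auto
  ultimately show False by simp
qed

lemma lt_smul_const:
  "a \<in> OK \<Longrightarrow> absval y < 1 \<Longrightarrow> lt_smul a (fps_const y) = fps_const (lt_smul a (fps_const y) $ 0)"
  by (rule fps_subst_const_const[OF integral_convergent[OF br_integral]])

text \<open>The endomorphism \<open>[\<pi>]\<close> moves the constant term into the disc of radius
  \<open>absval \<pi>\<close>, where 0 is the only zero of the logarithm, and \<open>[\<pi>]\<close>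
  itself has no other zero on the given disc. Once the constant term vanishes, the substitution is a
  formal composition and \<open>lam_cancel\<close> applies.\<close>

lemma Lam_eq_0_imp_eq_0:
  assumes u: "u \<in> points" and Lam: "Lam u = 0" and small: "absval (u $ 0) ^ (q - 1) < absval \<pi>"
  shows "u = 0"
proof -
  define y where "y = u $ 0"
  have y1: "absval y < 1" using u by (simp add: points_def y_def)
  have "((\<lambda>k. lam $ k * y ^ k) has_sum Lam u $ 0) UNIV"
    unfolding y_def by (rule fps_subst_nth_0_has_sum[OF lam_convergent u])
  moreover have "((\<lambda>k. lam $ k * y ^ k) has_sum Lam (fps_const y) $ 0) UNIV"
    using fps_subst_nth_0_has_sum[OF lam_convergent, of "fps_const y"] y1 by simp
  ultimately have Ly: "Lam (fps_const y) $ 0 = 0"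
    using has_sum_unique Lam by (metis fps_zero_nth)
  define y' where "y' = lt_smul \<pi> (fps_const y) $ 0"
  have y': "lt_smul \<pi> (fps_const y) = fps_const y'"
    unfolding y'_def by (rule lt_smul_const[OF unif_OK y1])
  have "absval y' \<le> absval \<pi>"
  proof -
    have "absval (y' - br \<pi> $ 1 * y) \<le> max (absval \<pi> * absval y) (absval y ^ (q - 1)) * absval y"
      unfolding y'_def using y1 br_unif_nth_0 br_unif_term_le
      by (intro absval_series_approx integral_convergent br_integral unif_OK) auto
    also have "\<dots> \<le> absval \<pi> * 1"
      using y1 small unif_pos by (intro mult_mono) (auto simp: y_def)
    finally have "absval (y' - \<pi> * y) \<le> absval \<pi>" using br_unif_nth_1 by simp
    moreover have "absval (\<pi> * y) \<le> absval \<pi>" using y1 unif_pos by (simp add: absval_mult)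
    ultimately show ?thesis using absval_add_le[of "y' - \<pi> * y" "\<pi> * y"] by simp
  qed
  moreover have "Lam (fps_const y') $ 0 = 0"
    unfolding y'[symmetric] using y1 Ly by (simp add: Lam_smul unif_OK)
  ultimately have "y' = 0" by (rule Lam_const_eq_0)
  then have "y = 0"
    using br_unif_const_eq_0[OF y1] small by (simp add: y_def y'_def)
  then have u0: "u $ 0 = 0" by (simp add: y_def)
  then have "lam oo u = lam oo 0"
    using Lam by (simp add: fps_subst_eq_compose lam_nth_0)
  then show ?thesis by (rule lam_cancel) (use u0 in auto)
qed

end

subsection \<open>Solving equations by contraction\<close>

lemma absval_power_diff_le:
  fixes x y :: "'c::nonarch_field"
  assumes "absval x \<le> r" "absval y \<le> r"
  shows "absval (x ^ n - y ^ n) \<le> absval (x - y) * r ^ (n - 1)"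
proof -
  have r: "r \<ge> 0" using assms(1) absval_nonneg[of x] by linarith
  have "absval (y ^ (n - Suc i) * x ^ i) \<le> r ^ (n - 1)" if "i < n" for i
  proof -
    have "absval (y ^ (n - Suc i) * x ^ i) \<le> r ^ (n - Suc i) * r ^ i"
      unfolding absval_mult absval_power using assms r by (intro mult_mono power_mono) auto
    also have "\<dots> = r ^ (n - 1)" using that by (simp flip: power_add)
    finally show ?thesis .
  qed
  then have "absval (\<Sum>i<n. y ^ (n - Suc i) * x ^ i) \<le> r ^ (n - 1)"
    using r by (intro absval_sum_le) auto
  then show ?thesis
    unfolding power_diff_sumr2 absval_mult by (rule mult_left_mono) simp
qed

text \<open>Newton iteration with the fixed slope \<open>a\<close>: the map \<open>\<Phi>\<close>
  contracts the closed ball of radius \<open>r\<close> in \<open>V\<close> by the factor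
  \<open>\<rho>\<close>. The closed ring \<open>V\<close> records where the solution lies; it is the
  whole field for torsion points and \<open>K\<close> for values of the logarithm.\<close>

lemma contraction_solve:
  fixes f :: "'c::{nonarch_field, complete_space} fps"
  assumes f: "convergent_on_disc f" "f $ 0 = 0" "f $ 1 = a" "a \<noteq> 0"
    and r: "0 < r" "r < 1" "0 \<le> \<rho>" "\<rho> < 1"
    and small: "\<And>n. n \<ge> 2 \<Longrightarrow> absval (f $ n) * r ^ n \<le> \<rho> * absval a * r"
    and V: "closed V" "0 \<in> V" "\<And>x y. x \<in> V \<Longrightarrow> y \<in> V \<Longrightarrow> x + y \<in> V" "\<And>x y. x \<in> V \<Longrightarrow> y \<in> V \<Longrightarrow> x - y \<in> V"
      "\<And>x y. x \<in> V \<Longrightarrow> y \<in> V \<Longrightarrow> x * y \<in> V" "1 \<in> V" "\<And>n. f $ n \<in> V" "inverse a \<in> V"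
    and t: "t \<in> V" "absval t \<le> absval a * r"
  shows "\<exists>y\<in>V. absval y \<le> r \<and> fps_subst f (fps_const y) $ 0 = t"
proof -
  define ev where "ev y = fps_subst f (fps_const y) $ 0" for y
  define S where "S = {y \<in> V. absval y \<le> r}"
  define \<Phi> where "\<Phi> y = y - inverse a * (ev y - t)" for y
  have ev: "((\<lambda>n. f $ n * y ^ n) has_sum ev y) UNIV" if "absval y \<le> r" for y
    using fps_subst_nth_0_has_sum[OF f(1), of "fps_const y"] that r by (simp add: ev_def)
  \<comment> \<open>Without the linear term there remain multiples of \<open>y ^ n - z ^ n\<close>
    with \<open>n \<ge> 2\<close>, each divisible by \<open>y - z\<close> with a cofactor of size at
    most \<open>r ^ (n - 1)\<close>.\<close>
  have lip: "absval ((ev y - a * y) - (ev z - a * z)) \<le> \<rho> * absval a * absval (y - z)"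
    if yz: "absval y \<le> r" "absval z \<le> r" for y z
  proof -
    let ?g = "\<lambda>n. (f $ n * y ^ n + (-1) * (f $ n * z ^ n)) + (if n = 1 then - (a * y - a * z) else 0)"
    have "((\<lambda>n. if n = 1 then - (a * y - a * z) else 0) has_sum - (a * y - a * z)) UNIV"
      by (rule has_sum_finite_neutralI[where B = "{1}"]) auto
    then have "(?g has_sum (ev y + (-1) * ev z) + - (a * y - a * z)) UNIV"
      by (intro has_sum_add has_sum_cmult_right ev yz)
    then have "absval ((ev y + (-1) * ev z) + - (a * y - a * z)) \<le> \<rho> * absval a * absval (y - z)"
    proof (rule absval_has_sum_le)
      fix n :: nat
      consider "n = 0" | "n = 1" | "n \<ge> 2" by linarith
      then show "absval (?g n) \<le> \<rho> * absval a * absval (y - z)"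
      proof cases
        case 3
        have "r ^ n = r ^ (n - 1) * r" using 3 by (simp flip: power_Suc2)
        then have "absval (f $ n) * r ^ (n - 1) * r \<le> \<rho> * absval a * r"
          using small[OF 3] by (simp only: mult.assoc)
        then have c: "absval (f $ n) * r ^ (n - 1) \<le> \<rho> * absval a" using r by simp
        have "?g n = f $ n * (y ^ n - z ^ n)" using 3 by (simp add: algebra_simps)
        then have "absval (?g n) \<le> absval (f $ n) * (absval (y - z) * r ^ (n - 1))"
          using absval_power_diff_le[OF yz, of n] by (simp add: absval_mult mult_left_mono)
        also have "\<dots> = (absval (f $ n) * r ^ (n - 1)) * absval (y - z)" by simp
        also have "\<dots> \<le> (\<rho> * absval a) * absval (y - z)" using c by (rule mult_right_mono) simp
        finally show ?thesis .
      qed (use r f in auto)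
    qed (use r in auto)
    then show ?thesis by (simp add: algebra_simps)
  qed
  have \<Phi>: "\<Phi> y = inverse a * t - inverse a * (ev y - a * y)" for y
    using f(4) by (simp add: \<Phi>_def algebra_simps)
  have ev0: "ev 0 = 0"
    using ev[of 0] r f(2) by (intro has_sum_unique[OF ev[of 0]] has_sum_0) (auto simp: power_0_left)
  have "\<exists>!y\<in>S. \<Phi> y = y"
  proof (rule Banach_fix)
    have "S = V \<inter> cball 0 r" by (auto simp: S_def absval_def dist_commute)
    then show "complete S" using V(1) by (simp add: complete_eq_closed closed_Int)
    show "S \<noteq> {}" using V(2) r by (auto simp: S_def intro!: exI[of _ 0])
    show "\<Phi> ` S \<subseteq> S"
    proof safe
      fix y assume y: "y \<in> S"
      then have yV: "y \<in> V" and yr: "absval y \<le> r" by (auto simp: S_def)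
      have pow: "y ^ n \<in> V" for n by (induction n) (auto intro: V yV)
      have "ev y \<in> V" by (rule has_sum_in_closed[OF ev[OF yr] _ V(1-3)]) (auto intro: V pow)
      then have "\<Phi> y \<in> V" unfolding \<Phi>_def by (intro V yV t)
      moreover have "absval (\<Phi> y) \<le> r"
      proof -
        have "absval (inverse a * t) \<le> r"
        proof -
          have "absval (inverse a * t) = absval t / absval a"
            by (simp only: absval_mult absval_inverse divide_inverse mult.commute)
          also have "\<dots> \<le> r" using t(2) f(4) by (subst pos_divide_le_eq) (simp_all add: mult.commute)
          finally show ?thesis .
        qed
        moreover have "absval (ev y - a * y) \<le> \<rho> * absval a * absval y"
          using lip[OF yr, of 0] r ev0 by simp
        then have "absval (inverse a * (ev y - a * y)) \<le> \<rho> * absval y"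
        proof -
          assume le: "absval (ev y - a * y) \<le> \<rho> * absval a * absval y"
          have "absval (inverse a * (ev y - a * y)) = inverse (absval a) * absval (ev y - a * y)"
            by (simp only: absval_mult absval_inverse)
          also have "\<dots> \<le> inverse (absval a) * (\<rho> * absval a * absval y)"
            using le by (intro mult_left_mono) auto
          also have "\<dots> = \<rho> * absval y" using f(4) by simp
          finally show ?thesis .
        qed
        moreover have "\<rho> * absval y \<le> 1 * r" using r yr by (intro mult_mono) auto
        ultimately show ?thesis unfolding \<Phi> by (intro absval_diff_bound) auto
      qed
      ultimately show "\<Phi> y \<in> S" by (simp add: S_def)
    qed
    show "dist (\<Phi> y) (\<Phi> z) \<le> \<rho> * dist y z" if "y \<in> S" "z \<in> S" for y z
    proof -
      have "\<Phi> y - \<Phi> z = - (inverse a * ((ev y - a * y) - (ev z - a * z)))"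
        by (simp add: \<Phi> algebra_simps)
      then have "absval (\<Phi> y - \<Phi> z) = inverse (absval a) * absval ((ev y - a * y) - (ev z - a * z))"
        by (simp only: absval_minus absval_mult absval_inverse)
      also have "\<dots> \<le> inverse (absval a) * (\<rho> * absval a * absval (y - z))"
        using that by (intro mult_left_mono lip) (auto simp: S_def)
      also have "\<dots> = \<rho> * absval (y - z)" using f(4) by simp
      finally show ?thesis by (simp add: dist_eq_absval)
    qed
  qed (use r in auto)
  then obtain y where y: "y \<in> S" "\<Phi> y = y" by blast
  then have "ev y = t" using f(4) by (simp add: \<Phi>_def)
  then show ?thesis using y by (auto simp: S_def ev_def)
qed

subsection \<open>Zeros of integral power series\<close>

lemma fps_subst_shift:
  fixes f :: "'c::{nonarch_field, complete_space} fps"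
  assumes "f \<in> integral_fps" "absval z < 1"
  shows "fps_subst f (fps_const z) $ 0 = f $ 0 + z * fps_subst (fps_shift 1 f) (fps_const z) $ 0"
proof -
  have s: "fps_shift 1 f \<in> integral_fps" and c: "fps_const (f $ 0) \<in> integral_fps"
    and X: "fps_X \<in> integral_fps"
    using assms(1) by (auto simp: integral_fps_def fps_X_nth)
  have eq: "f = fps_const (f $ 0) * 1 + fps_X * fps_shift 1 f"
    by (rule fps_ext) auto
  have "fps_subst f (fps_const z) =
      fps_subst (fps_const (f $ 0) * 1) (fps_const z) + fps_subst (fps_X * fps_shift 1 f) (fps_const z)"
    using assms(2) s c X
    by (subst eq, intro fps_subst_add integral_convergent integral_mult) auto
  also have "fps_subst (fps_const (f $ 0) * 1) (fps_const z) = fps_const (f $ 0) * fps_subst 1 (fps_const z)"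
    using assms(2) by (intro fps_subst_cmult integral_convergent) auto
  also have "fps_subst (fps_X * fps_shift 1 f) (fps_const z) = fps_const z * fps_subst (fps_shift 1 f) (fps_const z)"
    using assms(2) s X by (subst fps_subst_mult) (auto intro: integral_convergent)
  finally have "fps_subst f (fps_const z) = fps_const (f $ 0) + fps_const z * fps_subst (fps_shift 1 f) (fps_const z)"
    by simp
  then show ?thesis by simp
qed

lemma integral_fps_factor_root:
  fixes f :: "'c::{nonarch_field, complete_space} fps"
  assumes f: "f \<in> integral_fps" and z: "absval z < 1" "fps_subst f (fps_const z) $ 0 = 0"
  obtains g where "g \<in> integral_fps" "f = (fps_X - fps_const z) * g"
proof -
  \<comment> \<open>Division by \<open>x - z\<close>: coefficient \<open>n\<close> of the quotient
    is the sum of \<open>f_k * z^(k - n - 1)\<close> over \<open>k > n\<close>, which converges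
    because \<open>absval z < 1\<close>.\<close>
  define g where "g = Abs_fps (\<lambda>n. fps_subst (fps_shift (Suc n) f) (fps_const z) $ 0)"
  have s: "fps_shift n f \<in> integral_fps" for n using f by (auto simp: integral_fps_def)
  have "g \<in> integral_fps"
    using fps_subst_integral[OF s, of "fps_const z"] z(1) by (auto simp: g_def integral_fps_def)
  moreover have step: "fps_subst (fps_shift n f) (fps_const z) $ 0 = f $ n + z * g $ n" for n
    using fps_subst_shift[OF s z(1), of n] by (simp add: g_def fps_shift_fps_shift[symmetric])
  have "f = (fps_X - fps_const z) * g"
  proof (rule fps_ext)
    fix n
    show "f $ n = ((fps_X - fps_const z) * g) $ n"
    proof (cases n)
      case 0
      then show ?thesis using step[of 0] z(2) by (simp add: left_diff_distrib eq_neg_iff_add_eq_0)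
    next
      case (Suc m)
      then show ?thesis using step[of n] by (simp add: left_diff_distrib g_def algebra_simps)
    qed
  qed
  ultimately show ?thesis by (rule that)
qed

text \<open>Splitting off the roots one at a time writes \<open>f\<close> as an integral series
  times a product of factors \<open>x - z\<close>, whose reduction is a power of \<open>x\<close>.
  The number of roots is thereby bounded by the index of any unit coefficient.\<close>

lemma many_roots_imp_small_coeffs:
  fixes f :: "'c::{nonarch_field, complete_space} fps"
  assumes "finite T" "f \<in> integral_fps" "\<And>z. z \<in> T \<Longrightarrow> absval z < 1"
    "\<And>z. z \<in> T \<Longrightarrow> fps_subst f (fps_const z) $ 0 = 0" "k < card T"
  shows "absval (f $ k) < 1"
  using assms
proof (induction T arbitrary: f k rule: finite_induct)
  case (insert z T)
  obtain g where g: "g \<in> integral_fps" "f = (fps_X - fps_const z) * g"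
    by (rule integral_fps_factor_root[of f z]) (use insert.prems in auto)
  have z1: "absval z < 1" using insert.prems(2) by simp
  have Xz: "fps_X - fps_const z \<in> integral_fps"
    using z1 by (auto simp: integral_fps_def fps_X_nth)
  have gz: "fps_subst g (fps_const w) $ 0 = 0" if w: "w \<in> T" for w
  proof -
    have w1: "absval w < 1" using insert.prems(2) w by simp
    have "fps_subst (fps_X - fps_const z) (fps_const w) = fps_const w - fps_const z"
      using w1 z1 fps_subst_cmult[of 1 "fps_const w" z]
      by (subst fps_subst_diff) (auto simp: integral_convergent integral_fps_def fps_X_nth)
    then have "fps_subst f (fps_const w) = (fps_const w - fps_const z) * fps_subst g (fps_const w)"
      unfolding g(2) using w1 g(1) Xz by (simp add: fps_subst_mult integral_convergent)
    then have "(w - z) * fps_subst g (fps_const w) $ 0 = 0"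
      using insert.prems(3)[of w] w by (simp add: fps_mult_nth_0)
    then show ?thesis using w insert.hyps by auto
  qed
  have small: "absval (z * g $ k) < 1"
    using z1 g(1) mult_left_mono[of "absval (g $ k)" 1 "absval z"]
    by (simp add: absval_mult integral_fps_def)
  show ?case
  proof (cases k)
    case 0
    then have "f $ k = - (z * g $ k)" by (simp add: g left_diff_distrib)
    then show ?thesis using small by simp
  next
    case (Suc m)
    have "f $ k = g $ m - z * g $ k" by (simp add: g left_diff_distrib Suc)
    moreover have "absval (g $ m) < 1"
      using insert.prems insert.hyps gz g(1) Suc by (intro insert.IH) auto
    ultimately show ?thesis using small absval_diff_le[of "g $ m" "z * g $ k"] by simp
  qed
qed simp

text \<open>Up to a constant the polynomial is a product of factors \<open>x - r\<close> with
  \<open>absval r \<ge> 1\<close>, and in each of them the constant term is the largest. Read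
  contrapositively it provides a root in the open unit disc.\<close>

lemma large_roots_imp_coeff_le:
  fixes P :: "'c::{nonarch_field, alg_closed_field} poly"
  assumes "\<And>x. poly P x = 0 \<Longrightarrow> absval x \<ge> 1"
  shows "absval (poly.coeff P i) \<le> absval (poly.coeff P 0)"
  using assms
proof (induction "Polynomial.degree P" arbitrary: P i)
  case 0
  then show ?case by (cases i) (auto simp: coeff_eq_0)
next
  case (Suc n)
  then obtain x where x: "poly P x = 0" using alg_closed_imp_poly_has_root[of P] by auto
  then obtain Q where Q: "P = [:- x, 1:] * Q" by (auto simp: poly_eq_0_iff_dvd)
  have "Q \<noteq> 0" using Q Suc(2) by auto
  then have dQ: "n = Polynomial.degree Q"
    using Suc(2) Q degree_mult_eq[of "[:- x, 1:]" Q] by simp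
  have IH: "absval (poly.coeff Q i) \<le> absval (poly.coeff Q 0)" for i
    using Suc.prems by (intro Suc.hyps(1)[OF dQ]) (simp add: Q)
  have x1: "absval x \<ge> 1" using Suc.prems[OF x] .
  have P0: "absval (poly.coeff P 0) = absval x * absval (poly.coeff Q 0)"
    by (simp add: Q absval_mult)
  have xQ: "absval (x * poly.coeff Q i) \<le> absval (poly.coeff P 0)" for i
    unfolding P0 absval_mult by (intro mult_left_mono IH) auto
  show ?case
  proof (cases i)
    case (Suc m)
    have "absval (poly.coeff Q m) \<le> 1 * absval (poly.coeff Q 0)" using IH by simp
    also have "\<dots> \<le> absval (poly.coeff P 0)" unfolding P0 using x1 by (intro mult_right_mono) auto
    finally show ?thesis using xQ[of i] by (simp add: Q Suc absval_diff_bound)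
  qed simp
qed

context lubin_tate_module
begin

subsection \<open>The torsion points of level 0\<close>

definition tors :: "'c set" where "tors = torsion0 \<pi> br"

lemma tors_iff: "z \<in> tors \<longleftrightarrow> absval z < 1 \<and> lt_smul \<pi> (fps_const z) = 0"
proof (cases "absval z < 1")
  case True
  have "((\<lambda>n. br \<pi> $ n * z ^ n) has_sum lt_smul \<pi> (fps_const z) $ 0) UNIV"
    using fps_subst_nth_0_has_sum[OF integral_convergent[OF br_integral[OF unif_OK]], of "fps_const z"] True
    by simp
  then have "((\<lambda>n. br \<pi> $ n * z ^ n) has_sum 0) UNIV \<longleftrightarrow> lt_smul \<pi> (fps_const z) $ 0 = 0"
    using has_sum_unique by metis
  also have "\<dots> \<longleftrightarrow> lt_smul \<pi> (fps_const z) = 0"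
    using lt_smul_const[OF unif_OK True] by (metis fps_const_0_eq_0 fps_zero_nth)
  finally show ?thesis using True by (simp add: tors_def torsion0_def)
qed (simp add: tors_def torsion0_def)

text \<open>If the sum vanishes, the term of index \<open>q\<close> is cancelled by terms of size at
  most \<open>absval \<pi> * absval w\<close>. The coefficients are left general to cover both
  \<open>br \<pi>\<close> and a truncation of it.\<close>

lemma root_absval_le:
  fixes g :: "nat \<Rightarrow> 'c"
  assumes sum: "((\<lambda>n. g n * w ^ n) has_sum 0) UNIV" and w: "absval w < 1"
    and g: "g 0 = 0" "absval (g q) = 1" "\<And>n. n \<noteq> q \<Longrightarrow> absval (g n) \<le> absval \<pi>"
  shows "absval w ^ (q - 1) \<le> absval \<pi>"
proof (cases "w = 0")
  case False
  have "((\<lambda>n. if n = q then - (g q * w ^ q) else 0) has_sum - (g q * w ^ q)) UNIV"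
    by (rule has_sum_finite_neutralI[where B = "{q}"]) auto
  then have "((\<lambda>n. g n * w ^ n + (if n = q then - (g q * w ^ q) else 0)) has_sum 0 + - (g q * w ^ q)) UNIV"
    by (intro has_sum_add sum)
  then have "absval (0 + - (g q * w ^ q)) \<le> absval \<pi> * absval w"
  proof (rule absval_has_sum_le)
    fix n :: nat
    show "absval (g n * w ^ n + (if n = q then - (g q * w ^ q) else 0)) \<le> absval \<pi> * absval w"
    proof (cases "n = q \<or> n = 0")
      case False
      then have "absval (g n) * absval w ^ n \<le> absval \<pi> * absval w ^ 1"
        using g w by (intro mult_mono power_decreasing) auto
      then show ?thesis using False by (simp add: absval_mult absval_power)
    qed (use g q_ge_3 in auto)
  qed auto
  then have "absval w ^ q \<le> absval \<pi> * absval w"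
    using g by (simp add: absval_mult absval_power)
  also have "absval w ^ q = absval w ^ (q - 1) * absval w"
    using q_ge_3 by (simp flip: power_Suc2)
  finally show ?thesis using False by simp
qed (use unif_pos q_ge_3 in \<open>simp add: power_0_left\<close>)

lemma br_unif_nth_power_le: "n \<ge> 2 \<Longrightarrow> absval (br \<pi> $ n) * absval \<pi> ^ n \<le> absval \<pi> ^ 3"
proof (cases "n = q")
  case True
  then show ?thesis
    using unif_lt_1 q_ge_3 br_unif_nth_q by (simp add: power_decreasing)
next
  case False
  assume n: "n \<ge> 2"
  have "absval (br \<pi> $ n) * absval \<pi> ^ n \<le> absval \<pi> * absval \<pi> ^ 2"
    using False n unif_lt_1 by (intro mult_mono br_unif_nth_le power_decreasing) auto
  then show ?thesis by (simp add: power3_eq_cube power2_eq_square)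
qed

lemma lt_add_const:
  assumes "absval y < 1" "absval z < 1"
  shows "lt_add (fps_const y) (fps_const z) = fps_const (lt_add (fps_const y) (fps_const z) $ 0)"
proof -
  have "lt_add (fps_const y) (fps_const z) $ n = 0" if "n > 0" for n
  proof (rule has_sum_unique)
    show "((\<lambda>x. (case x of (i, j) \<Rightarrow> fps_const (F $ i $ j) * (fps_const y ^ i * fps_const z ^ j)) $ n)
        has_sum lt_add (fps_const y) (fps_const z) $ n) UNIV"
      using assms by (intro fps_has_sumD fps_subst2_has_sum F_integral) auto
    show "((\<lambda>x. (case x of (i, j) \<Rightarrow> fps_const (F $ i $ j) * (fps_const y ^ i * fps_const z ^ j)) $ n)
        has_sum 0) UNIV"
      using that by (intro has_sum_0) (auto simp: fps_const_power)
  qed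
  then show ?thesis by (auto simp: fps_eq_iff)
qed

text \<open>A small root of a truncation of \<open>br \<pi>\<close> is corrected to an exact root by subtracting, in the
  formal group, a much smaller solution of \<open>br \<pi> t = \<epsilon>\<close>.\<close>

lemma nonzero_torsion_exists: "\<exists>z\<in>tors. z \<noteq> 0"
proof -
  \<comment> \<open>The truncation error is at most \<open>absval w ^ (2 * q + 1)\<close>, and
    \<open>2 * q + 1 = 2 * (q - 1) + 3\<close>. This yields two factors \<open>absval \<pi>\<close>,
    which make the equation for the correction solvable, and a factor \<open>absval w ^ 3\<close>,
    which keeps the correction smaller than \<open>w\<close>.\<close>
  define N where "N = 2 * q"
  \<comment> \<open>The truncated series divided by \<open>x\<close>; its constant term is
    \<open>\<pi>\<close>, so its roots are nonzero.\<close>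
  define P :: "'c poly" where "P = (\<Sum>k<N. Polynomial.monom (br \<pi> $ Suc k) k)"
  have coeff: "poly.coeff P k = (if k < N then br \<pi> $ Suc k else 0)" for k
    by (simp add: P_def coeff_sum)
  have q1: "Suc (q - 1) = q" using q_ge_3 by simp
  \<comment> \<open>Otherwise the unit coefficient of index \<open>q - 1\<close> would be bounded by
    the constant term \<open>\<pi>\<close>.\<close>
  have "\<not> (\<forall>x. poly P x = 0 \<longrightarrow> absval x \<ge> 1)"
  proof
    assume "\<forall>x. poly P x = 0 \<longrightarrow> absval x \<ge> 1"
    then have "absval (poly.coeff P (q - 1)) \<le> absval (poly.coeff P 0)"
      by (intro large_roots_imp_coeff_le) auto
    moreover have "poly.coeff P (q - 1) = br \<pi> $ q"
      unfolding coeff q1 using q_ge_3 by (simp add: N_def)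
    moreover have "poly.coeff P 0 = \<pi>"
      using q_ge_3 br_unif_nth_1 by (simp add: coeff N_def)
    ultimately have "1 \<le> absval \<pi>" using br_unif_nth_q by simp
    then show False using unif_lt_1 by simp
  qed
  then obtain w where w: "poly P w = 0" "absval w < 1" by (auto simp: not_le)
  have w0: "w \<noteq> 0"
  proof
    assume "w = 0"
    then have "poly.coeff P 0 = 0" using w(1) by (simp add: poly_0_coeff_0)
    then show False using unif_nonzero br_unif_nth_1 q_ge_3 by (simp add: coeff N_def)
  qed
  define g where "g n = (if n \<le> N then br \<pi> $ n else 0)" for n
  have "(\<Sum>n\<le>N. br \<pi> $ n * w ^ n) = (\<Sum>k<N. br \<pi> $ Suc k * w ^ Suc k)"
    by (simp add: sum.atMost_shift br_unif_nth_0)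
  also have "\<dots> = w * poly P w"
    by (simp add: P_def poly_sum poly_monom sum_distrib_left mult_ac)
  finally have "(\<Sum>n\<le>N. br \<pi> $ n * w ^ n) = 0" using w(1) by simp
  then have gsum: "((\<lambda>n. g n * w ^ n) has_sum 0) UNIV"
    by (intro has_sum_finite_neutralI[where B = "{..N}"]) (auto simp: g_def)
  have w_le: "absval w ^ (q - 1) \<le> absval \<pi>"
    using br_unif_nth_0 br_unif_nth_q br_unif_nth_le unif_pos
    by (intro root_absval_le[OF gsum w(2)]) (auto simp: g_def N_def)
  define \<epsilon> where "\<epsilon> = lt_smul \<pi> (fps_const w) $ 0"
  have H: "convergent_on_disc (br \<pi>)" by (intro integral_convergent br_integral unif_OK)
  have wN: "absval w ^ (N + 1) = absval w ^ (q - 1) * absval w ^ (q - 1) * absval w ^ 3"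
    using q_ge_3 by (simp add: N_def flip: power_add)
  have "absval \<epsilon> \<le> absval w ^ (N + 1)"
  proof -
    have "((\<lambda>n. br \<pi> $ n * w ^ n) has_sum \<epsilon>) UNIV"
      unfolding \<epsilon>_def using fps_subst_nth_0_has_sum[OF H, of "fps_const w"] w(2) by simp
    then have "((\<lambda>n. br \<pi> $ n * w ^ n + (-1) * (g n * w ^ n)) has_sum \<epsilon> + (-1) * 0) UNIV"
      by (intro has_sum_add has_sum_cmult_right gsum)
    then have "absval (\<epsilon> + (-1) * 0) \<le> absval w ^ (N + 1)"
    proof (rule absval_has_sum_le)
      fix n :: nat
      show "absval (br \<pi> $ n * w ^ n + (-1) * (g n * w ^ n)) \<le> absval w ^ (N + 1)"
      proof (cases "n \<le> N")
        case False
        have "absval (br \<pi> $ n) * absval w ^ n \<le> 1 * absval w ^ (N + 1)"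
          using False w(2) br_unif_nth_le_1 by (intro mult_mono power_decreasing) auto
        then show ?thesis using False by (simp add: g_def absval_mult absval_power)
      qed (simp add: g_def)
    qed auto
    then show ?thesis by simp
  qed
  also have "\<dots> \<le> absval \<pi> * absval \<pi> * absval w ^ 3"
    unfolding wN using w_le by (intro mult_right_mono mult_mono) auto
  finally have \<epsilon>: "absval \<epsilon> \<le> absval \<pi> * absval \<pi> * absval w ^ 3" .
  have w3: "absval w ^ 3 < absval w"
    using power_strict_decreasing[of 1 3 "absval w"] w(2) w0 by simp
  have "\<exists>t\<in>UNIV. absval t \<le> absval \<pi> \<and> lt_smul \<pi> (fps_const t) $ 0 = \<epsilon>"
  proof (rule contraction_solve[where \<rho> = "absval \<pi>" and a = \<pi>])
    show "absval (br \<pi> $ n) * absval \<pi> ^ n \<le> absval \<pi> * absval \<pi> * absval \<pi>" if "n \<ge> 2" for n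
      using br_unif_nth_power_le[OF that] by (simp add: power3_eq_cube)
    have "absval \<pi> * absval \<pi> * absval w ^ 3 \<le> absval \<pi> * absval \<pi> * 1"
      using w(2) by (intro mult_left_mono power_le_one) auto
    then show "absval \<epsilon> \<le> absval \<pi> * absval \<pi>" using \<epsilon> by simp
  qed (use H br_unif_nth_0 br_unif_nth_1 unif_pos unif_lt_1 in auto)
  then obtain t where t: "absval t \<le> absval \<pi>" "lt_smul \<pi> (fps_const t) $ 0 = \<epsilon>" by blast
  have t1: "absval t < 1" using t(1) unif_lt_1 by simp
  \<comment> \<open>If \<open>t\<close> were not smaller, it would be nonzero and the linear term
    would decide: \<open>absval t = absval \<epsilon> / absval \<pi>\<close>, which is below
    \<open>absval w\<close>. The inequality ensures that correcting \<open>w\<close> by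
    \<open>t\<close> does not give 0.\<close>
  have "absval t < absval w"
  proof (rule ccontr)
    assume neg: "\<not> absval t < absval w"
    have t0: "absval t > 0" using neg w0 by (metis absval_pos_iff less_le_trans not_less)
    have "absval (lt_smul \<pi> (fps_const t) $ 0 - br \<pi> $ 1 * t) \<le> absval \<pi> * absval \<pi> * absval t"
    proof (rule absval_series_approx[OF H t1 br_unif_nth_0])
      fix n :: nat assume n: "n \<ge> 2"
      have "absval t ^ (q - 1) \<le> absval \<pi> ^ (q - 1)"
        using t(1) by (intro power_mono) auto
      also have "\<dots> \<le> absval \<pi> ^ 2"
        using q_ge_3 unif_lt_1 by (intro power_decreasing) auto
      finally have "absval t ^ (q - 1) \<le> absval \<pi> ^ 2" .
      then have "max (absval \<pi> * absval t) (absval t ^ (q - 1)) \<le> absval \<pi> * absval \<pi>"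
        using mult_left_mono[OF t(1), of "absval \<pi>"] by (simp add: power2_eq_square)
      then have "max (absval \<pi> * absval t) (absval t ^ (q - 1)) * absval t \<le> absval \<pi> * absval \<pi> * absval t"
        by (rule mult_right_mono) simp
      then show "absval (br \<pi> $ n * t ^ n) \<le> absval \<pi> * absval \<pi> * absval t"
        using br_unif_term_le[OF n, of t] t1 by linarith
    qed
    then have "absval (\<epsilon> - \<pi> * t) \<le> absval \<pi> * absval \<pi> * absval t"
      using t(2) br_unif_nth_1 by simp
    moreover have "absval \<pi> * absval \<pi> * absval t < absval \<pi> * absval t"
      using unif_pos unif_lt_1 t0 by simp
    ultimately have "absval (\<epsilon> - \<pi> * t) < absval (\<pi> * t)" by (simp add: absval_mult)
    then have "absval \<epsilon> = absval \<pi> * absval t"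
      using absval_add_eq[of "\<epsilon> - \<pi> * t" "\<pi> * t"] by (simp add: absval_mult)
    then have "absval \<pi> * absval t \<le> absval \<pi> * (absval \<pi> * absval w ^ 3)" using \<epsilon> by (simp add: mult.assoc)
    then have "absval t \<le> absval \<pi> * absval w ^ 3" using unif_pos by simp
    also have "\<dots> \<le> 1 * absval w ^ 3" using unif_lt_1 by (intro mult_right_mono) auto
    finally show False using w3 neg by simp
  qed
  define z where "z = lt_add (fps_const w) (lt_smul (-1) (fps_const t)) $ 0"
  have m1: "-1 \<in> OK" by (intro OK_ring)
  obtain t' where t': "lt_smul (-1) (fps_const t) = fps_const t'"
    using lt_smul_const[OF m1 t1] by blast
  have t'1: "absval t' < 1"
    using lt_smul_points[OF m1, of "fps_const t"] t1 by (simp add: t')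
  have z: "fps_const z = lt_add (fps_const w) (lt_smul (-1) (fps_const t))"
    unfolding z_def t' using lt_add_const[OF w(2) t'1] by simp
  have z1: "absval z < 1"
    using lt_add_points[of "fps_const w" "fps_const t'"] w(2) t'1 z unfolding t' by (metis const_point)
  have "lt_smul \<pi> (fps_const w) = lt_smul \<pi> (fps_const t)"
    using lt_smul_const[OF unif_OK w(2)] lt_smul_const[OF unif_OK t1] t(2) \<epsilon>_def by metis
  moreover have "lt_smul \<pi> (fps_const z) = lt_add (lt_smul \<pi> (fps_const w)) (lt_smul (-1) (lt_smul \<pi> (fps_const t)))"
    unfolding z using w(2) t1 t'1
    by (simp add: lt_smul_add_right unif_OK lt_smul_points m1 lt_smul_assoc[symmetric] mult.commute)
  ultimately have "lt_smul \<pi> (fps_const z) = 0"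
    using lt_smul_points[OF unif_OK, of "fps_const t"] t1 by (simp add: lt_add_neg)
  then have "z \<in> tors" using z1 by (simp add: tors_iff)
  moreover have "z \<noteq> 0"
  proof
    assume "z = 0"
    then have "lt_add (fps_const w) (lt_smul (-1) (fps_const t)) = 0" using z by simp
    then have "fps_const w = fps_const t"
      by (rule lt_add_neg_eq_0_iff[rotated 2]) (use w(2) t1 in auto)
    then have "w = t" by (metis fps_nth_fps_const)
    then show False using \<open>absval t < absval w\<close> by simp
  qed
  ultimately show ?thesis by blast
qed

lemma tors_smul:
  assumes "z \<in> tors" "a \<in> OK"
  shows "lt_smul a (fps_const z) $ 0 \<in> tors"
    and "lt_smul a (fps_const z) = fps_const (lt_smul a (fps_const z) $ 0)"
proof -
  have z: "absval z < 1" "lt_smul \<pi> (fps_const z) = 0" using assms(1) by (auto simp: tors_iff)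
  show c: "lt_smul a (fps_const z) = fps_const (lt_smul a (fps_const z) $ 0)"
    by (rule lt_smul_const[OF assms(2) z(1)])
  have "lt_smul a (fps_const z) \<in> points" using assms(2) z(1) by (simp add: lt_smul_points)
  then have "absval (lt_smul a (fps_const z) $ 0) < 1" by (simp add: points_def)
  moreover have "lt_smul \<pi> (lt_smul a (fps_const z)) = lt_smul a (lt_smul \<pi> (fps_const z))"
    using assms(2) z(1) by (simp add: lt_smul_assoc[symmetric] unif_OK mult.commute)
  moreover have "lt_smul a 0 = 0"
    using fps_subst_eq_compose[of 0 "br a"] br_nth_0[OF assms(2)] by simp
  ultimately show "lt_smul a (fps_const z) $ 0 \<in> tors"
    using z(2) c by (simp add: tors_iff)
qed

lemma lt_smul_zero_right: "a \<in> OK \<Longrightarrow> lt_smul a 0 = 0"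
  using fps_subst_eq_compose[of 0 "br a"] br_nth_0[of a] by simp

lemma unit_inverse_OK: "a \<in> K \<Longrightarrow> absval a = 1 \<Longrightarrow> inverse a \<in> OK"
  by (simp add: OK_def K_inverse absval_inverse)

lemma lt_smul_inverse:
  assumes "a \<in> K" "absval a = 1" "u \<in> points"
  shows "lt_smul (inverse a) (lt_smul a u) = u"
proof -
  have "a \<noteq> 0" using assms(2) by auto
  then have a: "a \<in> OK" "inverse a \<in> OK" "inverse a * a = 1"
    using assms(1,2) unit_inverse_OK[OF assms(1,2)] by (auto simp: OK_def)
  have "lt_smul (inverse a) (lt_smul a u) = lt_smul (inverse a * a) u"
    by (rule lt_smul_assoc[OF a(2,1) assms(3), symmetric])
  then show ?thesis using a by (simp add: lt_smul_one)
qed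

lemma lt_smul_unit_eq_0:
  assumes "a \<in> K" "absval a = 1" "u \<in> points" "lt_smul a u = 0"
  shows "u = 0"
  using lt_smul_inverse[OF assms(1-3)] assms(4) unit_inverse_OK[OF assms(1,2)]
  by (simp add: lt_smul_zero_right)

lemma lt_smul_diff_eq_0:
  assumes "a \<in> OK" "b \<in> OK" "u \<in> points" "lt_smul a u = lt_smul b u"
  shows "lt_smul (a - b) u = 0"
proof -
  have m: "-1 \<in> OK" by (intro OK_ring)
  have "lt_smul (a + (-1) * b) u = lt_add (lt_smul a u) (lt_smul ((-1) * b) u)"
    using assms m by (intro lt_smul_add_left OK_ring)
  also have "lt_smul ((-1) * b) u = lt_smul (-1) (lt_smul b u)"
    using m assms(2,3) by (rule lt_smul_assoc)
  also have "lt_add (lt_smul a u) (lt_smul (-1) (lt_smul b u)) = 0"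
    unfolding assms(4) using assms(2,3) by (simp add: lt_add_neg lt_smul_points)
  finally show ?thesis by simp
qed

text \<open>At most \<open>q\<close> points, because \<open>br \<pi>\<close> has a unit coefficient
  in degree \<open>q\<close>. At least \<open>q\<close>, because the multiples \<open>[s](z)\<close>
  of a nonzero torsion point by residue representatives are distinct: the difference of two
  representatives is a unit.\<close>

lemma finite_tors: "finite tors" and card_tors: "card tors = q"
proof -
  have "card G \<le> q" if G: "G \<subseteq> tors" "finite G" for G
  proof (rule ccontr)
    assume "\<not> card G \<le> q"
    then have "absval (br \<pi> $ q) < 1"
      using G by (intro many_roots_imp_small_coeffs[of G] br_integral unif_OK) (auto simp: tors_iff)
    then show False using br_unif_nth_q by simp
  qed
  then have fin: "finite tors \<and> card tors \<le> q"
    by (rule finite_if_finite_subsets_card_bdd)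
  then show "finite tors" by simp
  obtain z where z: "z \<in> tors" "z \<noteq> 0" using nonzero_torsion_exists by blast
  have z1: "absval z < 1" using z(1) by (simp add: tors_iff)
  have "q > 0" using q_ge_3 by simp
  then obtain S where "residue_system K S" using residue_system_exists[OF subfield_K] by blast
  note S = residue_systemD[OF this]
  have SO: "s \<in> OK" if "s \<in> S" for s using S(1,4) that by (auto simp: OK_def)
  let ?f = "\<lambda>a. lt_smul a (fps_const z) $ 0"
  have "inj_on ?f S"
  proof (rule inj_onI, rule ccontr)
    fix s t assume st: "s \<in> S" "t \<in> S" "?f s = ?f t" "s \<noteq> t"
    have "lt_smul s (fps_const z) = lt_smul t (fps_const z)"
      using tors_smul(2)[OF z(1) SO[OF st(1)]] tors_smul(2)[OF z(1) SO[OF st(2)]] st(3) by metis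
    then have "lt_smul (s - t) (fps_const z) = 0"
      using SO st z1 by (intro lt_smul_diff_eq_0) auto
    moreover have "s - t \<in> K" using st S(1) by (auto intro: K_diff)
    ultimately have "fps_const z = 0"
      by (rule lt_smul_unit_eq_0[OF _ S(5)[OF st(1,2,4)], rotated 2]) (use z1 in auto)
    then show False using z(2) by simp
  qed
  moreover have "?f ` S \<subseteq> tors" using tors_smul(1)[OF z(1)] SO by auto
  ultimately have "card S \<le> card tors" using fin by (intro card_inj_on_le) auto
  then show "card tors = q" using fin S(3) by simp
qed

text \<open>As \<open>q > 2\<close>, the residue field contains an element other than 0 and
  1.\<close>

lemma unit_minus_one_unit_exists: "\<exists>a\<in>K. absval a = 1 \<and> absval (a - 1) = 1"
proof -
  have "q > 0" using q_ge_3 by simp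
  then obtain S where "residue_system K S" using residue_system_exists[OF subfield_K] by blast
  note S = residue_systemD[OF this]
  obtain x where x: "x \<in> S" "absval (0 - x) < 1" using S(6)[of 0] K_zero by auto
  obtain y where y: "y \<in> S" "absval (1 - y) < 1" using S(6)[of 1] K_one by auto
  have "card {x, y} \<le> 2" by (simp add: card_insert_if)
  then have "card {x, y} < card S" using S(3) q_gt_2 by linarith
  then obtain a where a: "a \<in> S" "a \<notin> {x, y}"
    by (metis card_mono finite.emptyI finite.insertI not_less subsetI)
  have "absval a = 1"
    using S(5)[of a x] a x absval_add_eq[of x "a - x"] by auto
  moreover have "absval (a - 1) = 1"
    using S(5)[of a y] a y absval_add_eq[of "y - 1" "a - y"] by (auto simp: absval_minus_commute)
  ultimately show ?thesis using a(1) S(1) by blast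
qed

sublocale pts: Module.module R pts
  by (rule pts_module)

text \<open>Multiplication by a unit \<open>a\<close> permutes the torsion points, hence
  \<open>[a - 1]\<close> kills their sum, and \<open>a\<close> can be chosen so that
  \<open>a - 1\<close> is a unit.\<close>

lemma sum_tors_eq_0: "finsum pts fps_const tors = 0"
proof -
  obtain a where a: "a \<in> K" "absval a = 1" "absval (a - 1) = 1"
    using unit_minus_one_unit_exists by blast
  have aO: "a \<in> OK" using a by (simp add: OK_def)
  let ?f = "\<lambda>z. lt_smul a (fps_const z) $ 0"
  have Pi: "fps_const \<in> tors \<rightarrow> carrier pts" by (auto simp: tors_iff)
  have "inj_on ?f tors"
  proof (rule inj_onI)
    fix y z assume yz: "y \<in> tors" "z \<in> tors" "?f y = ?f z"
    have "lt_smul a (fps_const y) = lt_smul a (fps_const z)"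
      using tors_smul(2)[OF yz(1) aO] tors_smul(2)[OF yz(2) aO] yz(3) by metis
    moreover have "lt_smul (inverse a) (lt_smul a (fps_const w)) = fps_const w" if "w \<in> tors" for w
      by (rule lt_smul_inverse[OF a(1,2)]) (use that in \<open>simp add: tors_iff\<close>)
    ultimately have "fps_const y = fps_const z" using yz(1,2) by metis
    then show "y = z" by (metis fps_nth_fps_const)
  qed
  moreover have "?f ` tors \<subseteq> tors" using tors_smul(1) aO by auto
  ultimately have im: "?f ` tors = tors" "inj_on ?f tors" using finite_tors by (auto simp: endo_inj_surj)
  have fin: "finsum pts fps_const tors \<in> points" using pts.finsum_closed[OF Pi] by simp
  have "lt_smul a (finsum pts fps_const tors) = finsum pts (\<lambda>z. lt_smul a (fps_const z)) tors"
    using pts.finsum_smult_ldistr[OF finite_tors _ Pi, of a] aO by (simp add: OK_def)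
  also have "\<dots> = finsum pts (\<lambda>z. fps_const (?f z)) tors"
  proof (rule pts.finsum_cong')
    show "(\<lambda>z. fps_const (?f z)) \<in> tors \<rightarrow> carrier pts"
    proof
      fix z assume "z \<in> tors"
      then have "?f z \<in> tors" by (rule tors_smul(1)[OF _ aO])
      then show "fps_const (?f z) \<in> carrier pts" by (simp add: tors_iff)
    qed
  qed (use tors_smul(2)[OF _ aO] in auto)
  also have "\<dots> = finsum pts fps_const (?f ` tors)"
    using Pi im by (intro pts.finsum_reindex[symmetric]) auto
  also have "\<dots> = lt_smul 1 (finsum pts fps_const tors)" using im by (simp add: lt_smul_one)
  finally have "lt_smul (a - 1) (finsum pts fps_const tors) = 0"
    by (rule lt_smul_diff_eq_0[OF aO OK_ring(2) fin])
  then show ?thesis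
    by (rule lt_smul_unit_eq_0[OF K_diff[OF a(1) K_one] a(3) fin])
qed

end

text \<open>Coefficient \<open>n\<close> of \<open>a * l - (l o H) = g\<close> solved for
  \<open>l $ n\<close>, when \<open>H\<close> has linear coefficient \<open>a\<close> and no
  constant term; the diagonal term of \<open>l o H\<close> contributes \<open>a ^ n\<close>. For
  \<open>n = 1\<close> the denominator would be 0, and the value 0 selects the solution without
  linear term.\<close>

fun twisted_coeff :: "'a::Fields.field \<Rightarrow> 'a fps \<Rightarrow> 'a fps \<Rightarrow> nat \<Rightarrow> 'a" where
  "twisted_coeff a H g n = (if n = 1 then 0
     else (g $ n + (\<Sum>k<n. twisted_coeff a H g k * (H ^ k) $ n)) / (a - a ^ n))"

declare twisted_coeff.simps [simp del]

section \<open>Congruences and truncations of power series\<close>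

lemma gauss_le_add: "gauss_le 1 B u \<Longrightarrow> gauss_le 1 B v \<Longrightarrow> gauss_le 1 B (u + v)"
  by (simp add: gauss_le_def absval_add_bound)

lemma gauss_le_diff: "gauss_le 1 B u \<Longrightarrow> gauss_le 1 B v \<Longrightarrow> gauss_le 1 B (u - v)"
  by (simp add: gauss_le_def absval_diff_bound)

lemma gauss_le_integral_mult:
  "u \<in> integral_fps \<Longrightarrow> gauss_le 1 B v \<Longrightarrow> gauss_le 1 B (u * v)"
  using gauss_le_mult[of 1 1 u B v] by (simp add: integral_gauss_le)

lemma gauss_le_power_diff:
  fixes u v :: "'c::nonarch_field fps"
  assumes "u \<in> integral_fps" "v \<in> integral_fps" "gauss_le 1 B (u - v)"
  shows "gauss_le 1 B (u ^ k - v ^ k)"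
  unfolding power_diff_sumr2 mult.commute[of "u - v"]
  using assms by (intro gauss_le_integral_mult integral_sum integral_mult integral_power)

text \<open>Up to degree \<open>n\<close>, \<open>f\<close> differs from its truncation by
  \<open>f $ n * x ^ n\<close>. Only the linear term of \<open>l\<close> sees this: in
  \<open>f ^ k\<close> with \<open>k \<ge> 2\<close> the difference is multiplied by a series
  without constant term.\<close>

lemma compose_cutoff_diff:
  fixes f l :: "'a::comm_ring_1 fps"
  assumes l: "l $ 1 = 1" and f0: "f $ 0 = 0" and n: "n \<ge> 1" and m: "m \<le> n"
  shows "((l oo f) - (l oo fps_cutoff n f)) $ m = (if m = n then f $ n else 0)"
proof -
  define s where "s = fps_shift n f"
  have f: "f - fps_cutoff n f = fps_X ^ n * s"
    by (rule fps_ext) (auto simp: s_def fps_X_power_mult_nth)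
  have c0: "fps_cutoff n f $ 0 = 0" using f0 by simp
  have "(f ^ k - fps_cutoff n f ^ k) $ m = (if m = n \<and> k = 1 then f $ n else 0)" for k
  proof -
    define t where "t = (\<Sum>i<k. fps_cutoff n f ^ (k - Suc i) * f ^ i)"
    have t0: "t $ 0 = (if k = 1 then 1 else 0)"
    proof -
      have "(fps_cutoff n f ^ (k - Suc i) * f ^ i) $ 0 = (if k = 1 then 1 else 0)" if "i < k" for i
        using that f0 c0 by (auto simp: fps_mult_nth_0 fps_power_nth_0 power_0_left)
      then have "t $ 0 = (\<Sum>i<k. if k = 1 then 1 else 0)"
        unfolding t_def fps_sum_nth by (intro sum.cong) auto
      then show ?thesis by auto
    qed
    have "f ^ k - fps_cutoff n f ^ k = fps_X ^ n * (s * t)"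
      unfolding power_diff_sumr2 f t_def by (simp only: mult.assoc)
    then have "(f ^ k - fps_cutoff n f ^ k) $ m = (if m < n then 0 else (s * t) $ (m - n))"
      by (simp add: fps_X_power_mult_nth)
    then show ?thesis using m t0 by (auto simp: fps_mult_nth_0 s_def)
  qed
  then have d: "l $ k * (f ^ k) $ m - l $ k * (fps_cutoff n f ^ k) $ m = (if m = n \<and> k = 1 then l $ k * f $ n else 0)" for k
    by (simp add: right_diff_distrib[symmetric] fps_sub_nth[symmetric] del: fps_sub_nth)
  have "((l oo f) - (l oo fps_cutoff n f)) $ m = (\<Sum>k=0..m. if m = n \<and> k = 1 then l $ k * f $ n else 0)"
    by (simp add: fps_compose_nth sum_subtractf[symmetric] d)
  also have "\<dots> = (if m = n then f $ n else 0)"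
    using n l by (auto simp: sum.delta)
  finally show ?thesis .
qed

context lubin_tate_module
begin

subsection \<open>Series with coefficients in the base field\<close>

definition KF :: "'c fps set" where "KF = {f. \<forall>n. f $ n \<in> K}"

lemma KF_nth: "f \<in> KF \<Longrightarrow> f $ n \<in> K"
  by (simp add: KF_def)

lemma KF_add: "f \<in> KF \<Longrightarrow> g \<in> KF \<Longrightarrow> f + g \<in> KF"
  by (simp add: KF_def K_add)

lemma KF_diff: "f \<in> KF \<Longrightarrow> g \<in> KF \<Longrightarrow> f - g \<in> KF"
  by (simp add: KF_def K_diff)

lemma KF_zero: "0 \<in> KF"
  by (simp add: KF_def K_zero)

lemma KF_const: "fps_const a \<in> KF \<longleftrightarrow> a \<in> K"
  by (auto simp: KF_def K_zero dest: spec[of _ 0])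

lemma KF_mult: "f \<in> KF \<Longrightarrow> g \<in> KF \<Longrightarrow> f * g \<in> KF"
  by (auto simp: KF_def fps_mult_nth intro!: K_sum K_mult)

lemma KF_power: "f \<in> KF \<Longrightarrow> f ^ n \<in> KF"
proof (induction n)
  case 0
  have "1 = fps_const (1 :: 'c)" by simp
  then show ?case using KF_const K_one by (metis power_0)
qed (simp add: KF_mult)

lemma KF_X: "fps_X \<in> KF"
  by (auto simp: KF_def fps_X_nth K_zero K_one)

lemma KF_br: "a \<in> OK \<Longrightarrow> br a \<in> KF"
  using br_nth_OK by (auto simp: KF_def OK_def)

lemma KF_lam: "lam \<in> KF"
  by (simp add: KF_def lam_nth_K)

lemma KF_subst:
  assumes "f \<in> KF" "convergent_on_disc f" "u \<in> KF" "u \<in> points"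
  shows "fps_subst f u \<in> KF"
  unfolding KF_def
proof safe
  fix n
  have "(fps_const (f $ k) * u ^ k) $ n \<in> K" for k
    using assms KF_power[of u k] by (simp add: KF_def K_mult)
  then show "fps_subst f u $ n \<in> K"
    by (rule K_has_sum[OF fps_has_sumD[OF fps_subst_has_sum[OF assms(2,4)]]])
qed

lemma KF_lt_add:
  assumes "u \<in> KF" "u \<in> points" "v \<in> KF" "v \<in> points"
  shows "lt_add u v \<in> KF"
  unfolding KF_def
proof safe
  fix n
  have "(case x of (i, j) \<Rightarrow> fps_const (F $ i $ j) * (u ^ i * v ^ j)) $ n \<in> K" for x
    using KF_mult[OF KF_power[OF assms(1)] KF_power[OF assms(3)]] F_nth_OK
    by (auto simp: KF_def OK_def split: prod.split intro!: K_mult)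
  then show "lt_add u v $ n \<in> K"
    by (rule K_has_sum[OF fps_has_sumD[OF fps_subst2_has_sum[OF F_integral assms(2,4)]]])
qed

lemma KF_lt_smul: "a \<in> OK \<Longrightarrow> u \<in> KF \<Longrightarrow> u \<in> points \<Longrightarrow> lt_smul a u \<in> KF"
  by (intro KF_subst KF_br integral_convergent br_integral)

lemma int_fps_iff: "f \<in> int_fps K \<longleftrightarrow> f \<in> KF \<and> f \<in> integral_fps"
  by (auto simp: int_fps_def KF_def integral_fps_def)

lemma scaled_int_fps_iff: "g \<in> scaled_int_fps K \<pi> \<longleftrightarrow> g \<in> KF \<and> gauss_le 1 (absval \<pi>) g"
proof
  assume "g \<in> scaled_int_fps K \<pi>"
  then obtain h where h: "g = fps_const \<pi> * h" "h \<in> int_fps K" by (auto simp: scaled_int_fps_def)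
  then show "g \<in> KF \<and> gauss_le 1 (absval \<pi>) g"
    using unif_K by (auto simp: int_fps_iff KF_const gauss_le_def absval_mult integral_fps_def
        intro!: KF_mult mult_left_le)
next
  assume g: "g \<in> KF \<and> gauss_le 1 (absval \<pi>) g"
  have "g = fps_const \<pi> * (fps_const (inverse \<pi>) * g)"
    using unif_nonzero by (simp add: mult.assoc[symmetric])
  moreover have "fps_const (inverse \<pi>) * g \<in> int_fps K"
    unfolding int_fps_iff
  proof
    show "fps_const (inverse \<pi>) * g \<in> KF"
      using g by (intro KF_mult) (simp_all add: KF_const K_inverse unif_K)
    have "gauss_le 1 (inverse (absval \<pi>) * absval \<pi>) (fps_const (inverse \<pi>) * g)"
      using g by (intro gauss_le_mult gauss_le_const) (simp_all add: absval_inverse)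
    then show "fps_const (inverse \<pi>) * g \<in> integral_fps"
      using unif_nonzero by (simp add: integral_gauss_le)
  qed
  ultimately show "g \<in> scaled_int_fps K \<pi>" unfolding scaled_int_fps_def mem_Collect_eq by blast
qed

subsection \<open>Frobenius congruences\<close>

text \<open>The middle binomial coefficients are small by \<open>residue_binomial\<close>, hence
  divisible by \<open>\<pi>\<close> since they lie in \<open>K\<close>.\<close>

lemma frobenius_add:
  fixes a b :: "'c fps"
  assumes "a \<in> integral_fps" "b \<in> integral_fps"
  shows "gauss_le 1 (absval \<pi>) ((a + b) ^ q - (a ^ q + b ^ q))"
proof -
  have "{..q} = insert 0 (insert q {0<..<q})" using q_ge_3 by auto
  then have eq: "(a + b) ^ q - (a ^ q + b ^ q) =
      (\<Sum>k\<in>{0<..<q}. of_nat (q choose k) * a ^ k * b ^ (q - k))"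
    using q_ge_3 by (simp add: binomial_ring)
  have "gauss_le 1 (absval \<pi>) (of_nat (q choose k) * a ^ k * b ^ (q - k))" if "k \<in> {0<..<q}" for k
  proof -
    have "absval (of_nat (q choose k) :: 'c) < 1"
      using that q_ge_3 by (intro residue_binomial[OF subfield_K]) auto
    then have "absval (of_nat (q choose k) :: 'c) \<le> absval \<pi>"
      by (intro absval_le_unif K_of_nat)
    then have "gauss_le 1 (absval \<pi>) (of_nat (q choose k) :: 'c fps)"
      unfolding fps_of_nat[symmetric] by (rule gauss_le_const)
    then have "gauss_le 1 (absval \<pi>) (b ^ (q - k) * (a ^ k * of_nat (q choose k)))"
      using assms by (intro gauss_le_integral_mult integral_power)
    then show ?thesis by (simp add: mult_ac)
  qed
  then show ?thesis
    unfolding eq by (auto simp: gauss_le_def fps_sum_nth intro!: absval_sum_le)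
qed

lemma X_power_q_point: "fps_X ^ q \<in> points"
  using q_ge_3 integral_power[OF points_integral[OF fps_X_point], of q]
  by (simp add: points_def integral_fps_def fps_X_power_nth)

text \<open>Splitting \<open>f\<close> as \<open>f $ 0 + x * g\<close> makes \<open>f ^ q\<close>
  congruent to \<open>(f $ 0) ^ q + x ^ q * g ^ q\<close>, and Fermat handles the constant. The
  congruence for \<open>g\<close> is needed only in degrees lower by \<open>q\<close>, so the
  induction runs over the degree.\<close>

lemma frobenius_cong_upto:
  assumes "f \<in> KF" "f \<in> integral_fps" "m < n"
  shows "absval ((f ^ q - (f oo fps_X ^ q)) $ m) \<le> absval \<pi>"
  using assms
proof (induction n arbitrary: f m)
  case (Suc n)
  define g where "g = fps_shift 1 f"
  have g: "g \<in> KF" "g \<in> integral_fps" using Suc.prems by (auto simp: g_def KF_def integral_fps_def)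
  have q0: "(fps_X ^ q :: 'c fps) $ 0 = 0" using q_ge_3 by (simp add: fps_X_power_nth)
  have f: "f = fps_const (f $ 0) + fps_X * g"
    by (rule fps_ext) (auto simp: g_def)
  let ?E = "(fps_const (f $ 0) + fps_X * g) ^ q - (fps_const (f $ 0) ^ q + (fps_X * g) ^ q)"
  have E: "gauss_le 1 (absval \<pi>) ?E"
    using Suc.prems g points_integral[OF fps_X_point]
    by (intro frobenius_add integral_mult) (auto simp: integral_fps_def)
  have "f oo fps_X ^ q = fps_const (f $ 0) + fps_X ^ q * (g oo fps_X ^ q)"
    by (subst (1) f) (simp only: fps_compose_add_distrib fps_compose_mult_distrib[OF q0]
        fps_const_compose fps_X_fps_compose_startby0[OF q0])
  then have "f ^ q - (f oo fps_X ^ q) = (fps_const (f $ 0) + fps_X * g) ^ q -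
      (fps_const (f $ 0) + fps_X ^ q * (g oo fps_X ^ q))"
    using f by simp
  also have "\<dots> = ?E + fps_const ((f $ 0) ^ q - f $ 0) + fps_X ^ q * (g ^ q - (g oo fps_X ^ q))"
    by (simp add: power_mult_distrib fps_const_power algebra_simps flip: fps_const_sub)
  finally have eq: "f ^ q - (f oo fps_X ^ q) =
      ?E + fps_const ((f $ 0) ^ q - f $ 0) + fps_X ^ q * (g ^ q - (g oo fps_X ^ q))" .
  have "absval ((f $ 0) ^ q - f $ 0) \<le> absval \<pi>"
    using Suc.prems q_ge_3
    by (intro absval_le_unif K_diff K_power KF_nth residue_fermat[OF subfield_K])
      (auto simp: integral_fps_def)
  then have 2: "absval (fps_const ((f $ 0) ^ q - f $ 0) $ m) \<le> absval \<pi>"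
    by (cases m) auto
  have 3: "absval ((fps_X ^ q * (g ^ q - (g oo fps_X ^ q))) $ m) \<le> absval \<pi>"
  proof (cases "m < q")
    case False
    then have "m - q < n" using Suc.prems q_ge_3 by linarith
    then show ?thesis using Suc.IH[OF g] False by (simp add: fps_X_power_mult_nth del: fps_sub_nth)
  qed (simp add: fps_X_power_mult_nth del: fps_sub_nth)
  have 1: "absval (?E $ m) \<le> absval \<pi>" using E by (simp add: gauss_le_def)
  show ?case
    unfolding eq fps_add_nth[of "?E + fps_const ((f $ 0) ^ q - f $ 0)"] fps_add_nth[of ?E]
    by (intro absval_add_bound 1 2 3)
qed simp

lemma gauss_le_subst:
  fixes f u :: "'c fps"
  assumes "f \<in> integral_fps" "gauss_le 1 B f" "u \<in> points" "B \<ge> 0"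
  shows "gauss_le 1 B (fps_subst f u)"
proof (rule fps_has_sum_gauss_le[OF fps_subst_has_sum])
  fix k
  have "gauss_le 1 B (u ^ k * fps_const (f $ k))"
    using assms by (intro gauss_le_integral_mult integral_power points_integral gauss_le_const)
      (auto simp: gauss_le_def)
  then show "gauss_le 1 B (fps_const (f $ k) * u ^ k)" by (simp add: mult.commute)
qed (use assms in \<open>auto simp: integral_convergent\<close>)

lemma gauss_le_subst_diff:
  fixes f u v :: "'c fps"
  assumes "f \<in> integral_fps" "u \<in> points" "v \<in> points" "gauss_le 1 B (u - v)" "B \<ge> 0"
  shows "gauss_le 1 B (fps_subst f u - fps_subst f v)"
proof -
  have c: "convergent_on_disc f" using assms(1) by (rule integral_convergent)
  have "fps_has_sum (\<lambda>k. fps_const (f $ k) * u ^ k + (-1) * (fps_const (f $ k) * v ^ k)) UNIV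
      (fps_subst f u + (-1) * fps_subst f v)"
    by (intro fps_has_sum_add fps_has_sum_cmult fps_subst_has_sum c assms)
  then have "gauss_le 1 B (fps_subst f u + (-1) * fps_subst f v)"
  proof (rule fps_has_sum_gauss_le)
    fix k
    have c: "fps_const (f $ k) \<in> integral_fps" using assms(1) by (simp add: integral_fps_def)
    have "gauss_le 1 B (fps_const (f $ k) * (u ^ k - v ^ k))"
      using assms by (intro gauss_le_integral_mult[OF c] gauss_le_power_diff points_integral)
    then show "gauss_le 1 B (fps_const (f $ k) * u ^ k + (-1) * (fps_const (f $ k) * v ^ k))"
      by (simp add: algebra_simps)
  qed (use assms in auto)
  then show ?thesis by simp
qed

lemma gauss_le_lt_add_diff:
  assumes "u \<in> points" "v \<in> points" "w \<in> points" "gauss_le 1 B (u - v)" "B \<ge> 0"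
  shows "gauss_le 1 B (lt_add u w - lt_add v w)"
proof -
  let ?t = "\<lambda>u x. case x of (i, j) \<Rightarrow> fps_const (F $ i $ j) * (u ^ i * w ^ j)"
  have "fps_has_sum (\<lambda>x. ?t u x + (-1) * ?t v x) UNIV (lt_add u w + (-1) * lt_add v w)"
    by (intro fps_has_sum_add fps_has_sum_cmult fps_subst2_has_sum F_integral assms)
  then have "gauss_le 1 B (lt_add u w + (-1) * lt_add v w)"
  proof (rule fps_has_sum_gauss_le)
    fix x :: "nat \<times> nat"
    obtain i j where x: "x = (i, j)" by (cases x)
    have c: "fps_const (F $ i $ j) \<in> integral_fps"
      using integral_fps2_nth2[OF F_integral, of i j] by (simp add: integral_fps_def)
    have "gauss_le 1 B ((fps_const (F $ i $ j) * w ^ j) * (u ^ i - v ^ i))"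
      using assms c
      by (intro gauss_le_integral_mult integral_mult[OF c] integral_power gauss_le_power_diff points_integral)
    then show "gauss_le 1 B (?t u x + (-1) * ?t v x)"
      by (simp add: x algebra_simps)
  qed (use assms in auto)
  then show ?thesis by simp
qed

text \<open>Modulo \<open>\<pi>\<close>, \<open>[\<pi>](f)\<close> is \<open>f ^ q\<close>, which is
  \<open>f(x ^ q)\<close> by the Frobenius congruence, which is \<open>f([\<pi>](x))\<close>.
  Coefficients in \<open>K\<close> are required for the middle step.\<close>

lemma lt_smul_unif_cong:
  assumes "f \<in> KF" "f \<in> points"
  shows "gauss_le 1 (absval \<pi>) (lt_smul \<pi> f - fps_subst f (br \<pi>))"
proof -
  let ?E = "br \<pi> - fps_X ^ q"
  have E: "gauss_le 1 (absval \<pi>) ?E"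
    using br_unif_cong by (auto simp: gauss_le_def fps_X_power_nth)
  have Xq: "(fps_X ^ q :: 'c fps) \<in> integral_fps" using X_power_q_point by (rule points_integral)
  have Ei: "?E \<in> integral_fps"
    using E unif_lt_1 unfolding integral_gauss_le by (auto intro: gauss_le_mono)
  have "lt_smul \<pi> f = fps_subst (fps_X ^ q) f + fps_subst ?E f"
    using fps_subst_add[of "fps_X ^ q" ?E f] Xq Ei assms(2) by (simp add: integral_convergent)
  moreover have "fps_subst (fps_X ^ q) f = f ^ q"
    using fps_subst_power[OF points_integral[OF fps_X_point] assms(2), of q] by simp
  moreover have "fps_subst f (fps_X ^ q) = f oo fps_X ^ q"
    using q_ge_3 by (intro fps_subst_eq_compose) (simp add: fps_X_power_nth)
  ultimately have eq: "lt_smul \<pi> f - fps_subst f (br \<pi>) = (f ^ q - (f oo fps_X ^ q)) +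
      fps_subst ?E f - (fps_subst f (br \<pi>) - fps_subst f (fps_X ^ q))"
    by simp
  have "gauss_le 1 (absval \<pi>) (f ^ q - (f oo fps_X ^ q))"
    unfolding gauss_le_def
    using frobenius_cong_upto[OF assms(1) points_integral[OF assms(2)] lessI] by simp
  moreover have "gauss_le 1 (absval \<pi>) (fps_subst ?E f)"
    using Ei E assms(2) by (intro gauss_le_subst) auto
  moreover have "gauss_le 1 (absval \<pi>) (fps_subst f (br \<pi>) - fps_subst f (fps_X ^ q))"
    using E assms(2) X_power_q_point unif_OK
    by (intro gauss_le_subst_diff points_integral br_point) auto
  ultimately show ?thesis unfolding eq by (rule gauss_le_diff[OF gauss_le_add])
qed

text \<open>By \<open>lam_nth_scaled_le\<close> each \<open>lam $ k * \<pi> ^ k\<close> is divisible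
  by \<open>\<pi>\<close>.\<close>

lemma Lam_gauss_le:
  assumes "u \<in> points" "gauss_le 1 (absval \<pi>) u"
  shows "gauss_le 1 (absval \<pi>) (Lam u)"
proof (rule fps_has_sum_gauss_le[OF fps_subst_has_sum[OF lam_convergent assms(1)]])
  fix k :: nat
  have P: "absval \<pi> ^ 2 \<le> absval \<pi>"
    using power_decreasing[of 1 2 "absval \<pi>"] unif_lt_1 by simp
  consider "k = 0" | "k = 1" | "k \<ge> 2" by linarith
  then have "absval (lam $ k) * absval \<pi> ^ k \<le> absval \<pi>"
    by cases (use lam_nth_0 lam_nth_1 lam_nth_scaled_le[of k] P in auto)
  moreover have "gauss_le 1 (absval (lam $ k) * absval \<pi> ^ k) (fps_const (lam $ k) * u ^ k)"
    using assms(2) by (intro gauss_le_mult gauss_le_const gauss_le_power) auto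
  ultimately show "gauss_le 1 (absval \<pi>) (fps_const (lam $ k) * u ^ k)"
    by (rule gauss_le_mono[rotated])
qed auto

subsection \<open>The modules of the exact sequence\<close>

abbreviation lt_trace :: "'c fps \<Rightarrow> 'c fps" where
  "lt_trace f \<equiv> finsum pts (lt_translate F f) tors"

abbreviation translate_sum :: "'c fps \<Rightarrow> 'c fps" where
  "translate_sum g \<equiv> (\<Sum>z\<in>tors. lt_translate F g z)"

abbreviation H :: "'c fps" where "H \<equiv> br \<pi>"

definition c_q :: 'c where "c_q = of_nat q / \<pi>"

lemma c_q_OK: "c_q \<in> OK" and c_q_unif: "c_q * \<pi> = of_nat q"
proof -
  \<comment> \<open>The integer \<open>q\<close> is the binomial coefficient
    \<open>q choose 1\<close>.\<close>
  have "absval (of_nat q :: 'c) < 1"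
    using residue_binomial[OF subfield_K, of 1] q_ge_3 by simp
  then have "absval (of_nat q :: 'c) \<le> absval \<pi>" by (intro absval_le_unif K_of_nat)
  then show "c_q \<in> OK"
    using unif_pos by (simp add: OK_def c_q_def K_divide K_of_nat unif_K absval_divide)
  show "c_q * \<pi> = of_nat q" using unif_nonzero by (simp add: c_q_def)
qed

lemma H_point: "H \<in> points"
  by (rule br_point[OF unif_OK])

lemma translation_point: "z \<in> tors \<Longrightarrow> lt_add fps_X (fps_const z) \<in> points"
  by (intro lt_add_points) (auto simp: tors_iff)

lemma H_translation:
  assumes "z \<in> tors"
  shows "fps_subst H (lt_add fps_X (fps_const z)) = H"
proof -
  have "fps_subst H (lt_add fps_X (fps_const z)) = lt_add (lt_smul \<pi> fps_X) (lt_smul \<pi> (fps_const z))"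
    using assms by (intro lt_smul_add_right unif_OK) (auto simp: tors_iff)
  also have "\<dots> = lt_add 0 H"
    using assms H_point by (simp add: tors_iff lt_add_commute[of H 0])
  finally show ?thesis using H_point by (simp add: lt_add_zero_left)
qed

lemma lt_translate_points: "f \<in> points \<Longrightarrow> z \<in> tors \<Longrightarrow> lt_translate F f z \<in> points"
  unfolding lt_translate_def by (intro fps_subst_points translation_point)

lemma lt_translate_Pi: "f \<in> points \<Longrightarrow> lt_translate F f \<in> tors \<rightarrow> carrier pts"
  by (auto simp: lt_translate_points)

lemma lt_trace_points: "f \<in> points \<Longrightarrow> lt_trace f \<in> points"
  using pts.finsum_closed[OF lt_translate_Pi] by simp

lemma lt_trace_add:
  assumes "f \<in> points" "g \<in> points"
  shows "lt_trace (lt_add f g) = lt_add (lt_trace f) (lt_trace g)"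
proof -
  have "lt_trace (lt_add f g) = finsum pts (\<lambda>z. lt_translate F f z \<oplus>\<^bsub>pts\<^esub> lt_translate F g z) tors"
    using assms lt_translate_points
    by (intro pts.finsum_cong')
      (auto simp: lt_translate_def fps_subst_of_subst2 F_integral translation_point lt_add_points
        fps_subst_points)
  also have "\<dots> = lt_trace f \<oplus>\<^bsub>pts\<^esub> lt_trace g"
    using assms by (intro pts.finsum_addf lt_translate_Pi)
  finally show ?thesis by simp
qed

lemma lt_trace_smul:
  assumes "a \<in> OK" "f \<in> points"
  shows "lt_trace (lt_smul a f) = lt_smul a (lt_trace f)"
proof -
  have "lt_trace (lt_smul a f) = finsum pts (\<lambda>z. a \<odot>\<^bsub>pts\<^esub> lt_translate F f z) tors"
    using assms lt_translate_points[OF assms(2)]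
    by (intro pts.finsum_cong')
      (auto simp: lt_translate_def fps_subst_assoc integral_convergent br_integral translation_point
        lt_smul_points fps_subst_points br_point)
  also have "\<dots> = a \<odot>\<^bsub>pts\<^esub> lt_trace f"
    using assms finite_tors carrier_R
    by (intro pts.finsum_smult_ldistr[symmetric] lt_translate_Pi) auto
  finally show ?thesis by simp
qed

lemma A_set_iff:
  "f \<in> A_set K \<pi> F br \<longleftrightarrow> f \<in> points \<and> f \<in> KF \<and> lt_trace f = lt_smul c_q (fps_subst f H)"
proof -
  have "f oo H = fps_subst f H"
    by (simp add: fps_subst_eq_compose br_unif_nth_0)
  then show ?thesis
    by (auto simp: A_set_def int_fps_iff points_def integral_fps_def tors_def c_q_def)
qed

lemma pts_a_inv: "u \<in> points \<Longrightarrow> \<ominus>\<^bsub>pts\<^esub> u = lt_smul (-1) u"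
  by (rule pts.M.minus_equality) (auto simp: lt_add_neg lt_smul_points OK_ring)

lemma End_submodule: "submodule (End_set K br) R pts"
proof (rule pts.submoduleI)
  have E: "End_set K br = br ` OK" by (simp only: End_set_def carrier_R)
  have pts: "br a \<in> points" if "a \<in> OK" for a using that by (rule br_point)
  show "End_set K br \<subseteq> carrier pts" using pts by (auto simp: E)
  show "\<zero>\<^bsub>pts\<^esub> \<in> End_set K br"
    using OK_ring(1) br_zero unfolding E by (metis image_eqI pts_simps(2))
  show smul: "a \<odot>\<^bsub>pts\<^esub> x \<in> End_set K br" if "a \<in> carrier R" "x \<in> End_set K br" for a x
  proof -
    obtain b where b: "b \<in> OK" "x = br b" using \<open>x \<in> End_set K br\<close> E by auto
    have a: "a \<in> OK" using \<open>a \<in> carrier R\<close> by (simp add: OK_def)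
    have "lt_smul a (br b) = br (a * b)"
      using lt_smul_assoc[OF a b(1) fps_X_point] by simp
    then show ?thesis using b a OK_ring(4) by (auto simp: E)
  qed
  show "\<ominus>\<^bsub>pts\<^esub> a \<in> End_set K br" if "a \<in> End_set K br" for a
  proof -
    have "-1 \<in> carrier R" unfolding carrier_R by (intro OK_ring)
    then have "(-1) \<odot>\<^bsub>pts\<^esub> a \<in> End_set K br" using that by (rule smul)
    moreover have "a \<in> points" using that pts by (auto simp: E)
    ultimately show ?thesis by (simp add: pts_a_inv)
  qed
  show "a \<oplus>\<^bsub>pts\<^esub> b \<in> End_set K br" if "a \<in> End_set K br" "b \<in> End_set K br" for a b
    using that OK_ring(3) by (auto simp: E br_add[symmetric])
qed

lemma A_submodule: "submodule (A_set K \<pi> F br) R pts"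
proof (rule pts.submoduleI)
  show "A_set K \<pi> F br \<subseteq> carrier pts" by (auto simp: A_set_iff)
  show smul: "a \<odot>\<^bsub>pts\<^esub> x \<in> A_set K \<pi> F br" if "a \<in> carrier R" "x \<in> A_set K \<pi> F br" for a x
  proof -
    have a: "a \<in> OK" using that(1) by (simp add: OK_def)
    have x: "x \<in> points" "x \<in> KF" "lt_trace x = lt_smul c_q (fps_subst x H)"
      using that(2) by (auto simp: A_set_iff)
    have "lt_smul a (lt_smul c_q (fps_subst x H)) = lt_smul c_q (lt_smul a (fps_subst x H))"
      using lt_smul_assoc[OF a c_q_OK] lt_smul_assoc[OF c_q_OK a] fps_subst_points[OF x(1) H_point]
      by (metis mult.commute)
    also have "lt_smul a (fps_subst x H) = fps_subst (lt_smul a x) H"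
      using a x H_point by (intro fps_subst_assoc integral_convergent br_integral)
    finally show ?thesis
      using a x by (simp add: A_set_iff lt_smul_points KF_lt_smul lt_trace_smul)
  qed
  show "\<zero>\<^bsub>pts\<^esub> \<in> A_set K \<pi> F br"
  proof -
    have "lt_trace 0 = lt_smul 0 (lt_trace 0)"
      using lt_trace_smul[OF OK_ring(1), of 0] by (simp add: lt_smul_zero_left)
    then show ?thesis
      by (simp add: A_set_iff KF_zero lt_smul_zero_right c_q_OK lt_smul_zero_left)
  qed
  show "\<ominus>\<^bsub>pts\<^esub> a \<in> A_set K \<pi> F br" if "a \<in> A_set K \<pi> F br" for a
    using smul[of "-1" a] that OK_ring(2,5) carrier_R by (auto simp: A_set_iff pts_a_inv)
  show "x \<oplus>\<^bsub>pts\<^esub> y \<in> A_set K \<pi> F br" if "x \<in> A_set K \<pi> F br" "y \<in> A_set K \<pi> F br" for x y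
  proof -
    have x: "x \<in> points" "x \<in> KF" "lt_trace x = lt_smul c_q (fps_subst x H)"
      and y: "y \<in> points" "y \<in> KF" "lt_trace y = lt_smul c_q (fps_subst y H)"
      using that by (auto simp: A_set_iff)
    have "lt_trace (lt_add x y) = lt_smul c_q (lt_add (fps_subst x H) (fps_subst y H))"
      using x y H_point by (simp add: lt_trace_add lt_smul_add_right c_q_OK fps_subst_points)
    also have "lt_add (fps_subst x H) (fps_subst y H) = fps_subst (lt_add x y) H"
      using x y H_point by (simp add: fps_subst_of_subst2 F_integral)
    finally show ?thesis using x y by (simp add: A_set_iff lt_add_points KF_lt_add)
  qed
qed

lemma finsum_const:
  assumes "finite B" "u \<in> points"
  shows "finsum pts (\<lambda>_. u) B = lt_smul (of_nat (card B)) u"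
  using assms(1)
proof (induction B rule: finite_induct)
  case empty
  then show ?case by (simp add: lt_smul_zero_left)
next
  case (insert b B)
  have "finsum pts (\<lambda>_. u) (insert b B) = lt_add u (lt_smul (of_nat (card B)) u)"
    using insert assms(2) by (subst pts.finsum_insert) auto
  also have "\<dots> = lt_smul (1 + of_nat (card B)) u"
    using assms(2) by (simp add: lt_smul_add_left OK_ring OK_of_nat lt_smul_one)
  finally show ?case using insert.hyps by simp
qed

text \<open>The translates of \<open>x\<close> add up to \<open>[q](x)\<close> plus the sum of the
  torsion points, which is 0, and \<open>[q]\<close> is \<open>[q / \<pi>]\<close> after
  \<open>[\<pi>]\<close>. Since \<open>A_set\<close> is a submodule, it then contains all of
  \<open>End_set\<close>.\<close>

lemma X_in_A_set: "fps_X \<in> A_set K \<pi> F br"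
proof -
  have "lt_trace fps_X = finsum pts (\<lambda>z. fps_X \<oplus>\<^bsub>pts\<^esub> fps_const z) tors"
    by (intro pts.finsum_cong') (auto simp: lt_translate_def translation_point)
  also have "\<dots> = finsum pts (\<lambda>_. fps_X) tors \<oplus>\<^bsub>pts\<^esub> finsum pts fps_const tors"
    by (intro pts.finsum_addf) (auto simp: tors_iff)
  also have "\<dots> = lt_add (lt_smul (of_nat q) fps_X) 0"
    by (simp add: finsum_const finite_tors card_tors sum_tors_eq_0)
  also have "\<dots> = lt_smul (c_q * \<pi>) fps_X"
    using br_point[OF OK_of_nat, of q] by (simp add: lt_add_commute[of _ 0] lt_add_zero_left c_q_unif)
  also have "\<dots> = lt_smul c_q H"
    using lt_smul_assoc[OF c_q_OK unif_OK fps_X_point] by simp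
  finally show ?thesis by (simp add: A_set_iff KF_X)
qed

lemma End_subset_A: "End_set K br \<subseteq> A_set K \<pi> F br"
proof
  fix f assume "f \<in> End_set K br"
  then obtain a where a: "a \<in> carrier R" "f = br a" by (auto simp only: End_set_def)
  have "a \<odot>\<^bsub>pts\<^esub> fps_X \<in> A_set K \<pi> F br"
    using pts.submoduleE(4)[OF A_submodule a(1) X_in_A_set] .
  then show "f \<in> A_set K \<pi> F br" using a by simp
qed

subsection \<open>The map to the kernel of the trace\<close>

definition log_phi :: "'c fps \<Rightarrow> 'c fps" where
  "log_phi f = fps_subst lam (lt_phi \<pi> F br f)"

lemma lt_phi_eq: "lt_phi \<pi> F br f = lt_add (lt_smul \<pi> f) (lt_smul (-1) (fps_subst f H))"
  by (simp add: lt_phi_def lt_minus_def fps_subst_eq_compose br_unif_nth_0)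

lemma lt_phi_points: "f \<in> points \<Longrightarrow> lt_phi \<pi> F br f \<in> points"
  unfolding lt_phi_eq
  by (intro lt_add_points lt_smul_points fps_subst_points H_point unif_OK OK_ring)

lemma log_phi_eq:
  assumes "f \<in> points"
  shows "log_phi f = fps_const \<pi> * Lam f - fps_subst (Lam f) H"
proof -
  have m: "-1 \<in> OK" by (intro OK_ring)
  have "log_phi f = fps_const \<pi> * Lam f + fps_const (-1) * Lam (fps_subst f H)"
    unfolding log_phi_def lt_phi_eq using assms m
    by (subst Lam_add) (simp_all add: Lam_smul lt_smul_points fps_subst_points H_point unif_OK)
  also have "fps_const (-1 :: 'c) = -1" by (simp flip: fps_const_neg)
  finally show ?thesis using assms by (simp add: Lam_subst H_point)
qed

lemma log_phi_add:
  assumes "f \<in> points" "g \<in> points"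
  shows "log_phi (lt_add f g) = log_phi f + log_phi g"
  using assms
  by (simp add: log_phi_eq lt_add_points Lam_add fps_subst_add Lam_convergent H_point algebra_simps)

lemma log_phi_smul:
  assumes "a \<in> OK" "f \<in> points"
  shows "log_phi (lt_smul a f) = fps_const a * log_phi f"
  using assms
  by (simp add: log_phi_eq lt_smul_points Lam_smul fps_subst_cmult Lam_convergent H_point algebra_simps)

lemma log_phi_scaled:
  assumes "f \<in> points" "f \<in> KF"
  shows "log_phi f \<in> KF" "gauss_le 1 (absval \<pi>) (log_phi f)"
proof -
  have m: "-1 \<in> OK" by (intro OK_ring)
  define u v where "u = lt_smul \<pi> f" and "v = fps_subst f H"
  have u: "u \<in> points" "u \<in> KF" and v: "v \<in> points" "v \<in> KF"
    unfolding u_def v_def using assms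
    by (auto intro!: lt_smul_points fps_subst_points H_point unif_OK KF_lt_smul KF_subst
        integral_convergent points_integral KF_br)
  \<comment> \<open>Formal addition preserves congruences, so the formal difference of
    \<open>u\<close> and \<open>v\<close> is congruent to that of \<open>v\<close> with itself,
    which is 0.\<close>
  have "gauss_le 1 (absval \<pi>) (lt_add u (lt_smul (-1) v) - lt_add v (lt_smul (-1) v))"
    using lt_smul_unif_cong[OF assms(2,1)] u v m
    by (intro gauss_le_lt_add_diff lt_smul_points) (auto simp: u_def v_def)
  then have "gauss_le 1 (absval \<pi>) (lt_phi \<pi> F br f)"
    using v by (simp add: lt_add_neg lt_phi_eq u_def v_def)
  then show "gauss_le 1 (absval \<pi>) (log_phi f)"
    unfolding log_phi_def by (intro Lam_gauss_le lt_phi_points assms)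
  have "lt_phi \<pi> F br f \<in> KF"
    unfolding lt_phi_eq u_def[symmetric] v_def[symmetric]
    using u v m by (intro KF_lt_add KF_lt_smul lt_smul_points)
  then show "log_phi f \<in> KF"
    unfolding log_phi_def by (intro KF_subst KF_lam lam_convergent lt_phi_points assms)
qed

lemma Lam_finsum:
  assumes "finite B" "g \<in> B \<rightarrow> points"
  shows "Lam (finsum pts g B) = (\<Sum>z\<in>B. Lam (g z))"
  using assms
proof (induction B rule: finite_induct)
  case empty
  then show ?case by (simp add: fps_subst_eq_compose lam_nth_0)
next
  case (insert b B)
  have "finsum pts g B \<in> points" using pts.finsum_closed[of g B] insert.prems by auto
  then show ?case using insert by (simp add: Pi_iff Lam_add)
qed

lemma fps_subst_translation_H:
  assumes "convergent_on_disc l" "z \<in> tors"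
  shows "lt_translate F (fps_subst l H) z = fps_subst l H"
  unfolding lt_translate_def
  using fps_subst_assoc[OF assms(1) H_point translation_point[OF assms(2)]] H_translation[OF assms(2)]
  by simp

lemma translate_sum_log_phi:
  assumes f: "f \<in> points"
  shows "translate_sum (log_phi f) = fps_const \<pi> * (Lam (lt_trace f) - Lam (lt_smul c_q (fps_subst f H)))"
proof -
  let ?l = "Lam f"
  have c: "convergent_on_disc ?l" using f by (rule Lam_convergent)
  have cH: "convergent_on_disc (fps_subst ?l H)" using c H_point by (rule fps_subst_convergent)
  have "lt_translate F (log_phi f) z = fps_const \<pi> * Lam (lt_translate F f z) - fps_subst ?l H"
    if z: "z \<in> tors" for z
  proof -
    have w: "lt_add fps_X (fps_const z) \<in> points" using z by (rule translation_point)
    have "lt_translate F (log_phi f) z = fps_const \<pi> * lt_translate F ?l z - lt_translate F (fps_subst ?l H) z"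
      unfolding lt_translate_def log_phi_eq[OF f]
      using w c cH by (simp add: fps_subst_diff fps_subst_cmult convergent_cmult)
    also have "lt_translate F ?l z = Lam (lt_translate F f z)"
      unfolding lt_translate_def using f w by (rule Lam_subst[symmetric])
    finally show ?thesis using fps_subst_translation_H[OF c z] by simp
  qed
  then have "translate_sum (log_phi f) = fps_const \<pi> * (\<Sum>z\<in>tors. Lam (lt_translate F f z)) - of_nat q * fps_subst ?l H"
    by (simp add: sum_subtractf sum_distrib_left card_tors)
  also have "(\<Sum>z\<in>tors. Lam (lt_translate F f z)) = Lam (lt_trace f)"
    using finite_tors lt_translate_points[OF f] by (intro Lam_finsum[symmetric]) auto
  also have "of_nat q * fps_subst ?l H = fps_const \<pi> * Lam (lt_smul c_q (fps_subst f H))"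
  proof -
    have "Lam (lt_smul c_q (fps_subst f H)) = fps_const c_q * fps_subst ?l H"
      using f H_point by (simp add: Lam_smul c_q_OK fps_subst_points Lam_subst)
    moreover have "(of_nat q :: 'c fps) = fps_const \<pi> * fps_const c_q"
      using c_q_unif by (simp add: fps_of_nat[symmetric] mult.commute del: fps_of_nat)
    ultimately show ?thesis by (simp only: mult.assoc)
  qed
  finally show ?thesis by (simp add: right_diff_distrib)
qed

text \<open>Over the field \<open>H\<close> has a compositional inverse, its linear coefficient
  \<open>\<pi>\<close> being nonzero. Hence the series described by \<open>coleman_trace\<close>
  exists and is unique for every \<open>g\<close>.\<close>

lemma coleman_trace_eq_0_iff: "coleman_trace \<pi> F br g = 0 \<longleftrightarrow> translate_sum g = 0"
proof -
  have H1: "H $ 1 \<noteq> 0" using br_unif_nth_1 unif_nonzero by simp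
  let ?S = "translate_sum g"
  have inv: "fps_inv H oo H = fps_X" by (rule fps_inv[OF br_unif_nth_0 H1])
  have inv': "H oo fps_inv H = fps_X" by (rule fps_inv_right[OF br_unif_nth_0 H1])
  have i0: "fps_inv H $ 0 = 0" by (simp add: fps_inv_def)
  have ex: "(?S oo fps_inv H) oo H = ?S"
    using i0 br_unif_nth_0 by (simp add: fps_compose_assoc[symmetric] inv)
  have uniq: "h = h'" if "h oo H = h' oo H" for h h' :: "'c fps"
  proof -
    have "(k oo H) oo fps_inv H = k" for k :: "'c fps"
      using i0 br_unif_nth_0 by (simp add: fps_compose_assoc[symmetric] inv')
    then show ?thesis using that by metis
  qed
  have ct: "coleman_trace \<pi> F br g = (THE h. h oo H = ?S)" by (simp add: coleman_trace_def tors_def)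
  have "(THE h. h oo H = ?S) = ?S oo fps_inv H"
    by (rule the_equality) (use ex uniq in metis)+
  then have eq: "coleman_trace \<pi> F br g oo H = ?S" using ex ct by simp
  show ?thesis
  proof
    assume "coleman_trace \<pi> F br g = 0"
    then show "?S = 0" using eq by simp
  next
    assume "?S = 0"
    then have "coleman_trace \<pi> F br g oo H = 0 oo H" using eq by simp
    then show "coleman_trace \<pi> F br g = 0" by (rule uniq)
  qed
qed

lemma C'_set_iff:
  "g \<in> C'_set K \<pi> F br \<longleftrightarrow> g \<in> KF \<and> gauss_le 1 (absval \<pi>) g \<and> translate_sum g = 0 \<and> g $ 1 = 0"
  by (auto simp: C'_set_def C_set_def scaled_int_fps_iff coleman_trace_eq_0_iff)

lemma C'_integral: "g \<in> C'_set K \<pi> F br \<Longrightarrow> g \<in> integral_fps"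
  using unif_lt_1 unfolding C'_set_iff integral_gauss_le by (auto intro: gauss_le_mono)

lemma log_phi_nth_1: "f \<in> points \<Longrightarrow> log_phi f $ 1 = 0"
  using br_unif_nth_0 br_unif_nth_1
  by (simp add: log_phi_eq fps_subst_eq_compose fps_compose_nth)

lemma log_phi_C':
  assumes "f \<in> A_set K \<pi> F br"
  shows "log_phi f \<in> C'_set K \<pi> F br"
  using assms log_phi_scaled[of f] log_phi_nth_1[of f]
  by (auto simp: A_set_iff C'_set_iff translate_sum_log_phi)

lemma C'_module: "Module.module R (C'_module K \<pi> F br)"
proof -
  let ?C = "C'_set K \<pi> F br"
  have tr: "lt_translate F (g + h) z = lt_translate F g z + lt_translate F h z"
    "lt_translate F (fps_const a * g) z = fps_const a * lt_translate F g z"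
    if "g \<in> integral_fps" "h \<in> integral_fps" "z \<in> tors" for g h :: "'c fps" and z a
    using that translation_point
    by (simp_all add: lt_translate_def fps_subst_add fps_subst_cmult integral_convergent)
  have add: "g + h \<in> ?C" if "g \<in> ?C" "h \<in> ?C" for g h
  proof -
    have "translate_sum (g + h) = translate_sum g + translate_sum h"
      using tr(1)[OF C'_integral[OF that(1)] C'_integral[OF that(2)]] by (simp add: sum.distrib)
    then show ?thesis using that by (simp add: C'_set_iff KF_add gauss_le_add)
  qed
  have smul: "fps_const a * g \<in> ?C" if "a \<in> OK" "g \<in> ?C" for a g
  proof -
    have "translate_sum (fps_const a * g) = fps_const a * translate_sum g"
      using tr(2)[OF C'_integral[OF that(2)] C'_integral[OF that(2)]] by (simp add: sum_distrib_left)
    moreover have "gauss_le 1 (absval \<pi>) (fps_const a * g)"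
      using that by (intro gauss_le_integral_mult) (auto simp: C'_set_iff OK_def integral_fps_def)
    ultimately show ?thesis using that by (simp add: C'_set_iff KF_mult KF_const OK_def)
  qed
  have zero: "0 \<in> ?C"
    by (auto simp: C'_set_iff KF_zero gauss_le_def lt_translate_def)
  have "abelian_group (C'_module K \<pi> F br)"
  proof (rule abelian_groupI)
    fix x assume "x \<in> carrier (C'_module K \<pi> F br)"
    then have "fps_const (-1) * x \<in> ?C" using OK_ring by (intro smul) (auto simp: C'_module_def)
    moreover have "fps_const (-1) * x + x = 0" by (simp flip: fps_const_neg)
    ultimately show "\<exists>y\<in>carrier (C'_module K \<pi> F br).
        y \<oplus>\<^bsub>C'_module K \<pi> F br\<^esub> x = \<zero>\<^bsub>C'_module K \<pi> F br\<^esub>"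
      by (auto simp: C'_module_def)
  qed (auto simp: C'_module_def add zero)
  then show ?thesis
    using smul carrier_R
    by (intro moduleI R_cring) (auto simp: C'_module_def algebra_simps simp flip: fps_const_add fps_const_mult)
qed

subsection \<open>The kernel\<close>

lemma unif_power_diff:
  assumes "n \<noteq> 1"
  shows "\<pi> - \<pi> ^ n \<noteq> 0" and "n \<ge> 2 \<Longrightarrow> absval (\<pi> - \<pi> ^ n) = absval \<pi>"
proof -
  have *: "absval (\<pi> - \<pi> ^ n) = absval \<pi>" if "n \<ge> 2" for n
  proof -
    have "absval \<pi> ^ n < absval \<pi>"
      using power_strict_decreasing[of 1 n "absval \<pi>"] that unif_pos unif_lt_1 by simp
    then have "absval (- (\<pi> ^ n) + \<pi>) = absval \<pi>"
      by (intro absval_add_eq) (simp add: absval_power)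
    then show ?thesis by simp
  qed
  then show "n \<ge> 2 \<Longrightarrow> absval (\<pi> - \<pi> ^ n) = absval \<pi>" .
  show "\<pi> - \<pi> ^ n \<noteq> 0"
  proof (cases "n = 0")
    case True
    then show ?thesis using unif_lt_1 by auto
  next
    case False
    then have "n \<ge> 2" using assms by simp
    then show ?thesis using * unif_pos by (metis absval_zero less_irrefl)
  qed
qed

lemma compose_H_nth: "(l oo H) $ n = (\<Sum>k<n. l $ k * (H ^ k) $ n) + l $ n * \<pi> ^ n"
  by (simp add: fps_compose_nth atLeast0AtMost lessThan_Suc_atMost[symmetric] H_power_nth_diag)

lemma twisted_eigen_unique:
  assumes "fps_const \<pi> * l = l oo H" "l $ 1 = 0"
  shows "l = 0"
proof -
  have "l $ n = 0" for n
  proof (induction n rule: less_induct)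
    case (less n)
    show ?case
    proof (cases "n = 1")
      case False
      have "\<pi> * l $ n = (\<Sum>k<n. l $ k * (H ^ k) $ n) + l $ n * \<pi> ^ n"
        unfolding compose_H_nth[symmetric] assms(1)[symmetric] by simp
      then have "l $ n * (\<pi> - \<pi> ^ n) = 0" using less.IH by (simp add: algebra_simps)
      then show ?thesis using unif_power_diff(1)[OF False] by simp
    qed (use assms(2) in simp)
  qed
  then show ?thesis by (simp add: fps_eq_iff)
qed

lemma log_phi_eq_0_imp_End:
  assumes f: "f \<in> points" "f \<in> KF" and h: "log_phi f = 0"
  shows "f = br (Lam f $ 1)" "Lam f $ 1 \<in> OK"
proof -
  define a where "a = Lam f $ 1"
  have H0: "H $ 0 = 0" by (rule br_unif_nth_0)
  have "fps_const \<pi> * Lam f = Lam f oo H"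
    using log_phi_eq[OF f(1)] h H0 by (simp add: fps_subst_eq_compose)
  moreover have "fps_const \<pi> * lam = lam oo H" using lam_br[OF unif_OK] by simp
  ultimately have "fps_const \<pi> * (Lam f - fps_const a * lam) = (Lam f - fps_const a * lam) oo H"
    using H0 by (simp add: right_diff_distrib fps_compose_sub_distrib fps_compose_mult_distrib mult.left_commute)
  then have "Lam f - fps_const a * lam = 0"
    by (rule twisted_eigen_unique) (use lam_nth_1 in \<open>simp add: a_def\<close>)
  then have Lf: "Lam f = fps_const a * lam" by simp
  \<comment> \<open>A constant term in \<open>K\<close> of absolute value below 1 lies in the disc
    of radius \<open>absval \<pi>\<close>, where 0 is the only zero of the logarithm. Once it
    vanishes, the formal statement \<open>br_unique\<close> becomes applicable.\<close>
  have f0: "f $ 0 = 0"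
  proof (rule Lam_const_eq_0)
    show "absval (f $ 0) \<le> absval \<pi>"
      using f by (intro absval_le_unif KF_nth) (auto simp: points_def)
    have "((\<lambda>k. lam $ k * (f $ 0) ^ k) has_sum Lam f $ 0) UNIV"
      by (rule fps_subst_nth_0_has_sum[OF lam_convergent f(1)])
    moreover have "((\<lambda>k. lam $ k * (f $ 0) ^ k) has_sum Lam (fps_const (f $ 0)) $ 0) UNIV"
      using fps_subst_nth_0_has_sum[OF lam_convergent, of "fps_const (f $ 0)"] f(1)
      by (simp add: points_def)
    ultimately have "Lam (fps_const (f $ 0)) $ 0 = Lam f $ 0" by (rule has_sum_unique[rotated])
    then show "Lam (fps_const (f $ 0)) $ 0 = 0" by (simp add: Lf lam_nth_0)
  qed
  then have lf: "lam oo f = fps_const a * lam" using Lf by (simp add: fps_subst_eq_compose)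
  have "(lam oo f) $ 1 = f $ 1" using lam_nth_1 f0 by (simp add: fps_compose_nth)
  then have "a = f $ 1" using lf lam_nth_1 by simp
  then have aO: "a \<in> OK" using f by (simp add: OK_def points_def KF_nth)
  then show "Lam f $ 1 \<in> OK" by (simp add: a_def)
  show "f = br (Lam f $ 1)" using br_unique[OF aO f0 lf] by (simp add: a_def)
qed

lemma log_phi_br:
  assumes "a \<in> OK"
  shows "log_phi (br a) = 0"
proof -
  have "Lam (br a) = fps_const a * lam"
    using assms by (simp add: fps_subst_eq_compose br_nth_0 lam_br)
  then have "log_phi (br a) = fps_const \<pi> * (fps_const a * lam) - ((fps_const a * lam) oo H)"
    using assms by (simp add: log_phi_eq br_point fps_subst_eq_compose br_unif_nth_0)
  also have "(fps_const a * lam) oo H = fps_const a * (fps_const \<pi> * lam)"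
    using lam_br[OF unif_OK] br_unif_nth_0 by (simp add: fps_compose_mult_distrib)
  finally show ?thesis by (simp add: mult.left_commute)
qed

subsection \<open>Surjectivity\<close>

definition log_solution :: "'c fps \<Rightarrow> 'c fps" where
  "log_solution g = Abs_fps (twisted_coeff \<pi> H g)"

lemma log_solution_nth_1: "log_solution g $ 1 = 0"
  by (simp add: log_solution_def twisted_coeff.simps[of _ _ _ "Suc 0"])

lemma log_solution_eq:
  assumes "g $ 1 = 0"
  shows "fps_const \<pi> * log_solution g - (log_solution g oo H) = g"
proof (rule fps_ext)
  fix n
  let ?l = "log_solution g"
  show "(fps_const \<pi> * ?l - (?l oo H)) $ n = g $ n"
  proof (cases "n = 1")
    case True
    then show ?thesis
      using assms log_solution_nth_1[of g] by (simp add: compose_H_nth)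
  next
    case False
    have "?l $ n = (g $ n + (\<Sum>k<n. ?l $ k * (H ^ k) $ n)) / (\<pi> - \<pi> ^ n)"
      using False by (simp add: log_solution_def twisted_coeff.simps[of _ _ _ n])
    then have "?l $ n * (\<pi> - \<pi> ^ n) = g $ n + (\<Sum>k<n. ?l $ k * (H ^ k) $ n)"
      using unif_power_diff(1)[OF False] by simp
    then show ?thesis by (simp add: compose_H_nth algebra_simps)
  qed
qed

text \<open>Honda's argument: if the coefficients of \<open>f\<close> below \<open>n\<close> are integral, then applying
  \<open>log_phi_scaled\<close> to the truncation of \<open>f\<close> shows that \<open>(\<pi> - \<pi>^n) f\<^sub>n\<close> is divisible by \<open>\<pi>\<close>.\<close>

lemma honda_integrality:
  assumes f0: "f $ 0 = 0" and f1: "f $ 1 = 0"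
    and g: "g = fps_const \<pi> * (lam oo f) - ((lam oo f) oo H)" "g \<in> KF" "gauss_le 1 (absval \<pi>) g"
  shows "f $ n \<in> OK"
proof (induction n rule: less_induct)
  case (less n)
  consider "n = 0" | "n = 1" | "n \<ge> 2" by linarith
  then show ?case
  proof cases
    case 3
    define f' where "f' = fps_cutoff n f"
    have "f' $ m \<in> OK" for m using less.IH OK_ring(1) by (auto simp: f'_def)
    then have f': "f' \<in> points" "f' \<in> KF" "f' $ 0 = 0"
      using f0 by (auto simp: points_def KF_def OK_def f'_def)
    define d where "d = (lam oo f) - (lam oo f')"
    have d: "d $ m = (if m = n then f $ n else 0)" if "m \<le> n" for m
      unfolding d_def f'_def using that 3 f0 lam_nth_1 by (intro compose_cutoff_diff) auto
    have "Lam f' = lam oo f'" using f'(3) by (rule fps_subst_eq_compose)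
    then have lp: "log_phi f' = fps_const \<pi> * (lam oo f') - ((lam oo f') oo H)"
      using f' by (simp add: log_phi_eq fps_subst_eq_compose br_unif_nth_0)
    have "g - log_phi f' = fps_const \<pi> * d - (d oo H)"
      unfolding lp g(1) d_def by (simp add: fps_compose_sub_distrib algebra_simps)
    then have "(g - log_phi f') $ n = \<pi> * d $ n - (d oo H) $ n" by simp
    \<comment> \<open>Up to degree \<open>n\<close> the only nonzero coefficient of \<open>d\<close>
      can be \<open>d $ n = f $ n\<close>, so only the diagonal term of \<open>d o H\<close>
      survives.\<close>
    also have "\<dots> = f $ n * (\<pi> - \<pi> ^ n)"
      unfolding compose_H_nth using d by (simp add: algebra_simps)
    finally have eq: "f $ n * (\<pi> - \<pi> ^ n) = (g - log_phi f') $ n" ..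
    have n1: "n \<noteq> 1" using 3 by simp
    have "g - log_phi f' \<in> KF" using g(2) log_phi_scaled(1)[OF f'(1,2)] by (rule KF_diff)
    then have "f $ n * (\<pi> - \<pi> ^ n) / (\<pi> - \<pi> ^ n) \<in> K"
      unfolding eq by (intro K_divide KF_nth K_diff K_power unif_K)
    then have fK: "f $ n \<in> K" using unif_power_diff(1)[OF n1] by simp
    have "gauss_le 1 (absval \<pi>) (g - log_phi f')"
      using g(3) log_phi_scaled(2)[OF f'(1,2)] by (rule gauss_le_diff)
    then have "absval (f $ n * (\<pi> - \<pi> ^ n)) \<le> absval \<pi>"
      unfolding eq by (simp add: gauss_le_def del: fps_sub_nth)
    then have "absval (f $ n) * absval \<pi> \<le> 1 * absval \<pi>"
      using unif_power_diff(2)[OF n1 3] by (simp add: absval_mult)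
    then have "absval (f $ n) \<le> 1" using unif_pos by simp
    then show ?thesis using fK by (simp add: OK_def)
  qed (use f0 f1 OK_ring(1) in auto)
qed

text \<open>A torsion point has absolute value at most \<open>absval \<pi>\<close> to the power \<open>1 / (q - 1)\<close>; the logarithm is
  injective on the smaller disc defined here.\<close>

definition small :: "'c \<Rightarrow> bool" where
  "small x \<longleftrightarrow> absval x ^ (q - 1) < absval \<pi>"

lemma small_mono: "small y \<Longrightarrow> absval x \<le> absval y \<Longrightarrow> small x"
  unfolding small_def by (meson absval_nonneg le_less_trans power_mono)

lemma small_if_le_unif: "absval x \<le> absval \<pi> \<Longrightarrow> small x"
proof -
  assume "absval x \<le> absval \<pi>"
  then have "absval x ^ (q - 1) \<le> absval \<pi> ^ (q - 1)" by (intro power_mono) auto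
  also have "\<dots> < absval \<pi> ^ 1"
    using unif_pos unif_lt_1 q_ge_3 by (intro power_strict_decreasing) auto
  finally show ?thesis by (simp add: small_def)
qed

lemma small_lt_add:
  assumes "u \<in> points" "v \<in> points" "small (u $ 0)" "small (v $ 0)"
  shows "small (lt_add u v $ 0)"
  using lt_add_nth_0_le[OF assms(1,2)] assms(3,4) small_mono
  by (cases "absval (u $ 0) \<le> absval (v $ 0)") (auto simp: max_def)

lemma small_lt_smul: "a \<in> OK \<Longrightarrow> u \<in> points \<Longrightarrow> small (u $ 0) \<Longrightarrow> small (lt_smul a u $ 0)"
  using lt_smul_nth_0_le small_mono by blast

lemma small_finsum:
  assumes "finite B" "g \<in> B \<rightarrow> points" "\<And>z. z \<in> B \<Longrightarrow> small (g z $ 0)"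
  shows "small (finsum pts g B $ 0)"
  using assms
proof (induction B rule: finite_induct)
  case empty
  then show ?case by (simp add: small_if_le_unif)
next
  case (insert b B)
  have "finsum pts g B \<in> points" using pts.finsum_closed[of g B] insert.prems by auto
  then show ?case using insert by (simp add: Pi_iff small_lt_add)
qed

lemma tors_power_le:
  assumes "z \<in> tors"
  shows "absval z ^ (q - 1) \<le> absval \<pi>"
proof (rule root_absval_le[where g = "fps_nth H"])
  show "((\<lambda>n. H $ n * z ^ n) has_sum 0) UNIV" "absval z < 1"
    using assms by (simp_all add: tors_def torsion0_def)
qed (auto simp: br_unif_nth_0 br_unif_nth_q br_unif_nth_le)

text \<open>As \<open>f\<close> starts in degree 2, its value at a point of size at most
  \<open>absval z\<close> is bounded by \<open>absval z ^ 2\<close>, and squaring turns the bound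
  \<open>absval \<pi>\<close> of \<open>tors_power_le\<close> into \<open>absval \<pi> ^ 2\<close>.
  With a linear term the value could be as large as \<open>z\<close> itself.\<close>

lemma small_translate:
  assumes f: "f \<in> points" "f $ 0 = 0" "f $ 1 = 0" and z: "z \<in> tors"
  shows "small (lt_translate F f z $ 0)"
proof -
  define w where "w = lt_add fps_X (fps_const z)"
  have z1: "absval z < 1" using z by (simp add: tors_iff)
  have w: "w \<in> points" unfolding w_def using z by (rule translation_point)
  have wz: "absval (w $ 0) \<le> absval z"
    using lt_add_nth_0_le[OF fps_X_point, of "fps_const z"] z1 by (simp add: w_def)
  have "absval (fps_subst f w $ 0) \<le> absval (z ^ 2)"
  proof (rule absval_has_sum_le[OF fps_subst_nth_0_has_sum])
    fix k :: nat
    consider "k = 0" | "k = 1" | "k \<ge> 2" by linarith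
    then show "absval (f $ k * (w $ 0) ^ k) \<le> absval (z ^ 2)"
    proof cases
      case 3
      have "absval (w $ 0) ^ k \<le> absval z ^ k" using wz by (rule power_mono) simp
      also have "\<dots> \<le> absval z ^ 2" using 3 z1 by (intro power_decreasing) auto
      finally have "absval (f $ k) * absval (w $ 0) ^ k \<le> 1 * absval z ^ 2"
        using f(1) by (intro mult_mono) (auto simp: points_def)
      then show ?thesis by (simp add: absval_mult absval_power)
    qed (use f in auto)
  qed (use f w in \<open>auto simp: integral_convergent points_integral\<close>)
  moreover have "small (z ^ 2)"
  proof -
    have "absval (z ^ 2) ^ (q - 1) = absval z ^ (q - 1) * absval z ^ (q - 1)"
      by (simp only: absval_power absval_mult power2_eq_square power_mult_distrib)
    also have "\<dots> \<le> absval \<pi> * absval \<pi>"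
      using tors_power_le[OF z] by (intro mult_mono) auto
    also have "\<dots> < absval \<pi>" using unif_pos unif_lt_1 by simp
    finally show ?thesis by (simp add: small_def)
  qed
  ultimately show ?thesis
    unfolding lt_translate_def w_def[symmetric] by (rule small_mono[rotated])
qed

text \<open>On the disc of radius \<open>absval \<pi>\<close> the logarithm is a small perturbation
  of the identity, and the iteration stays in \<open>K\<close> because \<open>K\<close> is
  closed.\<close>

lemma Lam_const_surj:
  assumes "y \<in> K" "absval y \<le> absval \<pi>"
  shows "\<exists>c\<in>K. absval c \<le> absval \<pi> \<and> Lam (fps_const c) = fps_const y"
proof -
  have "\<exists>c\<in>K. absval c \<le> absval \<pi> \<and> Lam (fps_const c) $ 0 = y"
  proof (rule contraction_solve[where a = 1 and \<rho> = "absval \<pi>"])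
    show "absval (lam $ n) * absval \<pi> ^ n \<le> absval \<pi> * absval 1 * absval \<pi>" if "n \<ge> 2" for n
      using lam_nth_scaled_le[OF that] by (simp add: power2_eq_square)
  qed (use assms lam_nth_0 lam_nth_1 lam_nth_K lam_convergent unif_pos unif_lt_1 K_closed K_zero K_one
      K_add K_diff K_mult in auto)
  then obtain c where c: "c \<in> K" "absval c \<le> absval \<pi>" "Lam (fps_const c) $ 0 = y" by blast
  have "absval c < 1" using c(2) unif_lt_1 by simp
  then have "Lam (fps_const c) = fps_const y"
    using fps_subst_const_const[OF lam_convergent, of c] c(3) by simp
  then show ?thesis using c by blast
qed

lemma log_phi_surj:
  assumes g: "g \<in> C'_set K \<pi> F br"
  shows "\<exists>f\<in>A_set K \<pi> F br. Lam f $ 1 = 0 \<and> log_phi f = g"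
proof -
  have gK: "g \<in> KF" and g\<pi>: "gauss_le 1 (absval \<pi>) g" and gtr: "translate_sum g = 0" and g1: "g $ 1 = 0"
    using g by (simp_all add: C'_set_iff)
  define l where "l = log_solution g"
  have l1: "l $ 1 = 0" and leq: "fps_const \<pi> * l - (l oo H) = g"
    unfolding l_def using log_solution_nth_1 log_solution_eq[OF g1] by auto
  have "(fps_const \<pi> * l - (l oo H)) $ 0 = g $ 0" by (simp only: leq)
  \<comment> \<open>Degree 0 of the equation, where \<open>l o H\<close> contributes just
    \<open>l $ 0\<close>; the factor \<open>\<pi> - 1\<close> is a unit.\<close>
  then have l0: "l $ 0 * (\<pi> - 1) = g $ 0" by (simp add: algebra_simps)
  have p1: "absval (\<pi> - 1) = 1" using absval_1_minus[OF unif_lt_1] by (simp add: absval_minus_commute)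
  then have "\<pi> - 1 \<noteq> 0" by auto
  then have "l $ 0 = g $ 0 / (\<pi> - 1)" using l0 by (simp add: field_simps)
  then have "l $ 0 \<in> K" using gK by (simp add: K_divide KF_nth K_diff unif_K K_one)
  moreover have "absval (l $ 0) \<le> absval \<pi>"
  proof -
    have "absval (l $ 0) = absval (g $ 0)" using l0 p1 by (metis absval_mult mult.right_neutral)
    then show ?thesis using g\<pi>[unfolded gauss_le_def, rule_format, of 0] by simp
  qed
  ultimately obtain c where c: "c \<in> K" "absval c \<le> absval \<pi>" "Lam (fps_const c) = fps_const (l $ 0)"
    using Lam_const_surj by blast
  have c1: "absval c < 1" using c(2) unif_lt_1 by simp
  \<comment> \<open>Formal composition with \<open>fps_inv lam\<close> needs a zero constant term.
    The constant part of \<open>l\<close> is therefore realised separately, as the logarithm of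
    \<open>c\<close>, and the two parts are added in the formal group.\<close>
  define lp where "lp = l - fps_const (l $ 0)"
  have lam1: "lam $ 1 \<noteq> 0" using lam_nth_1 by simp
  define fp where "fp = fps_inv lam oo lp"
  have lam_inv: "lam oo fps_inv lam = fps_X" by (rule fps_inv_right[OF lam_nth_0 lam1])
  have i0: "fps_inv lam $ 0 = 0" by (simp add: fps_inv_def)
  have lp0: "lp $ 0 = 0" by (simp add: lp_def)
  have lfp: "lam oo fp = lp"
    unfolding fp_def using lp0 i0 by (simp add: fps_compose_assoc lam_inv)
  have fp0: "fp $ 0 = 0" by (simp add: fp_def i0)
  have "(lam oo fp) $ 1 = fp $ 1" using lam_nth_1 fp0 by (simp add: fps_compose_nth)
  then have fp1: "fp $ 1 = 0" using l1 by (simp add: lfp lp_def)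
  define gp where "gp = g - fps_const (g $ 0)"
  have gp: "gp = fps_const \<pi> * (lam oo fp) - ((lam oo fp) oo H)"
  proof -
    have "fps_const \<pi> * lp - (lp oo H) = g - fps_const (l $ 0 * (\<pi> - 1))"
      unfolding lp_def leq[symmetric]
      by (simp add: fps_compose_sub_distrib algebra_simps flip: fps_const_mult fps_const_sub)
    then show ?thesis by (simp add: gp_def lfp l0)
  qed
  have "gp \<in> KF" unfolding gp_def using gK by (intro KF_diff) (auto simp: KF_const KF_nth)
  moreover have "gauss_le 1 (absval \<pi>) gp"
    unfolding gp_def using g\<pi> by (intro gauss_le_diff gauss_le_const) (auto simp: gauss_le_def dest: spec[of _ 0])
  ultimately have fpO: "fp $ n \<in> OK" for n
    by (rule honda_integrality[OF fp0 fp1 gp])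
  then have fp: "fp \<in> points" "fp \<in> KF" using fp0 by (auto simp: points_def KF_def OK_def)
  have cp: "fps_const c \<in> points" "fps_const c \<in> KF" using c c1 by (auto simp: KF_const)
  define f where "f = lt_add (fps_const c) fp"
  have f: "f \<in> points" "f \<in> KF" unfolding f_def using cp fp by (auto intro: lt_add_points KF_lt_add)
  have "Lam fp = lp" using fp0 lfp by (simp add: fps_subst_eq_compose)
  then have Lf: "Lam f = l" unfolding f_def using cp fp c(3) by (simp add: Lam_add lp_def)
  have hf: "log_phi f = g"
    using f(1) leq by (simp add: log_phi_eq Lf fps_subst_eq_compose br_unif_nth_0)
  have fc: "absval (f $ 0) \<le> absval c"
    using lt_add_nth_0_le[OF cp(1) fp(1)] fp0 by (simp add: f_def)
  have "lt_trace f = lt_smul c_q (fps_subst f H)"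
  proof (rule lt_add_neg_eq_0_iff)
    let ?u = "lt_trace f" and ?v = "lt_smul c_q (fps_subst f H)"
    have m: "-1 \<in> OK" by (intro OK_ring)
    show u: "?u \<in> points" using f(1) by (rule lt_trace_points)
    have fH: "fps_subst f H \<in> points" using f(1) H_point by (rule fps_subst_points)
    then show v: "?v \<in> points" by (rule lt_smul_points[OF c_q_OK])
    have "fps_const \<pi> * (Lam ?u - Lam ?v) = 0"
      using translate_sum_log_phi[OF f(1)] gtr by (simp add: hf)
    then have "Lam ?u = Lam ?v" using unif_nonzero by simp
    then have L0: "Lam (lt_add ?u (lt_smul (-1) ?v)) = 0"
      using u v m by (simp add: Lam_add Lam_smul lt_smul_points flip: fps_const_neg)
    have "small (lt_translate F f z $ 0)" if z: "z \<in> tors" for z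
    proof -
      have w: "lt_add fps_X (fps_const z) \<in> points" using z by (rule translation_point)
      \<comment> \<open>Constants are unaffected by translation, so each translate of
        \<open>f\<close> is the small constant \<open>c\<close> plus a translate of
        \<open>fp\<close>, to which \<open>small_translate\<close> applies.\<close>
      have "lt_translate F (fps_const c) z = fps_const c"
        unfolding lt_translate_def using fps_subst_cmult[OF integral_convergent[OF integral_one] w, of c] by simp
      then have "lt_translate F f z = lt_add (fps_const c) (lt_translate F fp z)"
        unfolding lt_translate_def f_def using cp fp w by (simp add: fps_subst_of_subst2 F_integral)
      then show ?thesis
        using small_lt_add[OF cp(1) lt_translate_points[OF fp(1) z]] small_translate[OF fp(1) fp0 fp1 z]
          small_if_le_unif[OF c(2)] by simp
    qed
    then have su: "small (?u $ 0)"
      using finite_tors lt_translate_points[OF f(1)] by (intro small_finsum) auto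
    have "fps_subst f H $ 0 = f $ 0" by (simp add: fps_subst_eq_compose br_unif_nth_0)
    then have "small (fps_subst f H $ 0)" using small_if_le_unif fc c(2) by simp
    then have sv: "small (?v $ 0)" using small_lt_smul[OF c_q_OK fH] by simp
    have "small (lt_add ?u (lt_smul (-1) ?v) $ 0)"
      by (rule small_lt_add[OF u lt_smul_points[OF m v] su small_lt_smul[OF m v sv]])
    then show "lt_add ?u (lt_smul (-1) ?v) = 0"
      unfolding small_def by (rule Lam_eq_0_imp_eq_0[OF lt_add_points[OF u lt_smul_points[OF m v]] L0])
  qed
  then have "f \<in> A_set K \<pi> F br" using f by (simp add: A_set_iff)
  then show ?thesis using hf Lf l1 by blast
qed

text \<open>The formal difference has image 0, hence is \<open>[a]\<close> with \<open>a\<close> the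
  linear coefficient of its logarithm, which is 0.\<close>

lemma log_phi_inj:
  assumes "f1 \<in> A_set K \<pi> F br" "f2 \<in> A_set K \<pi> F br" "Lam f1 $ 1 = Lam f2 $ 1" "log_phi f1 = log_phi f2"
  shows "f1 = f2"
proof -
  have m: "-1 \<in> OK" by (intro OK_ring)
  have f: "f1 \<in> points" "f1 \<in> KF" "f2 \<in> points" "f2 \<in> KF" using assms by (auto simp: A_set_iff)
  let ?d = "lt_add f1 (lt_smul (-1) f2)"
  have d: "?d \<in> points" "?d \<in> KF"
    using f m by (auto intro!: lt_add_points lt_smul_points KF_lt_add KF_lt_smul)
  have "log_phi ?d = 0"
    using f m assms(4) by (simp add: log_phi_add log_phi_smul lt_smul_points flip: fps_const_neg)
  moreover have "Lam ?d $ 1 = 0"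
    using f m assms(3) by (simp add: Lam_add Lam_smul lt_smul_points flip: fps_const_neg)
  ultimately have "?d = 0" using log_phi_eq_0_imp_End(1)[OF d] br_zero by simp
  then show ?thesis by (rule lt_add_neg_eq_0_iff[OF f(1,3)])
qed

subsection \<open>The split exact sequence\<close>

lemma exact_sequence:
  "module_short_exact R (End_module K F br) (A_module K \<pi> F br) (C'_module K \<pi> F br) (\<lambda>f. f) log_phi"
  unfolding module_short_exact_def
proof (intro conjI)
  show "Module.module R (End_module K F br)"
    unfolding End_module_def by (rule submodule.submodule_is_module[OF End_submodule pts_module])
  show "Module.module R (A_module K \<pi> F br)"
    unfolding A_module_def by (rule submodule.submodule_is_module[OF A_submodule pts_module])
  show "Module.module R (C'_module K \<pi> F br)" by (rule C'_module)
  show "linear_map R (End_module K F br) (A_module K \<pi> F br) (\<lambda>f. f)"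
    using End_subset_A by (auto simp: linear_map_def End_module_def A_module_def)
  show "linear_map R (A_module K \<pi> F br) (C'_module K \<pi> F br) log_phi"
    unfolding linear_map_def carrier_R
    by (auto simp: A_module_def C'_module_def log_phi_C' log_phi_add log_phi_smul A_set_iff[of "_"]
        dest: log_phi_C')
  show "inj_on (\<lambda>f. f) (carrier (End_module K F br))" by simp
  have E: "End_set K br = br ` OK" by (simp only: End_set_def carrier_R)
  have "f \<in> End_set K br \<longleftrightarrow> f \<in> A_set K \<pi> F br \<and> log_phi f = 0" for f
  proof
    assume "f \<in> End_set K br"
    then show "f \<in> A_set K \<pi> F br \<and> log_phi f = 0"
      using End_subset_A by (auto simp: E log_phi_br)
  next
    assume f: "f \<in> A_set K \<pi> F br \<and> log_phi f = 0"
    then have "f \<in> points" "f \<in> KF" "log_phi f = 0" by (auto simp: A_set_iff)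
    from log_phi_eq_0_imp_End[OF this] show "f \<in> End_set K br" unfolding E by (rule image_eqI)
  qed
  then show "(\<lambda>f. f) ` carrier (End_module K F br) =
      {x \<in> carrier (A_module K \<pi> F br). log_phi x = \<zero>\<^bsub>C'_module K \<pi> F br\<^esub>}"
    by (auto simp: End_module_def A_module_def C'_module_def)
  show "log_phi ` carrier (A_module K \<pi> F br) = carrier (C'_module K \<pi> F br)"
    using log_phi_C' log_phi_surj by (force simp: A_module_def C'_module_def)
qed

lemma split_sequence: "split_by_section R (A_module K \<pi> F br) (C'_module K \<pi> F br) log_phi"
proof -
  let ?A = "A_set K \<pi> F br" and ?C = "C'_set K \<pi> F br"
  have "\<forall>g\<in>?C. \<exists>f. f \<in> ?A \<and> Lam f $ 1 = 0 \<and> log_phi f = g" using log_phi_surj by blast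
  then obtain s where s: "\<And>g. g \<in> ?C \<Longrightarrow> s g \<in> ?A" "\<And>g. g \<in> ?C \<Longrightarrow> Lam (s g) $ 1 = 0"
    "\<And>g. g \<in> ?C \<Longrightarrow> log_phi (s g) = g" by metis
  have sp: "s g \<in> points" if "g \<in> ?C" for g using s(1)[OF that] by (simp add: A_set_iff)
  interpret C: Module.module R "C'_module K \<pi> F br" by (rule C'_module)
  note A_closed = pts.submoduleE(4,5)[OF A_submodule, unfolded pts_simps]
  \<comment> \<open>The section comes from a choice of preimages; it is linear because both sides
    lie in \<open>A_set\<close>, have the same image and have logarithms without linear term, so
    \<open>log_phi_inj\<close> identifies them.\<close>
  have add: "s (g + h) = lt_add (s g) (s h)" if "g \<in> ?C" "h \<in> ?C" for g h
  proof (rule log_phi_inj)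
    have gh: "g + h \<in> ?C"
      using C.a_closed[of g h] that by (simp add: C'_module_def)
    show "s (g + h) \<in> ?A" using gh by (rule s)
    show "lt_add (s g) (s h) \<in> ?A" using that s(1) A_closed(2) by blast
    show "Lam (s (g + h)) $ 1 = Lam (lt_add (s g) (s h)) $ 1"
      using s(2)[OF gh] s(2)[OF that(1)] s(2)[OF that(2)] sp that by (simp add: Lam_add)
    show "log_phi (s (g + h)) = log_phi (lt_add (s g) (s h))"
      using s(3) gh that sp by (simp add: log_phi_add)
  qed
  have smul: "s (fps_const a * g) = lt_smul a (s g)" if "a \<in> OK" "g \<in> ?C" for a g
  proof (rule log_phi_inj)
    have ag: "fps_const a * g \<in> ?C"
      using C.smult_closed[of a g] that by (simp add: C'_module_def OK_def)
    show "s (fps_const a * g) \<in> ?A" using ag by (rule s)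
    show "lt_smul a (s g) \<in> ?A" using that s(1) A_closed(1) carrier_R by blast
    show "Lam (s (fps_const a * g)) $ 1 = Lam (lt_smul a (s g)) $ 1"
      using s(2)[OF ag] s(2)[OF that(2)] sp that by (simp add: Lam_smul)
    show "log_phi (s (fps_const a * g)) = log_phi (lt_smul a (s g))"
      using s(3) ag that sp by (simp add: log_phi_smul)
  qed
  have "linear_map R (C'_module K \<pi> F br) (A_module K \<pi> F br) s"
    unfolding linear_map_def carrier_R
    using s(1) add smul by (auto simp: A_module_def C'_module_def)
  then show ?thesis
    unfolding split_by_section_def using s(3) by (auto simp: C'_module_def)
qed

end

theorem theorem2p1p5:
  fixes p :: nat
    and K :: "'c::{nonarch_field, alg_closed_field, complete_space} set"
    and \<pi> :: 'c
    and F :: "'c fps fps"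
    and br :: "'c \<Rightarrow> 'c fps"
  assumes "finite_padic_extension p K"
    and "uniformizer K \<pi>"
    and "residue_card K > 2"
    and "lubin_tate K \<pi> F br"
  shows "module_short_exact (ring_of_integers K)
           (End_module K F br) (A_module K \<pi> F br) (C'_module K \<pi> F br)
           (\<lambda>f. f) (\<lambda>f. fps_subst (formal_log F) (lt_phi \<pi> F br f))
       \<and> split_by_section (ring_of_integers K) (A_module K \<pi> F br) (C'_module K \<pi> F br)
           (\<lambda>f. fps_subst (formal_log F) (lt_phi \<pi> F br f))"
proof -
  interpret lubin_tate_module p K \<pi> F br
    using assms by unfold_locales
  show ?thesis
    using exact_sequence split_sequence unfolding log_phi_def[abs_def] by blast
qed

end
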